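(* Let $(C,o)$ be a complex analytic isolated curve singularity, with conductor $c$, delta invariant $\delta(C,o)$, lattice homology $\mathbb{H}_*(C,o)$, spaces $S_n$, and series $PE_\infty(T,Q,h)$ as defined in the context. Then: (a) $PE_\infty(1,Q,h)=\sum_{n\ge m_w}\big(\sum_b \mathrm{rank}\,H_b(S_n,\mathbb{Z})\,h^b\big)\cdot Q^n$, which is the Poincaré series $\sum_{n,b}\mathrm{rank}\,(\mathbb{H}_b(C,o))_{-2n}\,Q^nh^b$ of $\mathbb{H}_*(C,o)$. (b) $PE_\infty(1,Q,-1)=\sum_{n\ge m_w}\chi_{top}(S_n)\cdot Q^n$, where $\chi_{top}$ denotes the topological Euler characteristic. (c) Let $R=\{x\in\mathbb{R}^r : 0\le x\le c'\}$ be any rectangle with $c'\in\mathbb{Z}^r$, $c'\ge c$. Then $$PE_\infty(1,Q,-1)=\frac{1}{1-Q}\cdot\sum_{\square_q\subset R}(-1)^q\,Q^{w(\square_q)},$$ where the sum runs over all cubes $\square_q$ contained in $R$, of all dimensions $q$. (d) $$\lim_{Q\to 1}\Big(PE_\infty(1,Q,-1)-\frac{1}{1-Q}\Big)=eu(\mathbb{H}_*(C,o))=\delta(C,o).$$ (e) For two series $P,P'$ write $P\ge P'$ if all coefficients of $P-P'$ are nonnegative. Then $$PE_\infty(1,Q,h)\ \ge\ PE_\infty(1,Q,h=0)\ \ge\ \frac{1}{1-Q},$$ and $PE_\infty(1,Q,h=0)-1/(1-Q)$ is finitely supported. (Here $1/(1-Q)=\sum_{n\ge0}Q^n$.)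
   Context: Let $(C,o)$ be a complex analytic isolated curve singularity with local ring $\mathcal{O}$ and irreducible components $(C_1,o),\dots,(C_r,o)$. Let $\overline{\mathcal{O}}=\bigoplus_{i=1}^r\mathbb{C}\{t_i\}$ be the integral closure of $\mathcal O$ and $\mathfrak{v}_i(f)=\mathrm{ord}_{t_i}(f)\in\mathbb{Z}_{\ge0}\cup\{\infty\}$ the $i$-th valuation. The delta invariant is $\delta(C,o)=\dim_{\mathbb C}\overline{\mathcal O}/\mathcal O$. The conductor ideal $(\mathcal O:\overline{\mathcal O})$ has the form $(t_1^{c_1},\dots,t_r^{c_r})\overline{\mathcal O}$, and $c=(c_1,\dots,c_r)$ is called the conductor. For $l\in(\mathbb{Z}_{\ge0})^r$ put $\mathcal F(l)=\{f\in\mathcal O:\mathfrak v_i(f)\ge l_i \ \forall i\}$, $\mathfrak h(l)=\dim_{\mathbb C}\mathcal O/\mathcal F(l)$ (Hilbert function), $|l|=\sum_i l_i$, and $w(l)=2\mathfrak h(l)-|l|$. Inequalities between vectors are coordinatewise. Let $E_1,\dots,E_r$ be the standard basis of $\mathbb Z^r$. Let $\mathfrak X=(\mathbb R_{\ge0})^r$ with its cubical decomposition: for $l\in(\mathbb Z_{\ge0})^r$ and $I\subset\{1,\dots,r\}$, the cube $(l,I)$ has dimension $|I|$ and vertices $l+\sum_{i\in I'}E_i$, $I'\subset I$. A cube of dimension $q$ is denoted $\square_q$. The weight $w(\square)$ of a cube is the maximum of $w$ over its vertices. For $n\in\mathbb Z$, $S_n\subset\mathfrak X$ is the union of all cubes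 with $w(\square)\le n$ (a finite cubical complex); $m_w=\min_{l}w(l)$, so $S_n=\emptyset$ for $n<m_w$. The lattice homology is $\mathbb H_*(C,o)=\bigoplus_{q\ge0}\mathbb H_q(C,o)$, $\mathbb H_q(C,o)=\bigoplus_{n}H_q(S_n,\mathbb Z)$, where $(\mathbb H_q(C,o))_{-2n}=H_q(S_n,\mathbb Z)$ is the part of degree $-2n$. The reduced part is $\mathbb H_{0,red}=\bigoplus_{n\ge m_w}\widetilde H_0(S_n,\mathbb Z)$ and $\mathbb H_{q,red}=\mathbb H_q$ for $q>0$; its total $\mathbb Z$-rank is finite, and the Euler characteristic is $eu(\mathbb H_*(C,o))=-m_w+\sum_q(-1)^q\,\mathrm{rank}_{\mathbb Z}\,\mathbb H_{q,red}(C,o)$. For $d\ge0$ let $\mathfrak X_{-d}$ be the union of the cubes $(l,I)$ with $|l|\ge d$. For each $n$, the finite increasing (in the index $-d$) filtration $\{S_n\cap\mathfrak X_{-d}\}_{d\ge0}$ of $S_n$ induces a homological spectral sequence $(E^k_{-d,q})_n\Rightarrow(E^\infty_{-d,q})_n$ with $(E^1_{-d,q})_n=H_{-d+q}(S_n\cap\mathfrak X_{-d},S_n\cap\mathfrak X_{-d-1},\mathbb Z)$ and $(E^\infty_{-d,q})_n=F_{-d}H_{-d+q}(S_n,\mathbb Z)/F_{-d-1}H_{-d+q}(S_n,\mathbb Z)$, where $F_{-d}H_b(S_n,\mathbb Z)=\mathrm{im}(H_b(S_n\cap\mathfrak X_{-d},\mathbb Z)\to H_b(S_n,\mathbb Z))$.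 For $1\le k\le\infty$, $$PE_k(T,Q,h)=\sum_{d,q,n}\mathrm{rank}\,(E^k_{-d,q})_n\cdot T^dQ^nh^{-d+q}\in\mathbb Z[[T,Q]][Q^{-1},h].$$ *)

theory Defs
  imports
    "HOL-Library.Groups_Big_Fun"
    "HOL-Complex_Analysis.Complex_Analysis"
    "HOL-Homology.Homology"
begin

unbundle no fps_syntax

section \<open>Isolated curve singularities and their normalization\<close>

definition mv_holomorphic_on :: "(complex^'n \<Rightarrow> complex) \<Rightarrow> (complex^'n) set \<Rightarrow> bool" where
  "mv_holomorphic_on f U \<longleftrightarrow>
     (\<forall>x\<in>U. \<exists>D. (f has_derivative D) (at x) \<and> (\<forall>c v. D (c *s v) = c * D v))"

definition holomorphic_germ :: "(complex^'n \<Rightarrow> complex) \<Rightarrow> complex^'n \<Rightarrow> bool" where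
  "holomorphic_germ f p \<longleftrightarrow> (\<exists>U. open U \<and> p \<in> U \<and> mv_holomorphic_on f U)"

definition analytic_set_in :: "(complex^'n) set \<Rightarrow> (complex^'n) set \<Rightarrow> bool" where
  "analytic_set_in C U \<longleftrightarrow>
     (\<exists>Fs. finite Fs \<and> (\<forall>f\<in>Fs. mv_holomorphic_on f U) \<and> C \<inter> U = {x\<in>U. \<forall>f\<in>Fs. f x = 0})"

definition smooth_curve_at :: "(complex^'n) set \<Rightarrow> complex^'n \<Rightarrow> bool" where
  "smooth_curve_at C x \<longleftrightarrow>
     (\<exists>V W \<phi> \<psi>. open V \<and> x \<in> V \<and> open W \<and>
        (\<forall>j. (\<lambda>t. \<phi> t $ j) holomorphic_on W) \<and>
        (\<forall>t\<in>W. \<exists>j. deriv (\<lambda>t. \<phi> t $ j) t \<noteq> 0) \<and>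
        homeomorphism W (C \<inter> V) \<phi> \<psi>)"

text \<open>
  Only the germ of \<open>C\<close> at \<open>p\<close> matters. The limit point condition excludes an isolated point,
  and as usual the smooth germ counts as a (trivial) singularity.
\<close>

definition isolated_curve_singularity :: "(complex^'n) set \<Rightarrow> complex^'n \<Rightarrow> bool" where
  "isolated_curve_singularity C p \<longleftrightarrow>
     p \<in> C \<and> p islimpt C \<and>
     (\<exists>U. open U \<and> p \<in> U \<and> analytic_set_in C U \<and> (\<forall>x\<in>C \<inter> U - {p}. smooth_curve_at C x))"

text \<open>The product of the rings of convergent power series in \<open>t\<^sub>i\<close>.\<close>

definition conv_ring :: "(complex fps ^ 'r) set" where
  "conv_ring = {F. \<forall>i. fps_conv_radius (F $ i) > 0}"

text \<open>
  The image of the local ring at \<open>p\<close> under pullback along the parametrizations \<open>\<gamma> i\<close>. When the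
  only germs pulling back to \<open>0\<close> are those vanishing on \<open>C\<close>, as required in
  \<open>is_normalization\<close> below, this is a copy of the ring of germs of holomorphic functions on \<open>C\<close>.
\<close>

definition local_ring :: "complex^'n \<Rightarrow> ('r::finite \<Rightarrow> complex \<Rightarrow> complex^'n) \<Rightarrow> (complex fps ^ 'r) set" where
  "local_ring p \<gamma> =
     {F. \<exists>f. holomorphic_germ f p \<and> (\<forall>i. (\<lambda>t. f (\<gamma> i t)) has_fps_expansion F $ i)}"

definition laurent_embed :: "complex fps ^ 'r \<Rightarrow> complex fls ^ 'r" where
  "laurent_embed F = (\<chi> i. fps_to_fls (F $ i))"

text \<open>
  The total ring of fractions of a subring of a product of fields, formed inside that product
  (where the units are the elements without zero component).
\<close>

definition total_fractions :: "('k::field ^ 'r) set \<Rightarrow> ('k ^ 'r) set" where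
  "total_fractions A = {x. \<exists>a\<in>A. \<exists>b\<in>A. (\<forall>i. b $ i \<noteq> 0) \<and> b * x = a}"

definition integral_over :: "('k::field ^ 'r) set \<Rightarrow> 'k ^ 'r \<Rightarrow> bool" where
  "integral_over A x \<longleftrightarrow> (\<exists>P. lead_coeff P = 1 \<and> (\<forall>k. poly.coeff P k \<in> A) \<and> poly P x = 0)"

definition integral_closure :: "('k::field ^ 'r) set \<Rightarrow> ('k ^ 'r) set" where
  "integral_closure A = {x \<in> total_fractions A. integral_over A x}"

text \<open>
  The family \<open>\<gamma>\<close> exhibits the product of the rings of convergent power series as the integral
  closure of the local ring. The total ring of fractions then is a product of fields indexed by
  \<open>'r\<close>, so \<open>'r\<close> indexes the irreducible components and \<open>\<gamma> i\<close> parametrizes the \<open>i\<close>-th one.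
\<close>

definition is_normalization ::
    "(complex^'n) set \<Rightarrow> complex^'n \<Rightarrow> ('r::finite \<Rightarrow> complex \<Rightarrow> complex^'n) \<Rightarrow> bool" where
  "is_normalization C p \<gamma> \<longleftrightarrow>
     (\<forall>i. \<gamma> i 0 = p \<and> (\<forall>j. (\<lambda>t. \<gamma> i t $ j) analytic_on {0}) \<and> (\<forall>\<^sub>F t in nhds 0. \<gamma> i t \<in> C)) \<and>
     (\<forall>f. holomorphic_germ f p \<longrightarrow> (\<forall>i. \<forall>\<^sub>F t in nhds 0. f (\<gamma> i t) = 0) \<longrightarrow>
          (\<forall>\<^sub>F x in nhds p. x \<in> C \<longrightarrow> f x = 0)) \<and>
     integral_closure (laurent_embed ` local_ring p \<gamma>) = laurent_embed ` conv_ring"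


section \<open>Conductor, delta invariant, Hilbert function\<close>

text \<open>A set of representatives of a \<open>\<complex>\<close>-basis of the quotient space \<open>A/B\<close>.\<close>

definition quotient_basis :: "(complex fps ^ 'r) set \<Rightarrow> (complex fps ^ 'r) set \<Rightarrow> (complex fps ^ 'r) set \<Rightarrow> bool" where
  "quotient_basis A B S \<longleftrightarrow> S \<subseteq> A \<and>
     (\<forall>T u. finite T \<and> T \<subseteq> S \<and> (\<Sum>x\<in>T. fps_const (u x) *s x) \<in> B \<longrightarrow> (\<forall>x\<in>T. u x = 0)) \<and>
     (\<forall>a\<in>A. \<exists>T u. finite T \<and> T \<subseteq> S \<and> a - (\<Sum>x\<in>T. fps_const (u x) *s x) \<in> B)"

text \<open>As for \<open>dim\<close> and \<open>card\<close>, the value is \<open>0\<close> in the infinite-dimensional case.\<close>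

definition quotient_dim :: "(complex fps ^ 'r) set \<Rightarrow> (complex fps ^ 'r) set \<Rightarrow> nat" where
  "quotient_dim A B = card (SOME S. quotient_basis A B S)"

definition delta_invariant :: "(complex fps ^ 'r) set \<Rightarrow> nat" where
  "delta_invariant A = quotient_dim conv_ring A"

definition conductor_ideal :: "(complex fps ^ 'r) set \<Rightarrow> (complex fps ^ 'r) set" where
  "conductor_ideal A = {f\<in>A. \<forall>g\<in>conv_ring. f * g \<in> A}"

definition conductor :: "(complex fps ^ 'r) set \<Rightarrow> nat ^ 'r" where
  "conductor A = (THE c. conductor_ideal A = (\<lambda>g. (\<chi> i. fps_X ^ (c $ i)) * g) ` conv_ring)"

definition valuation :: "'r \<Rightarrow> complex fps ^ 'r \<Rightarrow> enat" where
  "valuation i f = (if f $ i = 0 then \<infinity> else enat (subdegree (f $ i)))"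

definition val_filtration :: "(complex fps ^ 'r) set \<Rightarrow> nat ^ 'r \<Rightarrow> (complex fps ^ 'r) set" where
  "val_filtration A l = {f\<in>A. \<forall>i. valuation i f \<ge> enat (l $ i)}"

definition hilbert_fun :: "(complex fps ^ 'r) set \<Rightarrow> nat ^ 'r \<Rightarrow> nat" where
  "hilbert_fun A l = quotient_dim A (val_filtration A l)"

definition abs_sum :: "nat ^ 'r \<Rightarrow> nat" where
  "abs_sum l = (\<Sum>i\<in>UNIV. l $ i)"

definition weight :: "(complex fps ^ 'r) set \<Rightarrow> nat ^ 'r \<Rightarrow> int" where
  "weight A l = 2 * int (hilbert_fun A l) - int (abs_sum l)"

definition min_weight :: "(complex fps ^ 'r) set \<Rightarrow> int" where
  "min_weight A = (INF l. weight A l)"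


section \<open>Cubes and the spaces $S_n$\<close>

definition cube :: "nat ^ 'r \<Rightarrow> 'r set \<Rightarrow> (real ^ 'r) set" where
  "cube l I = {x. \<forall>i. real (l $ i) \<le> x $ i \<and> x $ i \<le> real (l $ i) + (if i \<in> I then 1 else 0)}"

definition vertex :: "nat ^ 'r \<Rightarrow> 'r set \<Rightarrow> nat ^ 'r" where
  "vertex l J = (\<chi> i. l $ i + (if i \<in> J then 1 else 0))"

definition cube_weight :: "(complex fps ^ 'r) set \<Rightarrow> nat ^ 'r \<Rightarrow> 'r set \<Rightarrow> int" where
  "cube_weight A l I = Max ((\<lambda>J. weight A (vertex l J)) ` Pow I)"

definition sublevel :: "(complex fps ^ 'r) set \<Rightarrow> int \<Rightarrow> (real ^ 'r) set" where
  "sublevel A n = \<Union>{cube l I | l I. cube_weight A l I \<le> n}"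

text \<open>The subspace written $X_{-d}$ in the increasing indexing.\<close>

definition level_space :: "nat \<Rightarrow> (real ^ 'r) set" where
  "level_space d = \<Union>{cube l I | l I. abs_sum l \<ge> d}"

definition rectangle :: "int ^ 'r \<Rightarrow> (real ^ 'r) set" where
  "rectangle c = {x. \<forall>i. 0 \<le> x $ i \<and> x $ i \<le> of_int (c $ i)}"


section \<open>Ranks of abelian groups, Euler characteristics\<close>

definition Z_independent :: "('a, 'm) monoid_scheme \<Rightarrow> 'a set \<Rightarrow> bool" where
  "Z_independent G S \<longleftrightarrow> S \<subseteq> carrier G \<and>
     (\<forall>T (k :: 'a \<Rightarrow> int). finite T \<and> T \<subseteq> S \<and> finprod G (\<lambda>x. x [^]\<^bsub>G\<^esub> k x) T = \<one>\<^bsub>G\<^esub>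
        \<longrightarrow> (\<forall>x\<in>T. k x = 0))"

text \<open>
  The \<open>\<int>\<close>-rank of an abelian group: the size of a maximal \<open>\<int>\<close>-linearly independent subset
  (\<open>0\<close> by convention if that is infinite).
\<close>

definition group_rank :: "('a, 'm) monoid_scheme \<Rightarrow> nat" where
  "group_rank G =
     card (SOME S. Z_independent G S \<and> (\<forall>S'. Z_independent G S' \<and> S \<subseteq> S' \<longrightarrow> S' = S))"

definition euler_char :: "'a::topological_space set \<Rightarrow> int" where
  "euler_char X =
     Sum_any (\<lambda>b::nat. (-1) ^ b * int (group_rank (homology_group (int b) (top_of_set X))))"


section \<open>Lattice homology\<close>

text \<open>The summand of degree $-2n$ of the $b$-th lattice homology.\<close>

definition lattice_homology_part ::
    "(complex fps ^ 'r) set \<Rightarrow> nat \<Rightarrow> int \<Rightarrow> (real ^ 'r) chain set monoid" where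
  "lattice_homology_part A b n = homology_group (int b) (top_of_set (sublevel A n))"

definition lattice_homology ::
    "(complex fps ^ 'r) set \<Rightarrow> nat \<Rightarrow> (int \<Rightarrow> (real ^ 'r) chain set) monoid" where
  "lattice_homology A b = sum_group UNIV (lattice_homology_part A b)"

definition reduced_lattice_homology ::
    "(complex fps ^ 'r) set \<Rightarrow> nat \<Rightarrow> (int \<Rightarrow> (real ^ 'r) chain set) monoid" where
  "reduced_lattice_homology A q =
     (if q = 0
      then sum_group {min_weight A..} (\<lambda>n. reduced_homology_group 0 (top_of_set (sublevel A n)))
      else lattice_homology A q)"

definition lattice_eu :: "(complex fps ^ 'r) set \<Rightarrow> int" where
  "lattice_eu A =
     - min_weight A + Sum_any (\<lambda>q. (-1) ^ q * int (group_rank (reduced_lattice_homology A q)))"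


section \<open>The limit of the spectral sequence and its Poincare series\<close>

text \<open>The image of $H_b(S_n \cap X_{-d})$ in $H_b(S_n)$.\<close>

definition homology_filtration ::
    "(complex fps ^ 'r) set \<Rightarrow> int \<Rightarrow> int \<Rightarrow> nat \<Rightarrow> (real ^ 'r) chain set set" where
  "homology_filtration A n b d =
     (let Y = top_of_set (sublevel A n \<inter> level_space d); X = top_of_set (sublevel A n)
      in hom_induced b Y {} X {} id ` carrier (homology_group b Y))"

text \<open>The group $(E^\infty_{-d,q})_n$.\<close>

definition E_infinity ::
    "(complex fps ^ 'r) set \<Rightarrow> nat \<Rightarrow> int \<Rightarrow> int \<Rightarrow> (real ^ 'r) chain set set monoid" where
  "E_infinity A d q n =
     (let b = - int d + q
      in subgroup_generated (homology_group b (top_of_set (sublevel A n))) (homology_filtration A n b d)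
           Mod homology_filtration A n b (Suc d))"

text \<open>
  Series in \<open>T\<close>, \<open>Q\<close>, \<open>h\<close> are formal Laurent series in \<open>Q\<close> whose coefficients are polynomials
  in \<open>T\<close> (outer) and \<open>h\<close> (inner). Polynomials in \<open>T\<close> suffice because each \<open>S\<^sub>n\<close> is compact and
  thus misses \<open>level_space d\<close> for large \<open>d\<close>; this is what makes the substitution \<open>T = 1\<close>
  meaningful. The index \<open>q\<close> is recovered from the exponent \<open>b = -d + q\<close> of \<open>h\<close>; negative \<open>b\<close>
  would only contribute trivial groups.
\<close>

definition PE_infinity :: "(complex fps ^ 'r) set \<Rightarrow> int poly poly fls" where
  "PE_infinity A = Abs_fls (\<lambda>n. Sum_any (\<lambda>d. Polynomial.monom
     (Sum_any (\<lambda>b::nat. Polynomial.monom (int (group_rank (E_infinity A d (int b + int d) n))) b)) d))"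

definition map_fls :: "('a::zero \<Rightarrow> 'b::zero) \<Rightarrow> 'a fls \<Rightarrow> 'b fls" where
  "map_fls g F = Abs_fls (\<lambda>n. g (fls_nth F n))"

definition subst_T :: "int poly \<Rightarrow> int poly poly fls \<Rightarrow> int poly fls" where
  "subst_T t = map_fls (\<lambda>P. poly P t)"

definition subst_h :: "int \<Rightarrow> int poly fls \<Rightarrow> int fls" where
  "subst_h a = map_fls (\<lambda>P. poly P a)"

definition const_h :: "int fls \<Rightarrow> int poly fls" where
  "const_h = map_fls (\<lambda>a. [:a:])"

text \<open>The expansion of $1/(1-Q)$.\<close>

definition geometric_fls :: "int fls" where
  "geometric_fls = fps_to_fls (Abs_fps (\<lambda>_. 1))"

definition coeffs_ge :: "int poly fls \<Rightarrow> int poly fls \<Rightarrow> bool" where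
  "coeffs_ge P P' \<longleftrightarrow> (\<forall>n b. poly.coeff (fls_nth (P - P') n) b \<ge> 0)"

definition homology_poly :: "'a::topological_space set \<Rightarrow> int poly" where
  "homology_poly X =
     Sum_any (\<lambda>b::nat. Polynomial.monom (int (group_rank (homology_group (int b) (top_of_set X)))) b)"

definition lattice_homology_series :: "(complex fps ^ 'r) set \<Rightarrow> int poly fls" where
  "lattice_homology_series A =
     Abs_fls (\<lambda>n. Sum_any (\<lambda>b. Polynomial.monom (int (group_rank (lattice_homology_part A b n))) b))"

end

theory Submission
  imports Defs
begin

text \<open>
  A conductor element exists because the normalization is finite over the convergent series in a single
  element of the local ring. From then on only two facts about the ring matter: beyond the conductor every
  coordinate step raises the weight by one, so that \<open>S\<^sub>n\<close> retracts onto its part inside a rectangle, and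
  the jumps of the Hilbert function along a cube behave like a matroid rank, so that the maximum of the weight
  on a cube \<open>(l, I)\<close> is \<open>h(l) + h(l + E\<^sub>I) - |l|\<close>, where \<open>E\<^sub>I\<close> is the sum of the unit vectors in \<open>I\<close>.
  A finite cubical complex is homotopy equivalent to the union of slightly thickened cubes, that is, of convex
  open sets, and excision shows that its Euler characteristic is the alternating number of its cubes; this
  gives (b) and (c). Summing over \<open>n\<close> and inserting the weight formula, all but the corner terms of the
  rectangle telescope, leaving the delta invariant in (d). The spectral sequence enters only through the ranks
  of its limit, which are additive along the filtration and add up to the ranks of \<open>H\<^sub>b(S\<^sub>n)\<close>.
\<close>

unbundle no Formal_Power_Series.fps_syntax

section \<open>Ranks of abelian groups\<close>

text \<open>Three numbers in the statement rest on choices: \<open>group_rank\<close> and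
  \<open>quotient_dim\<close> take the cardinality of a set picked by \<open>SOME\<close>, with
  value 0 if it is infinite, and \<open>conductor\<close> is a \<open>THE\<close>. Each acquires its
  meaning only with a finiteness or uniqueness proof; this is why ranks are accompanied by
  \<open>finite_rank\<close> and why the conductor has to be shown to exist at all. The Betti
  numbers of \<open>S\<^sub>n\<close> remain unknown in the middle range of \<open>n\<close>. What
  is used is their alternating sum, their values at the two ends, where \<open>S\<^sub>n\<close> is
  empty or has the ranks of a point, and the positivity of the rank of \<open>H\<^sub>0\<close> for
  a nonempty space. Open neighbourhoods replace the cubes because excision wants the closure of the
  removed set inside an interior: closed subcomplexes violate this along their common boundary, two
  open sets never do. The algebraic obstacle is uniformity: an integral closure consists of
  fractions, each with its own denominator, whereas a conductor element is one denominator for all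
  of them.\<close>

definition rat_span :: "('a, 'm) monoid_scheme \<Rightarrow> 'a set \<Rightarrow> 'a set" where
  "rat_span G S = {x \<in> carrier G. \<exists>m::int. m \<noteq> 0 \<and> x [^]\<^bsub>G\<^esub> m \<in> generate G S}"

text \<open>\<open>rat_span G S\<close> is the preimage in \<open>G\<close> of the rational span of
  \<open>S\<close> in the tensor product of an abelian \<open>G\<close> with the rationals; in these
  terms \<open>S\<close> maps bijectively onto a basis of that vector space. Torsion elements lie in
  the span of the empty set.\<close>

definition rank_basis :: "('a, 'm) monoid_scheme \<Rightarrow> 'a set \<Rightarrow> bool" where
  "rank_basis G S \<longleftrightarrow> Z_independent G S \<and> carrier G \<subseteq> rat_span G S"

text \<open>\<open>group_rank\<close> is 0 in infinite rank, so additivity of ranks can fail there;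
  this guard is therefore carried through the rank formulas.\<close>

definition finite_rank :: "('a, 'm) monoid_scheme \<Rightarrow> bool" where
  "finite_rank G \<longleftrightarrow> (\<exists>S. finite S \<and> rank_basis G S)"

lemma Z_independentD:
  "Z_independent G S \<Longrightarrow> finite T \<Longrightarrow> T \<subseteq> S \<Longrightarrow> finprod G (\<lambda>x. x [^]\<^bsub>G\<^esub> (k x::int)) T = \<one>\<^bsub>G\<^esub>
    \<Longrightarrow> x \<in> T \<Longrightarrow> k x = 0"
  by (auto simp: Z_independent_def)

lemma Z_independent_carrier: "Z_independent G S \<Longrightarrow> S \<subseteq> carrier G"
  by (auto simp: Z_independent_def)

lemma Z_independent_mono: "Z_independent G S \<Longrightarrow> S' \<subseteq> S \<Longrightarrow> Z_independent G S'"
  unfolding Z_independent_def by (meson subset_trans)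

context comm_group
begin

lemma generate_finprod:
  assumes "y \<in> generate G S" "S \<subseteq> carrier G"
  shows "\<exists>T (k :: 'a \<Rightarrow> int). finite T \<and> T \<subseteq> S \<and> y = finprod G (\<lambda>x. x [^] k x) T"
  using assms(1)
proof induction
  case one
  show ?case by (intro exI[of _ "{}"]) auto
next
  case (incl h)
  then have "finprod G (\<lambda>x. x [^] (1::int)) {h} = h"
    using assms(2) by (subst finprod_insert) auto
  then show ?case using incl by (intro exI[of _ "{h}"] exI[of _ "\<lambda>_. 1"]) auto
next
  case (inv h)
  then have "finprod G (\<lambda>x. x [^] (-1::int)) {h} = inv h"
    using assms(2) by (subst finprod_insert) (auto simp: int_pow_neg)
  then show ?case using inv by (intro exI[of _ "{h}"] exI[of _ "\<lambda>_. -1"]) auto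
next
  case (eng h1 h2)
  then obtain T1 T2 and k1 k2 :: "'a \<Rightarrow> int" where
    1: "finite T1" "T1 \<subseteq> S" "h1 = finprod G (\<lambda>x. x [^] k1 x) T1" and
    2: "finite T2" "T2 \<subseteq> S" "h2 = finprod G (\<lambda>x. x [^] k2 x) T2"
    by blast
  define l1 where "l1 x = (if x \<in> T1 then k1 x else 0)" for x
  define l2 where "l2 x = (if x \<in> T2 then k2 x else 0)" for x
  have c: "T1 \<union> T2 \<subseteq> carrier G" using 1 2 assms by auto
  have "h1 = finprod G (\<lambda>x. x [^] l1 x) (T1 \<union> T2)"
    unfolding 1(3) using c 1 2
    by (intro finprod_mono_neutral_cong) (auto simp: l1_def)
  moreover have "h2 = finprod G (\<lambda>x. x [^] l2 x) (T1 \<union> T2)"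
    unfolding 2(3) using c 1 2
    by (intro finprod_mono_neutral_cong) (auto simp: l2_def)
  ultimately have "h1 \<otimes> h2 = finprod G (\<lambda>x. x [^] l1 x \<otimes> x [^] l2 x) (T1 \<union> T2)"
    using c by (subst finprod_multf) auto
  also have "\<dots> = finprod G (\<lambda>x. x [^] (l1 x + l2 x)) (T1 \<union> T2)"
    using c by (intro finprod_cong) (auto simp: int_pow_mult subset_iff simp_implies_def)
  finally show ?case using 1 2
    by (intro exI[of _ "T1 \<union> T2"] exI[of _ "\<lambda>x. l1 x + l2 x"]) auto
qed

lemma finprod_in_generate:
  assumes "T \<subseteq> S" "S \<subseteq> carrier G"
  shows "finprod G (\<lambda>x. x [^] (k x::int)) T \<in> generate G S"
proof (cases "finite T")
  case True
  then show ?thesis using assms(1)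
  proof (induction T)
    case (insert x T)
    have "x [^] k x \<in> generate G S"
      using insert assms by (intro subgroup_int_pow_closed generate_is_subgroup) (auto intro: generate.incl)
    with insert assms show ?case
      by (subst finprod_insert) (auto intro: generate.eng)
  qed (auto intro: generate.one)
qed (auto intro: generate.one)

lemma subgroup_rat_span:
  assumes "S \<subseteq> carrier G"
  shows "subgroup (rat_span G S) G"
proof
  have sg: "subgroup (generate G S) G" using assms by (rule generate_is_subgroup)
  show "rat_span G S \<subseteq> carrier G" by (auto simp: rat_span_def)
  show "\<one> \<in> rat_span G S" by (auto simp: rat_span_def intro: generate.one exI[of _ 1])
  show "x \<otimes> y \<in> rat_span G S" if xy: "x \<in> rat_span G S" "y \<in> rat_span G S" for x y
  proof -
    obtain m n :: int where mn: "m \<noteq> 0" "x [^] m \<in> generate G S" "n \<noteq> 0" "y [^] n \<in> generate G S"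
      "x \<in> carrier G" "y \<in> carrier G"
      using xy by (auto simp: rat_span_def)
    have "(x \<otimes> y) [^] (m * n) = (x [^] m) [^] n \<otimes> (y [^] n) [^] m"
      using mn by (simp add: int_pow_distrib int_pow_pow mult.commute)
    also have "\<dots> \<in> generate G S"
      using subgroup_int_pow_closed[OF sg mn(2)] subgroup_int_pow_closed[OF sg mn(4)]
      by (rule generate.eng)
    finally show ?thesis using mn by (auto simp: rat_span_def intro!: exI[of _ "m * n"])
  qed
  show "inv x \<in> rat_span G S" if x: "x \<in> rat_span G S" for x
  proof -
    obtain m :: int where m: "m \<noteq> 0" "x [^] m \<in> generate G S" "x \<in> carrier G"
      using x by (auto simp: rat_span_def)
    then have "(inv x) [^] m \<in> generate G S"
      using assms by (simp add: int_pow_inv generate_m_inv_closed)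
    then show ?thesis using m by (auto simp: rat_span_def)
  qed
qed

lemma rat_span_superset: "S \<subseteq> carrier G \<Longrightarrow> S \<subseteq> rat_span G S"
  by (auto simp: rat_span_def intro!: exI[of _ "1::int"] generate.incl)

lemma rat_span_subsetI:
  assumes "S \<subseteq> rat_span G T" "T \<subseteq> carrier G"
  shows "rat_span G S \<subseteq> rat_span G T"
proof
  fix x assume "x \<in> rat_span G S"
  then obtain m :: int where m: "m \<noteq> 0" "x [^] m \<in> generate G S" "x \<in> carrier G"
    by (auto simp: rat_span_def)
  have "generate G S \<subseteq> rat_span G T"
    using assms by (intro generate_subgroup_incl subgroup_rat_span)
  with m obtain n :: int where n: "n \<noteq> 0" "(x [^] m) [^] n \<in> generate G T"
    by (auto simp: rat_span_def)
  then show "x \<in> rat_span G T" using m by (auto simp: rat_span_def int_pow_pow intro!: exI[of _ "m * n"])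
qed

lemma rat_span_mono: "S \<subseteq> T \<Longrightarrow> rat_span G S \<subseteq> rat_span G T"
  using mono_generate[of S T] by (auto simp: rat_span_def)

lemma Z_independent_notin_rat_span:
  assumes "Z_independent G S" "x \<in> S"
  shows "x \<notin> rat_span G (S - {x})"
proof
  assume "x \<in> rat_span G (S - {x})"
  then obtain m :: int where m: "m \<noteq> 0" "x [^] m \<in> generate G (S - {x})" "x \<in> carrier G"
    by (auto simp: rat_span_def)
  have S: "S \<subseteq> carrier G" using assms by (auto simp: Z_independent_def)
  then obtain T and k :: "'a \<Rightarrow> int" where
    T: "finite T" "T \<subseteq> S - {x}" "x [^] m = finprod G (\<lambda>x. x [^] k x) T"
    using generate_finprod[OF m(2)] by blast
  \<comment> \<open>The exponent \<open>- m\<close> at \<open>x\<close> turns the expression of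
    \<open>x [^] m\<close> through the other elements into a relation.\<close>
  define k' where "k' = k(x := - m)"
  have "finprod G (\<lambda>x. x [^] k' x) T = x [^] m"
    unfolding T(3) using T S by (intro finprod_cong) (auto simp: k'_def simp_implies_def)
  then have "finprod G (\<lambda>x. x [^] k' x) (insert x T) = x [^] (- m) \<otimes> x [^] m"
    using T S m by (subst finprod_insert) (auto simp: k'_def)
  also have "\<dots> = \<one>" using m by (simp flip: int_pow_mult)
  finally have "k' x = 0"
    using Z_independentD[OF assms(1), of "insert x T" k' x] T assms(2) by auto
  then show False using m by (simp add: k'_def)
qed

lemma Z_independent_insert:
  assumes "Z_independent G S" "y \<in> carrier G" "y \<notin> rat_span G S"
  shows "Z_independent G (insert y S)"
  unfolding Z_independent_def
proof (intro conjI allI impI ballI)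
  have S: "S \<subseteq> carrier G" using assms by (auto simp: Z_independent_def)
  then show "insert y S \<subseteq> carrier G" using assms by auto
  fix T and k :: "'a \<Rightarrow> int" and x
  assume T: "finite T \<and> T \<subseteq> insert y S \<and> finprod G (\<lambda>x. x [^] k x) T = \<one>" and x: "x \<in> T"
  let ?P = "finprod G (\<lambda>x. x [^] k x) (T - {y})"
  have P: "?P \<in> generate G S" using T S by (intro finprod_in_generate) auto
  have Pc: "?P \<in> carrier G" using P S generate_in_carrier by blast
  show "k x = 0"
  proof (cases "y \<in> T")
    case True
    have "finprod G (\<lambda>x. x [^] k x) (insert y (T - {y})) = y [^] k y \<otimes> ?P"
      using T S assms by (intro finprod_insert) auto
    then have eq: "y [^] k y \<otimes> ?P = \<one>" using T True by (simp add: insert_absorb)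
    then have "y [^] k y = inv ?P" using Pc assms(2) by (metis inv_equality int_pow_closed)
    also have "\<dots> \<in> generate G S" using P S by (intro generate_m_inv_closed)
    finally have ky: "k y = 0" using assms by (auto simp: rat_span_def)
    then have "?P = \<one>" using eq Pc by simp
    then have "k x = 0" if "x \<noteq> y"
      using Z_independentD[OF assms(1), of "T - {y}" k x] T x that by auto
    with ky show ?thesis by blast
  next
    case False
    then show ?thesis using Z_independentD[OF assms(1), of T k x] T x by auto
  qed
qed

text \<open>Steinitz exchange: an element of \<open>S\<close> outside \<open>T\<close> is replaced
  by an element of \<open>T\<close> outside the span of the rest of \<open>S\<close>. The
  cardinality of \<open>S\<close> is kept and \<open>S - T\<close> shrinks, until \<open>S\<close>
  is contained in \<open>T\<close>.\<close>

lemma Z_independent_exchange: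
  assumes "finite T" "T \<subseteq> carrier G" "finite S" "Z_independent G S" "S \<subseteq> rat_span G T"
  shows "card S \<le> card T"
  using assms(3-5)
proof (induction "card (S - T)" arbitrary: S rule: less_induct)
  case less
  show ?case
  proof (cases "S \<subseteq> T")
    case True
    then show ?thesis using assms(1) by (rule card_mono[rotated])
  next
    case False
    then obtain x where x: "x \<in> S" "x \<notin> T" by auto
    have S: "S \<subseteq> carrier G" using less by (auto simp: Z_independent_def)
    have "x \<notin> rat_span G (S - {x})" using less x by (intro Z_independent_notin_rat_span)
    then have "\<not> T \<subseteq> rat_span G (S - {x})"
      using rat_span_subsetI[of T "S - {x}"] S x less by blast
    then obtain y where y: "y \<in> T" "y \<notin> rat_span G (S - {x})" by auto
    define S' where "S' = insert y (S - {x})"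
    have "y \<notin> S - {x}" using y rat_span_superset[of "S - {x}"] S by auto
    then have cS: "card S' = card S"
      using less.prems(1) x card_Suc_Diff1[of S x] by (simp add: S'_def)
    have "card (S' - T) < card (S - T)"
      using x y less by (intro psubset_card_mono) (auto simp: S'_def)
    moreover have "Z_independent G S'" unfolding S'_def
      using less y assms by (intro Z_independent_insert) (auto intro: Z_independent_mono)
    moreover have "S' \<subseteq> rat_span G T"
      using less y rat_span_superset[OF assms(2)] by (auto simp: S'_def)
    ultimately have "card S' \<le> card T" using less by (simp add: S'_def)
    then show ?thesis using cS by simp
  qed
qed

lemma Z_independent_card_le:
  assumes "finite T" "T \<subseteq> carrier G" "Z_independent G S" "S \<subseteq> rat_span G T"
  shows "finite S \<and> card S \<le> card T"
proof -
  have *: "card F \<le> card T" if "finite F" "F \<subseteq> S" for F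
    using that assms by (intro Z_independent_exchange) (auto intro: Z_independent_mono)
  have "finite S"
  proof (rule ccontr)
    assume "infinite S"
    then obtain F where "F \<subseteq> S" "finite F" "card F = Suc (card T)"
      using infinite_arbitrarily_large by blast
    then show False using *[of F] by simp
  qed
  with * show ?thesis by blast
qed

text \<open>An element outside the rational span can be added to an independent set, and one inside
  cannot. This links the maximality in \<open>group_rank\<close> to spanning, which is what proofs
  can handle.\<close>

lemma rank_basis_iff_maximal:
  "rank_basis G S \<longleftrightarrow> Z_independent G S \<and> (\<forall>S'. Z_independent G S' \<and> S \<subseteq> S' \<longrightarrow> S' = S)"
proof (intro iffI conjI allI impI)
  assume S: "rank_basis G S"
  then show "Z_independent G S" by (simp add: rank_basis_def)
  fix S' assume S': "Z_independent G S' \<and> S \<subseteq> S'"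
  show "S' = S"
  proof (rule ccontr)
    assume "S' \<noteq> S"
    then obtain x where x: "x \<in> S'" "x \<notin> S" using S' by auto
    then have "x \<notin> rat_span G (S' - {x})" using S' Z_independent_notin_rat_span by blast
    moreover have "rat_span G S \<subseteq> rat_span G (S' - {x})" using x S' by (intro rat_span_mono) auto
    ultimately show False using x S S' by (auto simp: rank_basis_def Z_independent_def)
  qed
next
  assume S: "Z_independent G S \<and> (\<forall>S'. Z_independent G S' \<and> S \<subseteq> S' \<longrightarrow> S' = S)"
  have "x \<in> rat_span G S" if "x \<in> carrier G" for x
  proof (rule ccontr)
    assume "x \<notin> rat_span G S"
    then have "x \<in> S" using S Z_independent_insert[of S x] that by blast
    then show False using \<open>x \<notin> rat_span G S\<close> rat_span_superset[of S] S by (auto simp: Z_independent_def)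
  qed
  with S show "rank_basis G S" by (auto simp: rank_basis_def)
qed

lemma group_rank_eq:
  assumes "finite S" "rank_basis G S"
  shows "group_rank G = card S"
proof -
  define S' where "S' = (SOME S. rank_basis G S)"
  have S': "rank_basis G S'" unfolding S'_def using assms(2) by (rule someI)
  have "finite S' \<and> card S' \<le> card S"
    using assms S' by (intro Z_independent_card_le) (auto simp: rank_basis_def Z_independent_def)
  moreover from this have "finite S \<and> card S \<le> card S'"
    using assms S' by (intro Z_independent_card_le) (auto simp: rank_basis_def Z_independent_def)
  ultimately have "card S' = card S" by auto
  then show ?thesis by (simp add: group_rank_def S'_def rank_basis_iff_maximal)
qed

text \<open>Among independent sets of bounded size there is one of greatest cardinality, and it is
  maximal. A bound on all independent sets passes to subgroups and quotients, where no basis is at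
  hand.\<close>

lemma finite_rankI:
  assumes "\<And>S. Z_independent G S \<Longrightarrow> finite S \<and> card S \<le> n"
  shows "finite_rank G"
proof -
  have "Z_independent G {}" by (auto simp: Z_independent_def)
  then have "\<exists>S. Z_independent G S \<and> (\<forall>S'. Z_independent G S' \<longrightarrow> card S' \<le> card S)"
    by (rule ex_has_greatest_nat[where b = "Suc n"]) (use assms in \<open>simp add: less_Suc_eq_le\<close>)
  then obtain S where S: "Z_independent G S" "\<And>S'. Z_independent G S' \<Longrightarrow> card S' \<le> card S"
    by blast
  have "S' = S" if "Z_independent G S'" "S \<subseteq> S'" for S'
    using that S assms by (metis card_subset_eq le_antisym card_mono)
  then have "rank_basis G S" using S by (auto simp: rank_basis_iff_maximal)
  then show ?thesis using S assms by (auto simp: finite_rank_def)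
qed

lemma finite_rankD:
  assumes "finite_rank G" "Z_independent G S"
  shows "finite S \<and> card S \<le> group_rank G"
proof -
  obtain T where T: "finite T" "rank_basis G T" using assms by (auto simp: finite_rank_def)
  then show ?thesis using assms(2) group_rank_eq[OF T]
    using Z_independent_card_le[of T S] by (auto simp: rank_basis_def Z_independent_def)
qed

end

section \<open>Ranks along homomorphisms and in exact sequences\<close>

lemma group_hom_finprod:
  assumes "comm_group G" "comm_group H" "f \<in> hom G H" "a \<in> T \<rightarrow> carrier G"
  shows "f (finprod G a T) = finprod H (\<lambda>x. f (a x)) T"
proof -
  interpret G: comm_group G by fact
  interpret H: comm_group H by fact
  interpret f: group_hom G H f using assms by unfold_locales
  show ?thesis
  proof (cases "finite T")
    case True
    then show ?thesis using assms(4)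
    proof (induction T)
      case (insert x T)
      then have "a x \<in> carrier G" "a \<in> T \<rightarrow> carrier G" by auto
      moreover from this have "(\<lambda>x. f (a x)) \<in> T \<rightarrow> carrier H" by (auto intro!: f.hom_closed)
      ultimately      show ?case using insert by simp
    qed auto
  qed auto
qed

lemma Z_independent_lift:
  assumes "comm_group G" "comm_group H" "f \<in> hom G H" "S \<subseteq> carrier G" "inj_on f S"
    and "Z_independent H (f ` S)"
  shows "Z_independent G S"
  unfolding Z_independent_def
proof (intro conjI allI impI ballI assms(4))
  interpret G: comm_group G by fact
  interpret H: comm_group H by fact
  interpret f: group_hom G H f using assms by unfold_locales
  fix T x and k :: "'a \<Rightarrow> int"
  assume T: "finite T \<and> T \<subseteq> S \<and> (\<Otimes>\<^bsub>G\<^esub>x\<in>T. x [^]\<^bsub>G\<^esub> k x) = \<one>\<^bsub>G\<^esub>" and x: "x \<in> T"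
  have inj: "inj_on f T" using assms T by (meson inj_on_subset)
  define g where "g = the_inv_into T f"
  have g: "g (f y) = y" if "y \<in> T" for y using that inj by (simp add: g_def the_inv_into_f_f)
  have "(\<Otimes>\<^bsub>H\<^esub>y\<in>f ` T. y [^]\<^bsub>H\<^esub> k (g y)) = (\<Otimes>\<^bsub>H\<^esub>x\<in>T. f x [^]\<^bsub>H\<^esub> k (g (f x)))"
    by (rule H.finprod_reindex) (use T assms inj in \<open>auto intro!: H.int_pow_closed f.hom_closed\<close>)
  also have "\<dots> = (\<Otimes>\<^bsub>H\<^esub>x\<in>T. f (x [^]\<^bsub>G\<^esub> k x))"
    using T assms by (intro H.finprod_cong) (auto simp: g f.hom_int_pow subset_iff simp_implies_def)
  also have "\<dots> = f (\<Otimes>\<^bsub>G\<^esub>x\<in>T. x [^]\<^bsub>G\<^esub> k x)"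
    using T assms by (subst group_hom_finprod[of G H]) auto
  also have "\<dots> = \<one>\<^bsub>H\<^esub>" using T by simp
  finally have "k (g (f x)) = 0"
    using Z_independentD[OF assms(6), of "f ` T" "\<lambda>y. k (g y)" "f x"] T x by auto
  then show "k x = 0" using g x by simp
qed

lemma Z_independent_image:
  assumes "comm_group G" "comm_group H" "f \<in> hom G H" "inj_on f (carrier G)"
    and S: "Z_independent G S"
  shows "Z_independent H (f ` S)"
  unfolding Z_independent_def
proof (intro conjI allI impI ballI)
  interpret G: comm_group G by fact
  interpret H: comm_group H by fact
  interpret f: group_hom G H f using assms by unfold_locales
  have Sc: "S \<subseteq> carrier G" using S by (rule Z_independent_carrier)
  then show "f ` S \<subseteq> carrier H" by auto
  fix T y and k :: "'c \<Rightarrow> int"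
  assume T: "finite T \<and> T \<subseteq> f ` S \<and> (\<Otimes>\<^bsub>H\<^esub>x\<in>T. x [^]\<^bsub>H\<^esub> k x) = \<one>\<^bsub>H\<^esub>" and y: "y \<in> T"
  then obtain T' where T': "finite T'" "T' \<subseteq> S" "T = f ` T'" by (meson finite_subset_image)
  have inj: "inj_on f T'" using T' Sc assms(4) by (meson inj_on_subset)
  have c: "T' \<subseteq> carrier G" using T' Sc by auto
  have "f (\<Otimes>\<^bsub>G\<^esub>x\<in>T'. x [^]\<^bsub>G\<^esub> k (f x)) = (\<Otimes>\<^bsub>H\<^esub>x\<in>T'. f (x [^]\<^bsub>G\<^esub> k (f x)))"
    using c assms by (intro group_hom_finprod) auto
  also have "\<dots> = (\<Otimes>\<^bsub>H\<^esub>x\<in>T'. f x [^]\<^bsub>H\<^esub> k (f x))"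
    using c by (intro H.finprod_cong) (auto simp: f.hom_int_pow simp_implies_def)
  also have "\<dots> = (\<Otimes>\<^bsub>H\<^esub>x\<in>T. x [^]\<^bsub>H\<^esub> k x)"
    unfolding T'(3)
    by (rule H.finprod_reindex[symmetric]) (use c inj in \<open>auto intro!: H.int_pow_closed f.hom_closed\<close>)
  also have "\<dots> = f \<one>\<^bsub>G\<^esub>" using T by simp
  finally have "(\<Otimes>\<^bsub>G\<^esub>x\<in>T'. x [^]\<^bsub>G\<^esub> k (f x)) = \<one>\<^bsub>G\<^esub>"
    by (rule inj_onD[OF assms(4)]) (use c in \<open>auto intro!: G.finprod_closed\<close>)
  then show "k y = 0"
    using Z_independentD[OF S, of T' "\<lambda>x. k (f x)"] T' y by auto
qed

lemma finite_rank_injective: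
  assumes "comm_group A" "comm_group B" "f \<in> hom A B" "inj_on f (carrier A)" "finite_rank B"
  shows "finite_rank A"
proof (rule comm_group.finite_rankI[OF assms(1), where n = "group_rank B"])
  fix S assume S: "Z_independent A S"
  have "finite (f ` S) \<and> card (f ` S) \<le> group_rank B"
    using assms S by (intro comm_group.finite_rankD Z_independent_image[of A B])
  moreover have "inj_on f S" using assms(4) S by (meson Z_independent_carrier inj_on_subset)
  ultimately show "finite S \<and> card S \<le> group_rank B"
    using card_image finite_imageD by fastforce
qed

lemma finite_rank_surjective:
  assumes "comm_group B" "comm_group C" "g \<in> hom B C" "g ` carrier B = carrier C" "finite_rank B"
  shows "finite_rank C"
proof (rule comm_group.finite_rankI[OF assms(2), where n = "group_rank B"])
  fix S assume S: "Z_independent C S"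
  then obtain S' where S': "S' \<subseteq> carrier B" "inj_on g S'" "S = g ` S'"
    using assms(4) by (metis Z_independent_carrier subset_image_inj)
  then have "Z_independent B S'" using assms S by (intro Z_independent_lift[of B C g]) auto
  then have "finite S' \<and> card S' \<le> group_rank B"
    using assms by (intro comm_group.finite_rankD)
  then show "finite S \<and> card S \<le> group_rank B"
    using S' by (auto simp: card_image)
qed

text \<open>The usual basis of an extension: the image of a basis of the kernel together with lifts
  of a basis of the quotient. The two parts are disjoint since the image of \<open>f\<close> goes to
  the identity of \<open>C\<close>, which belongs to no independent set.\<close>

lemma rank_basis_extension:
  assumes A: "comm_group A" and B: "comm_group B" and C: "comm_group C"
    and f: "f \<in> hom A B" and injf: "inj_on f (carrier A)"
    and g: "g \<in> hom B C" and surj: "g ` carrier B = carrier C"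
    and exact: "f ` carrier A = {x \<in> carrier B. g x = \<one>\<^bsub>C\<^esub>}"
    and S: "rank_basis A S" and T: "T \<subseteq> carrier B" "inj_on g T" "rank_basis C (g ` T)"
  shows "rank_basis B (f ` S \<union> T) \<and> f ` S \<inter> T = {}"
proof -
  interpret A: comm_group A by fact
  interpret B: comm_group B by fact
  interpret C: comm_group C by fact
  interpret f: group_hom A B f using f by unfold_locales
  interpret g: group_hom B C g using g by unfold_locales
  have Sc: "S \<subseteq> carrier A" using S by (auto simp: rank_basis_def Z_independent_def)
  have iS: "Z_independent B (f ` S)"
    using S by (intro Z_independent_image[OF A B f injf]) (auto simp: rank_basis_def)
  have iT: "Z_independent B T"
    using T by (intro Z_independent_lift[OF B C g]) (auto simp: rank_basis_def)
  have gf: "g (f x) = \<one>\<^bsub>C\<^esub>" if "x \<in> carrier A" for x using exact that by auto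
  have one: "\<one>\<^bsub>C\<^esub> \<notin> g ` T"
  proof
    assume "\<one>\<^bsub>C\<^esub> \<in> g ` T"
    moreover have "finprod C (\<lambda>x. x [^]\<^bsub>C\<^esub> (1::int)) {\<one>\<^bsub>C\<^esub>} = \<one>\<^bsub>C\<^esub>" by (subst C.finprod_insert) auto
    ultimately have "(1::int) = 0"
      using T(3) Z_independentD[of C "g ` T" "{\<one>\<^bsub>C\<^esub>}" "\<lambda>_. 1"] by (auto simp: rank_basis_def)
    then show False by simp
  qed
  have disj: "f ` S \<inter> T = {}" using one gf Sc by force
  have indep: "Z_independent B (f ` S \<union> T)"
    unfolding Z_independent_def
  proof (intro conjI allI impI ballI)
    show "f ` S \<union> T \<subseteq> carrier B" using Sc T by auto
    fix U x and k :: "'c \<Rightarrow> int"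
    assume U: "finite U \<and> U \<subseteq> f ` S \<union> T \<and> (\<Otimes>\<^bsub>B\<^esub>x\<in>U. x [^]\<^bsub>B\<^esub> k x) = \<one>\<^bsub>B\<^esub>" and x: "x \<in> U"
    define U1 where "U1 = U \<inter> f ` S"
    define U2 where "U2 = U \<inter> T"
    let ?P1 = "\<Otimes>\<^bsub>B\<^esub>x\<in>U1. x [^]\<^bsub>B\<^esub> k x" and ?P2 = "\<Otimes>\<^bsub>B\<^esub>x\<in>U2. x [^]\<^bsub>B\<^esub> k x"
    have c: "U1 \<subseteq> carrier B" "U2 \<subseteq> carrier B" using Sc T by (auto simp: U1_def U2_def)
    have P: "?P1 \<in> carrier B" "?P2 \<in> carrier B" using c by (auto intro!: B.finprod_closed)
    have "U = U1 \<union> U2" "U1 \<inter> U2 = {}" using U disj by (auto simp: U1_def U2_def)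
    then have eq: "?P1 \<otimes>\<^bsub>B\<^esub> ?P2 = \<one>\<^bsub>B\<^esub>"
      using U c by (subst B.finprod_Un_disjoint[symmetric]) (auto simp: U1_def U2_def)
    have "g ?P1 = (\<Otimes>\<^bsub>C\<^esub>x\<in>U1. g (x [^]\<^bsub>B\<^esub> k x))" using c by (intro group_hom_finprod B C g) auto
    also have "\<dots> = (\<Otimes>\<^bsub>C\<^esub>x\<in>U1. \<one>\<^bsub>C\<^esub>)"
      using Sc by (intro C.finprod_cong) (auto simp: U1_def g.hom_int_pow gf subset_iff simp_implies_def)
    finally have "g ?P1 = \<one>\<^bsub>C\<^esub>" by simp
    then have "g ?P2 = \<one>\<^bsub>C\<^esub>" using arg_cong[OF eq, of g] P by simp
    have inj2: "inj_on g U2" using T unfolding U2_def by (meson Int_lower2 inj_on_subset)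
    define k' where "k' y = k (the_inv_into U2 g y)" for y
    have k': "k' (g y) = k y" if "y \<in> U2" for y using that inj2 by (simp add: k'_def the_inv_into_f_f)
    have "(\<Otimes>\<^bsub>C\<^esub>y\<in>g ` U2. y [^]\<^bsub>C\<^esub> k' y) = (\<Otimes>\<^bsub>C\<^esub>x\<in>U2. g x [^]\<^bsub>C\<^esub> k' (g x))"
      by (rule C.finprod_reindex) (use c inj2 in \<open>auto intro!: C.int_pow_closed\<close>)
    also have "\<dots> = (\<Otimes>\<^bsub>C\<^esub>x\<in>U2. g (x [^]\<^bsub>B\<^esub> k x))"
      using c by (intro C.finprod_cong) (auto simp: k' g.hom_int_pow subset_iff simp_implies_def)
    also have "\<dots> = g ?P2" using c by (intro group_hom_finprod[symmetric] B C g) auto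
    finally have "(\<Otimes>\<^bsub>C\<^esub>y\<in>g ` U2. y [^]\<^bsub>C\<^esub> k' y) = \<one>\<^bsub>C\<^esub>" using \<open>g ?P2 = \<one>\<^bsub>C\<^esub>\<close> by simp
    then have k2: "k y = 0" if "y \<in> U2" for y
      using Z_independentD[of C "g ` T" "g ` U2" k' "g y"] that T U k'
      by (auto simp: rank_basis_def U2_def)
    then have "?P2 = (\<Otimes>\<^bsub>B\<^esub>x\<in>U2. \<one>\<^bsub>B\<^esub>)"
      by (intro B.finprod_cong) (auto simp: simp_implies_def)
    then have "?P1 = \<one>\<^bsub>B\<^esub>" using eq P by simp
    then have "k y = 0" if "y \<in> U1" for y
      using Z_independentD[OF iS, of U1 k y] that U by (auto simp: U1_def)
    then show "k x = 0" using k2 x U by (auto simp: U1_def U2_def)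
  qed
  \<comment> \<open>Two denominators are needed: the multiple \<open>m\<close> brings
    \<open>g x\<close> into the subgroup generated by the image of \<open>T\<close>, and the
    multiple \<open>n\<close> brings the remaining difference, which comes from \<open>A\<close>,
    into the subgroup generated by \<open>S\<close>.\<close>
  have "x \<in> rat_span B (f ` S \<union> T)" if x: "x \<in> carrier B" for x
  proof -
    have "g x \<in> rat_span C (g ` T)" using T(3) x by (auto simp: rank_basis_def)
    then obtain m :: int where m: "m \<noteq> 0" "g x [^]\<^bsub>C\<^esub> m \<in> g ` generate B T"
      using g.generate_img[OF T(1)] by (auto simp: rat_span_def)
    then obtain s where s: "s \<in> generate B T" "g (x [^]\<^bsub>B\<^esub> m) = g s"
      using x by (auto simp: g.hom_int_pow)
    have sc: "s \<in> carrier B" using s T B.generate_in_carrier by blast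
    have "x [^]\<^bsub>B\<^esub> m \<otimes>\<^bsub>B\<^esub> inv\<^bsub>B\<^esub> s \<in> f ` carrier A"
      unfolding exact using x sc s(2) by simp
    then obtain a where a: "a \<in> carrier A" "x [^]\<^bsub>B\<^esub> m \<otimes>\<^bsub>B\<^esub> inv\<^bsub>B\<^esub> s = f a" by auto
    then have xm: "x [^]\<^bsub>B\<^esub> m = f a \<otimes>\<^bsub>B\<^esub> s"
      by (metis B.inv_solve_right' B.int_pow_closed f.hom_closed sc x)
    obtain n :: int where n: "n \<noteq> 0" "a [^]\<^bsub>A\<^esub> n \<in> generate A S"
      using S a by (auto simp: rank_basis_def rat_span_def)
    have "f a [^]\<^bsub>B\<^esub> n \<in> f ` generate A S" using n a by (simp flip: f.hom_int_pow)
    then have 1: "f a [^]\<^bsub>B\<^esub> n \<in> generate B (f ` S \<union> T)"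
      using f.generate_img[OF Sc] B.mono_generate[of "f ` S" "f ` S \<union> T"] by auto
    have 2: "s [^]\<^bsub>B\<^esub> n \<in> generate B (f ` S \<union> T)"
      using s B.mono_generate[of T "f ` S \<union> T"] Sc T
      by (intro B.subgroup_int_pow_closed B.generate_is_subgroup) auto
    have "x [^]\<^bsub>B\<^esub> (m * n) = f a [^]\<^bsub>B\<^esub> n \<otimes>\<^bsub>B\<^esub> s [^]\<^bsub>B\<^esub> n"
      using x sc a by (simp add: xm B.int_pow_distrib flip: B.int_pow_pow)
    also have "\<dots> \<in> generate B (f ` S \<union> T)" using 1 2 by (rule generate.eng)
    finally show ?thesis using x m n by (auto simp: rat_span_def intro!: exI[of _ "m * n"])
  qed
  then show ?thesis using indep disj by (auto simp: rank_basis_def)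
qed

theorem group_rank_exact:
  assumes A: "comm_group A" and B: "comm_group B" and C: "comm_group C"
    and f: "f \<in> hom A B" and injf: "inj_on f (carrier A)"
    and g: "g \<in> hom B C" and surj: "g ` carrier B = carrier C"
    and exact: "f ` carrier A = {x \<in> carrier B. g x = \<one>\<^bsub>C\<^esub>}"
    and "finite_rank A" "finite_rank C"
  shows "finite_rank B" and "group_rank B = group_rank A + group_rank C"
proof -
  obtain S where S: "finite S" "rank_basis A S" using assms by (auto simp: finite_rank_def)
  obtain T' where T': "finite T'" "rank_basis C T'" using assms by (auto simp: finite_rank_def)
  then have "T' \<subseteq> g ` carrier B" using surj by (auto simp: rank_basis_def Z_independent_def)
  then obtain T where T: "T \<subseteq> carrier B" "inj_on g T" "T' = g ` T" by (metis subset_image_inj)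
  have fT: "finite T" using T T' by (simp add: finite_image_iff)
  have *: "rank_basis B (f ` S \<union> T) \<and> f ` S \<inter> T = {}"
    using assms S T T' by (intro rank_basis_extension[of A B C f g]) auto
  then show "finite_rank B" using fT S by (auto simp: finite_rank_def)
  have "inj_on f S" using S injf by (meson Z_independent_carrier inj_on_subset rank_basis_def)
  then have "card (f ` S \<union> T) = card S + card T'"
    using * fT S T by (simp add: card_Un_disjoint card_image)
  moreover have "group_rank B = card (f ` S \<union> T)"
    using * fT S B by (intro comm_group.group_rank_eq) auto
  ultimately show "group_rank B = group_rank A + group_rank C"
    using S T' A C by (simp add: comm_group.group_rank_eq)
qed

lemma trivial_group_rank:
  assumes "trivial_group G"
  shows "finite_rank G" "group_rank G = 0"
proof -
  have G: "group G" and c: "carrier G = {\<one>\<^bsub>G\<^esub>}" using assms by (auto simp: trivial_group_def)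
  interpret G: comm_group G by (rule group.group_comm_groupI[OF G]) (auto simp: c)
  have "\<one>\<^bsub>G\<^esub> \<in> rat_span G {}"
    by (auto simp: rat_span_def intro!: exI[of _ "1::int"] generate.one)
  then have "carrier G \<subseteq> rat_span G {}" using c by simp
  then have "rank_basis G {}" by (simp add: rank_basis_def Z_independent_def)
  then show "finite_rank G" "group_rank G = 0"
    using G.group_rank_eq[of "{}"] by (auto simp: finite_rank_def)
qed

lemma iso_group_rank:
  assumes "comm_group A" "comm_group B" "A \<cong> B" "finite_rank A"
  shows "finite_rank B" "group_rank B = group_rank A"
proof -
  interpret A: comm_group A by fact
  interpret B: comm_group B by fact
  obtain f where f: "f \<in> iso A B" using assms by (auto simp: is_iso_def)
  then have f': "f \<in> hom A B" "inj_on f (carrier A)" "f ` carrier A = carrier B"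
    by (auto simp: iso_def bij_betw_def)
  \<comment> \<open>An isomorphism is treated as a short exact sequence with trivial
    quotient.\<close>
  let ?C = "singleton_group (\<one>\<^bsub>B\<^esub>)"
  have one: "\<one>\<^bsub>?C\<^esub> = \<one>\<^bsub>B\<^esub>" by (simp add: singleton_group_def)
  have C: "trivial_group ?C" by (simp add: trivial_group_def one)
  have g: "(\<lambda>_. \<one>\<^bsub>B\<^esub>) \<in> hom B ?C" by (simp add: B.hom_into_singleton_iff)
  have *: "(\<lambda>_. \<one>\<^bsub>B\<^esub>) ` carrier B = carrier ?C"
    "f ` carrier A = {x \<in> carrier B. \<one>\<^bsub>B\<^esub> = \<one>\<^bsub>?C\<^esub>}"
    using f' B.one_closed by (auto simp: one)
  note ex = group_rank_exact[OF assms(1,2) singleton_abelian_group f'(1,2) g * assms(4) trivial_group_rank(1)[OF C]]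
  show "finite_rank B" "group_rank B = group_rank A"
    using ex trivial_group_rank(2)[OF C] by simp_all
qed

lemma integer_group_rank: "finite_rank integer_group" "group_rank integer_group = 1"
proof -
  interpret comm_group integer_group by (rule abelian_integer_group)
  have "x \<in> generate integer_group {1}" for x
    using subgroup_int_pow_closed[OF generate_is_subgroup, of "{1}" 1 x] by (auto intro: generate.incl)
  then have "carrier integer_group \<subseteq> rat_span integer_group {1}"
    by (auto simp: rat_span_def intro: exI[of _ 1])
  moreover have "Z_independent integer_group {1}"
    unfolding Z_independent_def
  proof (intro conjI allI impI ballI)
    fix T x and k :: "int \<Rightarrow> int"
    assume T: "finite T \<and> T \<subseteq> {1} \<and> (\<Otimes>\<^bsub>integer_group\<^esub>x\<in>T. x [^]\<^bsub>integer_group\<^esub> k x) = \<one>\<^bsub>integer_group\<^esub>"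
      and x: "x \<in> T"
    then have "T = {1}" "x = 1" by auto
    then show "k x = 0" using T by simp
  qed auto
  ultimately have "rank_basis integer_group {1}" by (simp add: rank_basis_def)
  then show "finite_rank integer_group" "group_rank integer_group = 1"
    using group_rank_eq[of "{1}"] by (auto simp: finite_rank_def)
qed

section \<open>Direct sums of groups\<close>

lemma comm_group_sum_group:
  assumes "\<And>i. i \<in> I \<Longrightarrow> comm_group (G i)"
  shows "comm_group (sum_group I G)"
proof (rule group.group_comm_groupI)
  have gr: "group (G i)" if "i \<in> I" for i using assms[OF that] by (simp add: comm_group_def)
  then show "group (sum_group I G)" by simp
  fix x y assume "x \<in> carrier (sum_group I G)" "y \<in> carrier (sum_group I G)"
  then have "x i \<otimes>\<^bsub>G i\<^esub> y i = y i \<otimes>\<^bsub>G i\<^esub> x i" if "i \<in> I" for i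
    using assms[OF that] that gr
    by (intro comm_monoid.m_comm) (auto simp: carrier_sum_group comm_group_def PiE_iff)
  then show "x \<otimes>\<^bsub>sum_group I G\<^esub> y = y \<otimes>\<^bsub>sum_group I G\<^esub> x"
    by (auto intro!: restrict_ext)
qed

text \<open>Finite rank 0 means torsion. An element of a direct sum has finite support, so the
  product of the orders of its entries is one exponent that kills it.\<close>

lemma rank_sum_group_torsion:
  assumes G: "\<And>i. i \<in> I \<Longrightarrow> comm_group (G i)"
    and rk: "\<And>i. i \<in> I \<Longrightarrow> finite_rank (G i) \<and> group_rank (G i) = 0"
  shows "finite_rank (sum_group I G) \<and> group_rank (sum_group I G) = 0"
proof -
  have gr: "group (G i)" if "i \<in> I" for i using G[OF that] by (simp add: comm_group_def)
  interpret S: comm_group "sum_group I G" using G by (rule comm_group_sum_group)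
  have pow_nat: "(x [^]\<^bsub>sum_group I G\<^esub> (n::nat)) i = x i [^]\<^bsub>G i\<^esub> n"
    if "i \<in> I" for x n i
    using that by (induction n) auto
  have tors: "\<exists>n::nat. n > 0 \<and> y [^]\<^bsub>G i\<^esub> n = \<one>\<^bsub>G i\<^esub>" if i: "i \<in> I" and y: "y \<in> carrier (G i)" for i y
  proof -
    interpret Gi: comm_group "G i" using G i by auto
    obtain B where B: "finite B" "rank_basis (G i) B" using rk i by (auto simp: finite_rank_def)
    then have "B = {}" using rk i Gi.group_rank_eq by auto
    then obtain m :: int where m: "m \<noteq> 0" "y [^]\<^bsub>G i\<^esub> m \<in> {\<one>\<^bsub>G i\<^esub>}"
      using B y Gi.generate_empty by (auto simp: rank_basis_def rat_span_def)
    have "y [^]\<^bsub>G i\<^esub> (int (nat \<bar>m\<bar>)) = \<one>\<^bsub>G i\<^esub>"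
      using m y by (cases "m > 0") (auto simp: Gi.int_pow_neg)
    then show ?thesis using m by (intro exI[of _ "nat \<bar>m\<bar>"]) (auto simp flip: int_pow_int)
  qed
  have "x \<in> rat_span (sum_group I G) {}" if x: "x \<in> carrier (sum_group I G)" for x
  proof -
    define J where "J = {i \<in> I. x i \<noteq> \<one>\<^bsub>G i\<^esub>}"
    have J: "finite J" "\<And>i. i \<in> I \<Longrightarrow> x i \<in> carrier (G i)"
      using x gr by (auto simp: carrier_sum_group J_def PiE_iff)
    have "\<forall>i\<in>J. \<exists>n::nat. n > 0 \<and> x i [^]\<^bsub>G i\<^esub> n = \<one>\<^bsub>G i\<^esub>" using tors J by (auto simp: J_def)
    then obtain n :: "_ \<Rightarrow> nat" where n: "\<And>i. i \<in> J \<Longrightarrow> n i > 0 \<and> x i [^]\<^bsub>G i\<^esub> n i = \<one>\<^bsub>G i\<^esub>" by metis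
    define N where "N = prod n J"
    have "x i [^]\<^bsub>G i\<^esub> N = \<one>\<^bsub>G i\<^esub>" if i: "i \<in> I" for i
    proof -
      interpret Gi: comm_group "G i" using G i by auto
      show ?thesis
      proof (cases "i \<in> J")
        case True
        then have "N = n i * prod n (J - {i})" using J by (simp add: N_def prod.remove)
        then show ?thesis using n[OF True] J(2)[OF i] by (simp flip: Gi.nat_pow_pow)
      next
        case False
        then show ?thesis using i by (simp add: J_def)
      qed
    qed
    then have "(x [^]\<^bsub>sum_group I G\<^esub> N) i = \<one>\<^bsub>sum_group I G\<^esub> i" if "i \<in> I" for i
      using that by (simp add: pow_nat)
    moreover have "x [^]\<^bsub>sum_group I G\<^esub> N \<in> carrier (sum_group I G)" using x by simp
    ultimately have "x [^]\<^bsub>sum_group I G\<^esub> N = \<one>\<^bsub>sum_group I G\<^esub>"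
      using gr by (auto simp: carrier_sum_group PiE_iff extensional_def fun_eq_iff)
    moreover have "N > 0" unfolding N_def using n by (intro prod_pos) auto
    ultimately have "int N \<noteq> 0 \<and> x [^]\<^bsub>sum_group I G\<^esub> int N \<in> generate (sum_group I G) {}"
      using S.generate_empty by (simp add: int_pow_int)
    then show ?thesis using x unfolding rat_span_def by blast
  qed
  then have "rank_basis (sum_group I G) {}"
    by (auto simp: rank_basis_def Z_independent_def)
  then show ?thesis using S.group_rank_eq[of "{}"] by (auto simp: finite_rank_def)
qed

text \<open>Lattice homology is a sum over all integers \<open>n\<close>, of which only finitely
  many contribute rank. The summands in \<open>J\<close> are split off one at a time by exact
  sequences, and the rest is torsion.\<close>

theorem group_rank_sum_group:
  assumes "finite J" "J \<subseteq> I" "\<And>i. i \<in> I \<Longrightarrow> comm_group (G i)"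
    and "\<And>i. i \<in> I \<Longrightarrow> finite_rank (G i)" "\<And>i. i \<in> I - J \<Longrightarrow> group_rank (G i) = 0"
  shows "finite_rank (sum_group I G) \<and> group_rank (sum_group I G) = (\<Sum>i\<in>J. group_rank (G i))"
  using assms
proof (induction J arbitrary: I)
  case empty
  then show ?case using rank_sum_group_torsion[of I G] by simp
next
  case (insert j J)
  have gr: "group (G i)" if "i \<in> I" for i using insert.prems(2)[OF that] by (simp add: comm_group_def)
  define I' where "I' = I - {j}"
  have I: "j \<in> I" "j \<notin> I'" "\<And>i. i \<in> I' \<Longrightarrow> i \<in> I" "\<And>i. i \<in> I \<Longrightarrow> i = j \<or> i \<in> I'"
    using insert.prems by (auto simp: I'_def)
  have IH: "finite_rank (sum_group I' G) \<and> group_rank (sum_group I' G) = (\<Sum>i\<in>J. group_rank (G i))"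
    using insert.prems insert.hyps by (intro insert.IH) (auto simp: I'_def)
  \<comment> \<open>Extension by the identity; it replaces the value \<open>undefined\<close> that
    an element of the smaller sum takes at \<open>j\<close>.\<close>
  let ?f = "\<lambda>x. x(j := \<one>\<^bsub>G j\<^esub>)"
  interpret Gj: comm_group "G j" using insert.prems I by auto
  have mem: "x(j := a) \<in> carrier (sum_group I G)"
    if "x \<in> carrier (sum_group I' G)" "a \<in> carrier (G j)" for x a
  proof -
    have "{i \<in> I. (x(j := a)) i \<noteq> \<one>\<^bsub>G i\<^esub>} \<subseteq> insert j {i \<in> I'. x i \<noteq> \<one>\<^bsub>G i\<^esub>}" using I by auto
    moreover have "finite (insert j {i \<in> I'. x i \<noteq> \<one>\<^bsub>G i\<^esub>})"
      using that gr I by (auto simp: carrier_sum_group)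
    ultimately have "finite {i \<in> I. (x(j := a)) i \<noteq> \<one>\<^bsub>G i\<^esub>}" by (rule finite_subset)
    moreover have "x(j := a) \<in> (\<Pi>\<^sub>E i\<in>I. carrier (G i))"
      using that gr I(1,3,4) by (fastforce simp: carrier_sum_group PiE_iff extensional_def)
    ultimately show ?thesis using gr by (simp add: carrier_sum_group del: fun_upd_apply)
  qed
  have mem': "restrict x I' \<in> carrier (sum_group I' G)" if "x \<in> carrier (sum_group I G)" for x
  proof -
    have "{i \<in> I'. restrict x I' i \<noteq> \<one>\<^bsub>G i\<^esub>} \<subseteq> {i \<in> I. x i \<noteq> \<one>\<^bsub>G i\<^esub>}" using I by auto
    moreover have "finite {i \<in> I. x i \<noteq> \<one>\<^bsub>G i\<^esub>}" using that gr by (auto simp: carrier_sum_group)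
    ultimately have "finite {i \<in> I'. restrict x I' i \<noteq> \<one>\<^bsub>G i\<^esub>}" by (rule finite_subset)
    moreover have "x i \<in> carrier (G i)" if "i \<in> I'" for i
      using \<open>x \<in> carrier (sum_group I G)\<close> that gr I by (auto simp only: carrier_sum_group PiE_iff)
    then have "restrict x I' \<in> (\<Pi>\<^sub>E i\<in>I'. carrier (G i))" by auto
    ultimately show ?thesis using gr I by (simp add: carrier_sum_group del: restrict_apply)
  qed
  have ext: "i \<in> I" if "x \<in> carrier (sum_group I G)" "x i \<noteq> undefined" for x i
    using that gr by (auto simp: carrier_sum_group PiE_iff extensional_def)
  have grI': "\<And>i. i \<in> I' \<Longrightarrow> group (G i)" using gr I by auto
  have A: "comm_group (sum_group I' G)" "comm_group (sum_group I G)"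
    using insert.prems I by (intro comm_group_sum_group; auto)+
  have f: "?f \<in> hom (sum_group I' G) (sum_group I G)"
    using I by (intro homI mem) (auto simp: fun_eq_iff)
  have inj: "inj_on ?f (carrier (sum_group I' G))"
  proof (rule inj_onI)
    fix x y assume xy: "x \<in> carrier (sum_group I' G)" "y \<in> carrier (sum_group I' G)" "?f x = ?f y"
    have "x j = y j" using xy I grI' by (auto simp: carrier_sum_group PiE_iff extensional_def)
    moreover have "x i = y i" if "i \<noteq> j" for i using fun_cong[OF xy(3), of i] that by simp
    ultimately show "x = y" unfolding fun_eq_iff by metis
  qed
  have g: "(\<lambda>x. x j) \<in> hom (sum_group I G) (G j)"
    using I gr by (intro homI) (auto simp: carrier_sum_group PiE_iff)
  have surj: "(\<lambda>x. x j) ` carrier (sum_group I G) = carrier (G j)"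
  proof
    show "(\<lambda>x. x j) ` carrier (sum_group I G) \<subseteq> carrier (G j)" using g by (auto simp: hom_def)
    show "carrier (G j) \<subseteq> (\<lambda>x. x j) ` carrier (sum_group I G)"
    proof
      fix a assume a: "a \<in> carrier (G j)"
      have "\<one>\<^bsub>sum_group I' G\<^esub> \<in> carrier (sum_group I' G)"
        using A by (meson comm_group_def group.is_monoid monoid.one_closed)
      from mem[OF this a] show "a \<in> (\<lambda>x. x j) ` carrier (sum_group I G)"
        by (rule image_eqI[rotated]) (simp only: fun_upd_same)
    qed
  qed
  have ex: "?f ` carrier (sum_group I' G) = {x \<in> carrier (sum_group I G). x j = \<one>\<^bsub>G j\<^esub>}"
  proof
    show "?f ` carrier (sum_group I' G) \<subseteq> {x \<in> carrier (sum_group I G). x j = \<one>\<^bsub>G j\<^esub>}"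
      using mem by auto
    show "{x \<in> carrier (sum_group I G). x j = \<one>\<^bsub>G j\<^esub>} \<subseteq> ?f ` carrier (sum_group I' G)"
    proof
      fix x assume x: "x \<in> {x \<in> carrier (sum_group I G). x j = \<one>\<^bsub>G j\<^esub>}"
      then have "x i = ?f (restrict x I') i" for i
        using ext[of x i] I(4)[of i] by (cases "i = j"; cases "i \<in> I'") auto
      then have "x = ?f (restrict x I')" by (rule HOL.ext)
      then show "x \<in> ?f ` carrier (sum_group I' G)" using mem' x by blast
    qed
  qed
  have "finite_rank (sum_group I G)" "group_rank (sum_group I G) = group_rank (sum_group I' G) + group_rank (G j)"
    by (rule group_rank_exact[OF A Gj.comm_group_axioms f inj g surj ex]; use IH insert.prems I in auto)+
  then show ?case using IH insert.hyps by simp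
qed

section \<open>Homology of finite unions of open convex sets\<close>

text \<open>Exactness at \<open>B\<close> alone: the image of \<open>f\<close>, a quotient of
  \<open>A\<close>, and the image of \<open>g\<close>, a subgroup of \<open>C\<close>, both have
  finite rank and are the ends of a short exact sequence with \<open>B\<close> in the
  middle.\<close>

lemma exact_group_rank:
  assumes A: "comm_group A" and B: "comm_group B" and C: "comm_group C"
    and f: "f \<in> hom A B" and g: "g \<in> hom B C" and exact: "kernel B C g = f ` carrier A"
    and fin: "finite_rank A" "finite_rank C"
  shows "finite_rank B"
    and "group_rank B = group_rank (subgroup_generated B (f ` carrier A))
                        + group_rank (subgroup_generated C (g ` carrier B))"
proof -
  interpret A: comm_group A by fact
  interpret B: comm_group B by fact
  interpret C: comm_group C by fact
  interpret f: group_hom A B f using f by unfold_locales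
  interpret g: group_hom B C g using g by unfold_locales
  let ?A = "subgroup_generated B (f ` carrier A)" and ?C = "subgroup_generated C (g ` carrier B)"
  have cA: "carrier ?A = f ` carrier A"
    by (rule subgroup.carrier_subgroup_generated_subgroup[OF f.img_is_subgroup])
  have cC: "carrier ?C = g ` carrier B"
    by (rule subgroup.carrier_subgroup_generated_subgroup[OF g.img_is_subgroup])
  have cg: "comm_group ?A" "comm_group ?C"
    by (simp_all add: B.abelian_subgroup_generated C.abelian_subgroup_generated B C)
  have "f \<in> hom A ?A" using f by (auto simp: hom_def cA)
  then have fA: "finite_rank ?A"
    using A cg fin by (intro finite_rank_surjective[of A ?A f]) (auto simp: cA)
  have "id \<in> hom ?C C" using g by (auto simp: hom_def cC)
  then have fC: "finite_rank ?C"
    using C cg fin by (intro finite_rank_injective[of ?C C id]) auto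
  have "id \<in> hom ?A B" "g \<in> hom B ?C"
    using f g by (auto simp: hom_def cA cC)
  moreover have "id ` carrier ?A = {x \<in> carrier B. g x = \<one>\<^bsub>?C\<^esub>}"
    using exact by (auto simp: cA kernel_def)
  ultimately show "finite_rank B" "group_rank B = group_rank ?A + group_rank ?C"
    using group_rank_exact[of ?A B ?C id g] cg B fA fC by (auto simp: cC)
qed

text \<open>The second clause keeps the support of the sum in \<open>rel_euler_char\<close> finite;
  over an infinite support \<open>Sum_any\<close> is 0 and additivity would break down.\<close>

definition finite_type :: "'a topology \<Rightarrow> 'a set \<Rightarrow> bool" where
  "finite_type X S \<longleftrightarrow> (\<forall>p. finite_rank (relative_homology_group p X S)) \<and>
     (\<exists>N. \<forall>p\<ge>N. group_rank (relative_homology_group (int p) X S) = 0)"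

definition rel_euler_char :: "'a topology \<Rightarrow> 'a set \<Rightarrow> int" where
  "rel_euler_char X S =
     Sum_any (\<lambda>b::nat. (-1) ^ b * int (group_rank (relative_homology_group (int b) X S)))"

lemma rel_euler_char_eq:
  assumes "\<And>p. p \<ge> N \<Longrightarrow> group_rank (relative_homology_group (int p) X S) = 0"
  shows "rel_euler_char X S = (\<Sum>b<N. (-1) ^ b * int (group_rank (relative_homology_group (int b) X S)))"
proof -
  have "{b. (-1) ^ b * int (group_rank (relative_homology_group (int b) X S)) \<noteq> 0} \<subseteq> {..<N}"
  proof
    fix b assume b: "b \<in> {b. (-1) ^ b * int (group_rank (relative_homology_group (int b) X S)) \<noteq> 0}"
    show "b \<in> {..<N}"
    proof (rule ccontr)
      assume "b \<notin> {..<N}"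
      then have "group_rank (relative_homology_group (int b) X S) = 0" by (intro assms) simp
      then show False using b by simp
    qed
  qed
  then show ?thesis unfolding rel_euler_char_def by (intro Sum_any.expand_superset) auto
qed

text \<open>\<open>a\<close>, \<open>b\<close> and \<open>c\<close> are the ranks of the images of
  the three maps in the long exact sequence of the pair, \<open>c p\<close> that of the boundary map
  out of degree \<open>p\<close>; the rank of each group is the sum of those of its incoming and its
  outgoing image. The disjunction covers the passage from absolute to relative groups and
  back.\<close>

lemma pair_group_ranks:
  fixes X :: "'a topology"
  assumes "\<And>p. finite_rank (homology_group p (subtopology X S))"
    and "(\<forall>p. finite_rank (homology_group p X)) \<or> (\<forall>p. finite_rank (relative_homology_group p X S))"
  shows "\<exists>a b c :: int \<Rightarrow> nat. \<forall>p. finite_rank (homology_group p X) \<and> finite_rank (relative_homology_group p X S) \<and>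
     group_rank (homology_group p (subtopology X S)) = c (p + 1) + a p \<and>
     group_rank (homology_group p X) = a p + b p \<and>
     group_rank (relative_homology_group p X S) = b p + c p"
proof -
  let ?A = "\<lambda>p. homology_group p (subtopology X S)"
  let ?X = "\<lambda>p. homology_group p X"
  let ?R = "\<lambda>p. relative_homology_group p X S"
  let ?i = "\<lambda>p. hom_induced p (subtopology X S) {} X {} id"
  let ?j = "\<lambda>p. hom_induced p X {} X S id"
  let ?d = "\<lambda>p. hom_boundary p X S"
  define a where "a p = group_rank (subgroup_generated (?X p) (?i p ` carrier (?A p)))" for p
  define b where "b p = group_rank (subgroup_generated (?R p) (?j p ` carrier (?X p)))" for p
  define c where "c p = group_rank (subgroup_generated (?A (p - 1)) (?d p ` carrier (?R p)))" for p
  have h: "?i p \<in> hom (?A p) (?X p)" "?j p \<in> hom (?X p) (?R p)" "?d p \<in> hom (?R p) (?A (p - 1))" for p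
    by (simp_all add: hom_induced_hom hom_boundary_hom)
  have e1: "kernel (?R p) (?A (p - 1)) (?d p) = ?j p ` carrier (?X p)" for p
    using homology_exactness_axiom_1[of p X S] by simp
  have e2: "kernel (?A (p - 1)) (?X (p - 1)) (?i (p - 1)) = ?d p ` carrier (?R p)" for p
    using homology_exactness_axiom_2[of p X S] by simp
  have e3: "kernel (?X p) (?R p) (?j p) = ?i p ` carrier (?A p)" for p
    using homology_exactness_axiom_3[of p X S] by simp
  have fX: "finite_rank (?X p)" and fR: "finite_rank (?R p)" for p
    using assms(2)
      exact_group_rank(1)[of "?A p" "?X p" "?R p", OF _ _ _ h(1,2) e3]
      exact_group_rank(1)[of "?X p" "?R p" "?A (p - 1)", OF _ _ _ h(2,3) e1] assms(1)
    by auto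
  have "group_rank (?X p) = a p + b p" for p
    unfolding a_def b_def by (rule exact_group_rank(2)[OF _ _ _ h(1,2) e3]) (use assms fR in auto)
  moreover have "group_rank (?R p) = b p + c p" for p
    unfolding b_def c_def by (rule exact_group_rank(2)[OF _ _ _ h(2,3) e1]) (use assms fX in auto)
  moreover have "group_rank (?A (p - 1)) = c p + a (p - 1)" for p
    unfolding a_def c_def by (rule exact_group_rank(2)[OF _ _ _ h(3) h(1) e2]) (use fX fR in auto)
  then have "group_rank (?A p) = c (p + 1) + a p" for p by (metis add_diff_cancel_right')
  ultimately show ?thesis using fX fR by blast
qed

lemma finite_type_relative:
  assumes "finite_type (subtopology X S) {}" "finite_type X {}"
  shows "finite_type X S"
proof -
  obtain a b c :: "int \<Rightarrow> nat" where abc: "\<And>p. finite_rank (relative_homology_group p X S) \<and>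
     group_rank (homology_group p (subtopology X S)) = c (p + 1) + a p \<and>
     group_rank (homology_group p X) = a p + b p \<and>
     group_rank (relative_homology_group p X S) = b p + c p"
    using pair_group_ranks[of X S] assms unfolding finite_type_def by blast
  obtain N1 N2 where N: "\<forall>p\<ge>N1. group_rank (homology_group (int p) (subtopology X S)) = 0"
    "\<forall>p\<ge>N2. group_rank (homology_group (int p) X) = 0"
    using assms by (auto simp: finite_type_def)
  \<comment> \<open>The boundary map lowers the degree, so the subspace must have rank 0 already in
    degree \<open>p - 1\<close>; hence the \<open>Suc\<close>.\<close>
  have "group_rank (relative_homology_group (int p) X S) = 0" if "p \<ge> Suc (max N1 N2)" for p
  proof -
    have "group_rank (homology_group (int (p - 1)) (subtopology X S)) = 0"
      by (rule N(1)[rule_format]) (use that in linarith)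
    moreover have "group_rank (homology_group (int p) X) = 0" using N that by simp
    moreover have "int (p - 1) + 1 = int p" using that by simp
    ultimately show ?thesis using abc[of "int p"] abc[of "int (p - 1)"] by simp
  qed
  then show ?thesis using abc unfolding finite_type_def by blast
qed

lemma finite_type_absolute:
  assumes "finite_type (subtopology X S) {}" "finite_type X S"
  shows "finite_type X {}"
proof -
  obtain a b c :: "int \<Rightarrow> nat" where abc: "\<And>p. finite_rank (homology_group p X) \<and>
     group_rank (homology_group p (subtopology X S)) = c (p + 1) + a p \<and>
     group_rank (homology_group p X) = a p + b p \<and>
     group_rank (relative_homology_group p X S) = b p + c p"
    using pair_group_ranks[of X S] assms unfolding finite_type_def by blast
  obtain N1 N2 where N: "\<forall>p\<ge>N1. group_rank (homology_group (int p) (subtopology X S)) = 0"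
    "\<forall>p\<ge>N2. group_rank (relative_homology_group (int p) X S) = 0"
    using assms by (auto simp: finite_type_def)
  have "group_rank (homology_group (int p) X) = 0" if "p \<ge> max N1 N2" for p
    using N that abc[of "int p"] by simp
  then show ?thesis using abc unfolding finite_type_def by blast
qed

text \<open>In the alternating sum \<open>a\<close> and \<open>b\<close> cancel, and the boundary
  ranks \<open>c\<close> telescope to the two ends: \<open>c 0\<close> vanishes because homology in
  degree -1 is trivial, \<open>c N\<close> because all ranks are 0 from degree \<open>N\<close>
  on.\<close>

lemma euler_char_pair:
  assumes "finite_type (subtopology X S) {}" "finite_type X {}" "finite_type X S"
  shows "rel_euler_char X {} = rel_euler_char (subtopology X S) {} + rel_euler_char X S"
proof -
  obtain a b c :: "int \<Rightarrow> nat" where abc: "\<And>p. 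
     group_rank (homology_group p (subtopology X S)) = c (p + 1) + a p \<and>
     group_rank (homology_group p X) = a p + b p \<and>
     group_rank (relative_homology_group p X S) = b p + c p"
    using pair_group_ranks[of X S] assms unfolding finite_type_def by blast
  obtain N1 N2 N3 where N: "\<forall>p\<ge>N1. group_rank (homology_group (int p) (subtopology X S)) = 0"
    "\<forall>p\<ge>N2. group_rank (homology_group (int p) X) = 0"
    "\<forall>p\<ge>N3. group_rank (relative_homology_group (int p) X S) = 0"
    using assms by (auto simp: finite_type_def)
  define N where "N = max N1 (max N2 N3)"
  have cN: "c (int N) = 0" using abc[of "int N"] N by (simp add: N_def)
  have "group_rank (homology_group (-1) (subtopology X S)) = 0"
    by (intro trivial_group_rank trivial_homology_group) simp
  then have c0: "c 0 = 0" using abc[of "-1"] by simp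
  have tel: "(\<Sum>p<n. (-1) ^ p * (int (c (int p)) + int (c (int p + 1)))) = int (c 0) - (-1) ^ n * int (c (int n))" for n
    by (induction n) (auto simp: algebra_simps)
  have "rel_euler_char X {} = (\<Sum>p<N. (-1) ^ p * int (a p + b p))"
    using N by (subst rel_euler_char_eq[of N]) (auto simp: N_def abc intro!: sum.cong)
  moreover have "rel_euler_char (subtopology X S) {} = (\<Sum>p<N. (-1) ^ p * int (c (int p + 1) + a p))"
    using N by (subst rel_euler_char_eq[of N]) (auto simp: N_def abc intro!: sum.cong)
  moreover have "rel_euler_char X S = (\<Sum>p<N. (-1) ^ p * int (b p + c p))"
    using N by (subst rel_euler_char_eq[of N]) (auto simp: N_def abc intro!: sum.cong)
  ultimately have "rel_euler_char X {} - rel_euler_char (subtopology X S) {} - rel_euler_char X S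
    = (\<Sum>p<N. (-1) ^ p * int (a p + b p)) - (\<Sum>p<N. (-1) ^ p * int (c (int p + 1) + a p))
      - (\<Sum>p<N. (-1) ^ p * int (b p + c p))"
    by simp
  also have "\<dots> = - (\<Sum>p<N. (-1) ^ p * (int (c (int p)) + int (c (int p + 1))))"
    by (simp add: sum_subtractf[symmetric] sum_negf[symmetric] algebra_simps)
  also have "\<dots> = 0" unfolding tel using c0 cN by simp
  finally show ?thesis by simp
qed

section \<open>Homotopy invariance, excision and inclusion-exclusion\<close>

lemma iso_finite_type:
  assumes "\<And>p. relative_homology_group p X S \<cong> relative_homology_group p Y T" "finite_type X S"
  shows "finite_type Y T" "rel_euler_char Y T = rel_euler_char X S"
proof -
  have "finite_rank (relative_homology_group p Y T)"
    "group_rank (relative_homology_group p Y T) = group_rank (relative_homology_group p X S)" for p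
    using iso_group_rank[OF _ _ assms(1)[of p]] assms(2) by (auto simp: finite_type_def)
  then show "finite_type Y T" "rel_euler_char Y T = rel_euler_char X S"
    using assms(2) by (auto simp: finite_type_def rel_euler_char_def)
qed

lemma homotopy_equivalent_finite_type:
  assumes "X homotopy_equivalent_space Y" "finite_type X {}"
  shows "finite_type Y {}" "rel_euler_char Y {} = rel_euler_char X {}"
  using iso_finite_type[of X "{}" Y "{}"] assms homotopy_equivalent_space_imp_isomorphic_homology_groups
  by blast+

lemma open_excision:
  assumes "open A" "open B"
  shows "relative_homology_group p (top_of_set B) (A \<inter> B) \<cong> relative_homology_group p (top_of_set (A \<union> B)) A"
proof -
  let ?X = "top_of_set (A \<union> B)"
  \<comment> \<open>\<open>A - B\<close> is the complement of the open set \<open>B\<close> in the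
    union, hence closed, and it lies in the open set \<open>A\<close>; closure and interior in the
    excision hypothesis change nothing.\<close>
  have "closedin ?X (A - B)"
    using closedin_diff[of ?X "topspace ?X" B] assms openin_open_Int[of B "A \<union> B"]
    by (simp add: Int_absorb1 Un_Diff)
  then have c: "?X closure_of (A - B) = A - B" by (simp add: closure_of_eq)
  have "openin ?X A" using assms openin_open_Int[of A "A \<union> B"] by (simp add: Int_absorb1)
  then have i: "?X interior_of A = A" by (simp add: interior_of_eq)
  have "hom_induced p (subtopology ?X (A \<union> B - (A - B))) (A - (A - B)) (subtopology ?X (A \<union> B)) A id
    \<in> iso (relative_homology_group p (subtopology ?X (A \<union> B - (A - B))) (A - (A - B)))
          (relative_homology_group p (subtopology ?X (A \<union> B)) A)"
    by (rule homology_excision_axiom) (auto simp: c i)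
  moreover have "A \<union> B - (A - B) = B" "A - (A - B) = A \<inter> B" by auto
  ultimately show ?thesis by (auto simp: subtopology_subtopology is_iso_def Int_absorb1)
qed

text \<open>Mayer-Vietoris in numerical form: excision identifies the relative homology of
  \<open>A \<union> B\<close> modulo \<open>A\<close> with that of \<open>B\<close> modulo
  \<open>A \<inter> B\<close>, and additivity for the two pairs gives inclusion-exclusion.\<close>

lemma open_union_euler_char:
  fixes A B :: "'a::topological_space set"
  assumes "open A" "open B" "finite_type (top_of_set A) {}" "finite_type (top_of_set B) {}"
    and "finite_type (top_of_set (A \<inter> B)) {}"
  shows "finite_type (top_of_set (A \<union> B)) {}"
    and "rel_euler_char (top_of_set (A \<union> B)) {} =
      rel_euler_char (top_of_set A) {} + rel_euler_char (top_of_set B) {} - rel_euler_char (top_of_set (A \<inter> B)) {}"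
proof -
  have "B \<inter> (A \<inter> B) = A \<inter> B" "(A \<union> B) \<inter> A = A" by auto
  then have sub: "subtopology (top_of_set B) (A \<inter> B) = top_of_set (A \<inter> B)"
    "subtopology (top_of_set (A \<union> B)) A = top_of_set A"
    by (simp_all only: subtopology_subtopology)
  have 1: "finite_type (top_of_set B) (A \<inter> B)"
    by (rule finite_type_relative) (simp_all only: sub assms)
  have iso: "relative_homology_group p (top_of_set B) (A \<inter> B) \<cong> relative_homology_group p (top_of_set (A \<union> B)) A" for p
    using assms by (intro open_excision)
  have 2: "finite_type (top_of_set (A \<union> B)) A" and 
    3: "rel_euler_char (top_of_set (A \<union> B)) A = rel_euler_char (top_of_set B) (A \<inter> B)"
    using iso_finite_type[OF iso 1] by auto
  show 4: "finite_type (top_of_set (A \<union> B)) {}"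
    by (rule finite_type_absolute[of _ A]) (simp_all only: sub assms 2)
  have "rel_euler_char (top_of_set B) {} = rel_euler_char (top_of_set (A \<inter> B)) {} + rel_euler_char (top_of_set B) (A \<inter> B)"
    using euler_char_pair[of "top_of_set B" "A \<inter> B", unfolded sub] assms 1 by blast
  moreover have "rel_euler_char (top_of_set (A \<union> B)) {} = rel_euler_char (top_of_set A) {} + rel_euler_char (top_of_set (A \<union> B)) A"
    using euler_char_pair[of "top_of_set (A \<union> B)" A, unfolded sub] assms 2 4 by blast
  ultimately show "rel_euler_char (top_of_set (A \<union> B)) {} =
      rel_euler_char (top_of_set A) {} + rel_euler_char (top_of_set B) {} - rel_euler_char (top_of_set (A \<inter> B)) {}"
    using 3 by simp
qed

lemma finite_type_empty:
  "finite_type (top_of_set ({} :: 'a::topological_space set)) {}"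
  "rel_euler_char (top_of_set ({} :: 'a set)) {} = 0"
proof -
  have "trivial_group (homology_group p (trivial_topology :: 'a topology))" for p :: int
    by (intro trivial_homology_group_empty) simp
  then show "finite_type (top_of_set ({} :: 'a set)) {}" "rel_euler_char (top_of_set ({} :: 'a set)) {} = 0"
    by (auto simp: finite_type_def rel_euler_char_def trivial_group_rank)
qed

lemma contractible_group_rank:
  fixes S :: "'a::real_normed_vector set"
  assumes "contractible S" "S \<noteq> {}"
  shows "finite_rank (homology_group p (top_of_set S)) \<and>
    group_rank (homology_group p (top_of_set S)) = (if p = 0 then 1 else 0)"
proof -
  obtain a where a: "a \<in> S" using assms by auto
  have "top_of_set S homotopy_equivalent_space top_of_set {a}"
    using assms by (intro homotopy_eqv_contractible_sets) auto
  then have "homology_group p (top_of_set {a}) \<cong> homology_group p (top_of_set S)"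
    using homotopy_equivalent_space_sym homotopy_equivalent_space_imp_isomorphic_homology_groups by blast
  then have *: "finite_rank (homology_group p (top_of_set S)) \<and>
     group_rank (homology_group p (top_of_set S)) = group_rank (homology_group p (top_of_set {a}))"
    if "finite_rank (homology_group p (top_of_set {a}))"
    using iso_group_rank[of "homology_group p (top_of_set {a})" "homology_group p (top_of_set S)"] that by simp
  show ?thesis
  proof (cases "p = 0")
    case True
    have "homology_group 0 (top_of_set {a}) \<cong> integer_group"
      by (rule homology_coefficients) simp
    then have "integer_group \<cong> homology_group 0 (top_of_set {a})" by (simp add: group.iso_sym)
    then have "finite_rank (homology_group 0 (top_of_set {a})) \<and> group_rank (homology_group 0 (top_of_set {a})) = 1"
      using iso_group_rank[of integer_group "homology_group 0 (top_of_set {a})"]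
        abelian_integer_group integer_group_rank by simp
    then show ?thesis using * True by simp
  next
    case False
    then have "trivial_group (homology_group p (top_of_set {a}))"
      by (intro homology_dimension_axiom) simp
    then show ?thesis using * False by (simp add: trivial_group_rank)
  qed
qed

lemma contractible_finite_type:
  fixes S :: "'a::real_normed_vector set"
  assumes "contractible S" "S \<noteq> {}"
  shows "finite_type (top_of_set S) {}" "rel_euler_char (top_of_set S) {} = 1"
proof -
  note rk = contractible_group_rank[OF assms]
  show "finite_type (top_of_set S) {}"
    using rk by (auto simp: finite_type_def intro!: exI[of _ 1])
  show "rel_euler_char (top_of_set S) {} = 1"
    using rk by (subst rel_euler_char_eq[of 1]) auto
qed

text \<open>\<open>\<nu>\<close> is any additive set function with value 1 on the nonempty members
  of an intersection-stable family of convex open sets. The Euler characteristic satisfies the same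
  inclusion-exclusion and the same normalization, which leaves no room for a difference on finite
  unions.\<close>

theorem euler_char_Union_open_convex:
  fixes \<V> :: "'a::real_normed_vector set set" and \<nu> :: "'a set \<Rightarrow> int"
  assumes \<V>: "\<And>U. U \<in> \<V> \<Longrightarrow> open U \<and> convex U"
    and Int: "\<And>U V. U \<in> \<V> \<Longrightarrow> V \<in> \<V> \<Longrightarrow> U \<inter> V \<in> \<V>"
    and \<nu>: "\<nu> {} = 0" "\<And>A B. \<nu> (A \<union> B) + \<nu> (A \<inter> B) = \<nu> A + \<nu> B"
      "\<And>U. U \<in> \<V> \<Longrightarrow> U \<noteq> {} \<Longrightarrow> \<nu> U = 1"
    and "finite \<U>" "\<U> \<subseteq> \<V>"
  shows "finite_type (top_of_set (\<Union>\<U>)) {} \<and> rel_euler_char (top_of_set (\<Union>\<U>)) {} = \<nu> (\<Union>\<U>)"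
  using assms(6,7)
proof (induction "card \<U>" arbitrary: \<U> rule: less_induct)
  case less
  show ?case
  proof (cases "\<U> = {}")
    case True
    then show ?thesis using finite_type_empty \<nu> by auto
  next
    case False
    then obtain U where U: "U \<in> \<U>" by auto
    define \<W> where "\<W> = \<U> - {U}"
    \<comment> \<open>The overlap of \<open>U\<close> with the remaining union is again a union of
      members of the family, at most as many as in \<open>\<W>\<close>, so induction on the
      cardinality reaches it too.\<close>
    define \<W>' where "\<W>' = (\<lambda>V. V \<inter> U) ` \<W>"
    have fin: "finite \<W>" "finite \<W>'" using less by (auto simp: \<W>_def \<W>'_def)
    have "card \<W> < card \<U>" using less U unfolding \<W>_def by (intro card_Diff1_less)
    moreover from this have "card \<W>' < card \<U>" using card_image_le[OF fin(1), of "\<lambda>V. V \<inter> U"] by (simp add: \<W>'_def)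
    moreover have sub: "\<W> \<subseteq> \<V>" using less U by (auto simp: \<W>_def)
    moreover from this have sub': "\<W>' \<subseteq> \<V>" using less U Int unfolding \<W>'_def by blast
    ultimately have
      1: "finite_type (top_of_set (\<Union>\<W>)) {}" "rel_euler_char (top_of_set (\<Union>\<W>)) {} = \<nu> (\<Union>\<W>)" and
      2: "finite_type (top_of_set (\<Union>\<W>')) {}" "rel_euler_char (top_of_set (\<Union>\<W>')) {} = \<nu> (\<Union>\<W>')"
      using less.hyps fin by auto
    have "U \<in> \<V>" using U less by auto
    then have 3: "finite_type (top_of_set U) {}" "rel_euler_char (top_of_set U) {} = \<nu> U"
      using finite_type_empty contractible_finite_type[of U] convex_imp_contractible[of U] \<V>[of U] \<nu>
      by (cases "U = {}"; simp)+
    have eq: "\<Union>\<W>' = \<Union>\<W> \<inter> U" "\<Union>\<U> = \<Union>\<W> \<union> U" using U by (auto simp: \<W>_def \<W>'_def)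
    have "open (\<Union>\<W>)" "open U" using \<V> sub \<open>U \<in> \<V>\<close> by auto
    from open_union_euler_char[OF this 1(1) 3(1)] 1 2 3 \<nu>(2)[of "\<Union>\<W>" U]
    show ?thesis unfolding eq by simp
  qed
qed

text \<open>Reduced homology is the kernel of the map to the homology of a point. That map is onto
  because any point of \<open>X\<close> gives a section, and the point contributes the rank
  1.\<close>

lemma reduced_homology_rank:
  fixes X :: "'a topology"
  assumes "topspace X \<noteq> {}" "finite_rank (homology_group 0 X)"
  shows "finite_rank (reduced_homology_group 0 X)"
    and "group_rank (homology_group 0 X) = group_rank (reduced_homology_group 0 X) + 1"
proof -
  let ?P = "discrete_topology {()}"
  let ?h = "hom_induced 0 X {} ?P {} (\<lambda>x. ())"
  let ?R = "reduced_homology_group 0 X"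
  obtain x where x: "x \<in> topspace X" using assms(1) by blast
  have "retraction_map X ?P (\<lambda>x. ())"
    unfolding retraction_map_def retraction_maps_def using x
    by (intro exI[of _ "\<lambda>_. x"]) auto
  then have "?h \<in> epi (homology_group 0 X) (homology_group 0 ?P)"
    by (rule epi_hom_induced_retraction_map)
  then have h: "?h \<in> hom (homology_group 0 X) (homology_group 0 ?P)"
    "?h ` carrier (homology_group 0 X) = carrier (homology_group 0 ?P)"
    by (auto simp: epi_def)
  have R: "comm_group ?R"
    unfolding reduced_homology_group_def by (rule group.abelian_subgroup_generated) auto
  have id: "id \<in> hom ?R (homology_group 0 X)"
    using carrier_reduced_homology_group_subset[of 0 X]
    by (auto simp: hom_def reduced_homology_group_def)
  show f: "finite_rank ?R"
    by (rule finite_rank_injective[OF R _ id]) (use assms in auto)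
  have "integer_group \<cong> homology_group 0 ?P"
    by (rule group.iso_sym) (auto intro!: homology_coefficients simp: group_relative_homology_group)
  then have P: "finite_rank (homology_group 0 ?P)" "group_rank (homology_group 0 ?P) = 1"
    using iso_group_rank[of integer_group "homology_group 0 ?P"] abelian_integer_group integer_group_rank
    by auto
  have "group_rank (homology_group 0 X) = group_rank ?R + group_rank (homology_group 0 ?P)"
    by (rule group_rank_exact(2)[OF R _ _ id _ h])
       (use f P in \<open>auto simp: carrier_reduced_homology_group kernel_def\<close>)
  then show "group_rank (homology_group 0 X) = group_rank ?R + 1" using P by simp
qed

section \<open>Cubical complexes\<close>

lemma vertex_nth [simp]: "vertex l J $ i = l $ i + (if i \<in> J then 1 else 0)"
  by (simp add: vertex_def)

lemma sum_Pow_alternating: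
  assumes "finite S"
  shows "(\<Sum>I\<in>Pow S. (-1) ^ card I) = (if S = {} then 1 else 0 :: int)"
  using assms
proof (induction S)
  case (insert a S)
  have "(\<Sum>I\<in>insert a ` Pow S. (-1) ^ card I) = (\<Sum>I\<in>Pow S. (-1) ^ card (insert a I) :: int)"
    using insert by (subst sum.reindex) (auto simp: inj_on_def)
  also have "\<dots> = (\<Sum>I\<in>Pow S. - ((-1) ^ card I))"
  proof (rule sum.cong)
    fix I assume I: "I \<in> Pow S"
    then have "finite I" "a \<notin> I" using insert by (auto intro: finite_subset)
    then show "(-1) ^ card (insert a I) = - ((-1) ^ card I :: int)" by simp
  qed simp
  finally have "(\<Sum>I\<in>insert a ` Pow S. (-1) ^ card I) = - (\<Sum>I\<in>Pow S. (-1) ^ card I :: int)"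
    by (simp add: sum_negf)
  then show ?case using insert
    unfolding Pow_insert by (subst sum.union_disjoint) auto
qed simp

text \<open>A cube is kept as the pair of its lowest vertex and its set of directions. In particular
  \<open>cells l (vertex l I)\<close> is the set of all faces of \<open>cube l I\<close>, which is
  how closure under faces is expressed below.\<close>

definition cells :: "nat ^ 'r \<Rightarrow> nat ^ 'r \<Rightarrow> ((nat ^ 'r) \<times> 'r set) set" where
  "cells L U = {(l, I). \<forall>i. L $ i \<le> l $ i \<and> vertex l I $ i \<le> U $ i}"

lemma finite_vec_box: "finite {l :: nat ^ 'r::finite. \<forall>i. l $ i \<le> U $ i}"
proof -
  have "{l :: nat ^ 'r. \<forall>i. l $ i \<le> U $ i} \<subseteq> vec_lambda ` (PiE UNIV (\<lambda>i. {..U $ i}))"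
  proof
    fix l :: "nat ^ 'r" assume "l \<in> {l. \<forall>i. l $ i \<le> U $ i}"
    then have "l = vec_lambda (($) l)" "($) l \<in> PiE UNIV (\<lambda>i. {..U $ i})" by auto
    then show "l \<in> vec_lambda ` (PiE UNIV (\<lambda>i. {..U $ i}))" by blast
  qed
  then show ?thesis by (rule finite_subset) (auto intro!: finite_PiE)
qed

lemma cells_Sigma_bottom:
  "cells L U = Sigma {l. \<forall>i. L $ i \<le> l $ i \<and> l $ i \<le> U $ i} (\<lambda>l. Pow {i. l $ i < U $ i})"
  by (force simp: cells_def Suc_le_eq split: if_splits)

lemma finite_cells [simp]: "finite (cells L (U :: nat ^ 'r::finite))"
  unfolding cells_Sigma_bottom
  by (rule finite_SigmaI) (auto intro: finite_subset[OF _ finite_vec_box[of U]])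

text \<open>The cells with lowest vertex \<open>l\<close> correspond to the subsets of the
  coordinates in which \<open>l\<close> is below \<open>U\<close>; their signs cancel unless
  \<open>l = U\<close>. For constant \<open>g\<close> this is the Euler characteristic 1 of a
  box.\<close>

lemma sum_cells_bottom:
  fixes L U :: "nat ^ 'r::finite"
  assumes "\<And>i. L $ i \<le> U $ i"
  shows "(\<Sum>(l, I)\<in>cells L U. (-1) ^ card I * g l) = (g U :: int)"
proof -
  let ?B = "{l. \<forall>i. L $ i \<le> l $ i \<and> l $ i \<le> U $ i}"
  have fin: "finite ?B" by (auto intro: finite_subset[OF _ finite_vec_box[of U]])
  have "(\<Sum>(l, I)\<in>cells L U. (-1) ^ card I * g l)
     = (\<Sum>l\<in>?B. \<Sum>I\<in>Pow {i. l $ i < U $ i}. (-1) ^ card I * g l)"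
    unfolding cells_Sigma_bottom using fin by (subst sum.Sigma) auto
  also have "\<dots> = (\<Sum>l\<in>?B. if l = U then g l else 0)"
  proof (rule sum.cong)
    fix l assume l: "l \<in> ?B"
    have "{i. l $ i < U $ i} = {} \<longleftrightarrow> l = U"
      using l by (auto simp: vec_eq_iff le_less dest: spec)
    then show "(\<Sum>I\<in>Pow {i. l $ i < U $ i}. (-1) ^ card I * g l) = (if l = U then g l else 0)"
      using sum_Pow_alternating[of "{i. l $ i < U $ i}"] by (simp flip: sum_distrib_right)
  qed simp
  also have "\<dots> = g U" using fin assms by (simp add: sum.delta')
  finally show ?thesis .
qed

lemma sum_cells_top:
  fixes L U :: "nat ^ 'r::finite"
  assumes "\<And>i. L $ i \<le> U $ i"
  shows "(\<Sum>(l, I)\<in>cells L U. (-1) ^ card I * g (vertex l I)) = (g L :: int)"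
proof -
  let ?B = "{l. \<forall>i. L $ i \<le> l $ i \<and> l $ i \<le> U $ i}"
  let ?S = "Sigma ?B (\<lambda>v. Pow {i. L $ i < v $ i})"
  have fin: "finite ?B" by (auto intro: finite_subset[OF _ finite_vec_box[of U]])
  have "(\<Sum>(l, I)\<in>cells L U. (-1) ^ card I * g (vertex l I)) = (\<Sum>(v, I)\<in>?S. (-1) ^ card I * g v)"
  \<comment> \<open>Cells are regrouped by their highest vertex, so that the surviving term sits at
    \<open>L\<close> instead of \<open>U\<close>. The truncated subtraction is exact because
    \<open>v $ i > L $ i\<close> for \<open>i\<close> in \<open>I\<close>.\<close>
  proof (rule sum.reindex_bij_witness[of _ "\<lambda>(v, I). (\<chi> i. v $ i - (if i \<in> I then 1 else 0), I)" "\<lambda>(l, I). (vertex l I, I)"])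
    fix a assume "a \<in> cells L U"
    then show "(case case a of (l, I) \<Rightarrow> (vertex l I, I) of (v, I) \<Rightarrow> (\<chi> i. v $ i - (if i \<in> I then 1 else 0), I)) = a"
      by (auto simp: vec_eq_iff split: prod.splits)
    from \<open>a \<in> cells L U\<close> show "(case a of (l, I) \<Rightarrow> (vertex l I, I)) \<in> ?S"
      by (auto simp: cells_def less_Suc_eq_le trans_le_add1)
  next
    fix b assume b: "b \<in> ?S"
    obtain v I where [simp]: "b = (v, I)" by (cases b)
    have 1: "v $ i > L $ i" if "i \<in> I" for i using b that by auto
    have 2: "v $ i \<ge> 1" if "i \<in> I" for i using 1[OF that] by linarith
    show "(case case b of (v, I) \<Rightarrow> (\<chi> i. v $ i - (if i \<in> I then 1 else 0), I) of (l, I) \<Rightarrow> (vertex l I, I)) = b"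
      using 2 by (auto simp: vec_eq_iff)
    show "(case b of (v, I) \<Rightarrow> (\<chi> i. v $ i - (if i \<in> I then 1 else 0), I)) \<in> cells L U"
      using b 1 2 by (fastforce simp: cells_def)
  qed auto
  also have "\<dots> = (\<Sum>l\<in>?B. \<Sum>I\<in>Pow {i. L $ i < l $ i}. (-1) ^ card I * g l)"
    using fin by (subst sum.Sigma) auto
  also have "\<dots> = (\<Sum>l\<in>?B. if l = L then g l else 0)"
  proof (rule sum.cong)
    fix l assume l: "l \<in> ?B"
    have "{i. L $ i < l $ i} = {} \<longleftrightarrow> l = L"
      using l by (auto simp: vec_eq_iff le_less dest: spec)
    then show "(\<Sum>I\<in>Pow {i. L $ i < l $ i}. (-1) ^ card I * g l) = (if l = L then g l else 0)"
      using sum_Pow_alternating[of "{i. L $ i < l $ i}"] by (simp flip: sum_distrib_right)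
  qed simp
  also have "\<dots> = g L" using fin assms by (simp add: sum.delta')
  finally show ?thesis .
qed

text \<open>Straight-line homotopies join both composites to the identity. \<open>f\<close> may move
  points of \<open>K\<close>, as \<open>squeeze\<close> does, as long as the segments stay inside
  \<open>K\<close>.\<close>

lemma deformation_homotopy_equivalent:
  fixes f :: "'a::real_normed_vector \<Rightarrow> 'a"
  assumes "K \<subseteq> T" "continuous_on T f" "f ` T \<subseteq> K"
    and "\<And>x. x \<in> T \<Longrightarrow> closed_segment (f x) x \<subseteq> T" "\<And>x. x \<in> K \<Longrightarrow> closed_segment (f x) x \<subseteq> K"
  shows "top_of_set T homotopy_equivalent_space top_of_set K"
  unfolding homotopy_equivalent_space_def
proof (intro exI conjI)
  show "continuous_map (top_of_set T) (top_of_set K) f"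
    unfolding continuous_map_in_subtopology using assms(2,3)
    by (simp only: continuous_map_iff_continuous topspace_euclidean_subtopology image_subset_iff_funcset)
  show "continuous_map (top_of_set K) (top_of_set T) id"
    unfolding continuous_map_in_subtopology using assms(1)
    by (simp only: continuous_map_iff_continuous topspace_euclidean_subtopology image_id id_apply
      continuous_on_id' id_def flip: image_subset_iff_funcset) simp
  show "homotopic_with_canon (\<lambda>x. True) T T (id \<circ> f) id"
    by (rule homotopic_with_linear) (simp_all add: assms)
  have "continuous_on K f" using assms(1,2) by (rule continuous_on_subset[rotated])
  then show "homotopic_with_canon (\<lambda>x. True) K K (f \<circ> id) id"
    by (intro homotopic_with_linear) (simp_all add: assms)
qed

text \<open>The open neighbourhoods of the cubes meet exactly when the cubes do, and \<open>squeeze\<close> maps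
  each of them into its cube.\<close>

definition thick :: "nat ^ 'r \<Rightarrow> 'r set \<Rightarrow> (real ^ 'r) set" where
  "thick l I = {x. \<forall>i. real (l $ i) - 1 / 4 < x $ i \<and> x $ i < real (l $ i) + (if i \<in> I then 1 else 0) + 1 / 4}"

definition squeeze :: "nat \<Rightarrow> real ^ 'r \<Rightarrow> real ^ 'r" where
  "squeeze N x = (\<chi> i. \<Sum>k<N. max 0 (min 1 (2 * (x $ i - real k) - 1 / 2)))"

text \<open>The barycentre serves as a sample point: counting with signs the barycentres in a set is
  a finitely additive set function that sees the cells.\<close>

definition center :: "nat ^ 'r \<Rightarrow> 'r set \<Rightarrow> real ^ 'r" where
  "center l I = (\<chi> i. real (l $ i) + (if i \<in> I then 1 / 2 else 0))"

lemma cube_subset_thick: "cube l I \<subseteq> thick l I"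
proof
  fix x assume "x \<in> cube l I"
  then have "real (l $ i) \<le> x $ i \<and> x $ i \<le> real (l $ i) + (if i \<in> I then 1 else 0)" for i
    unfolding cube_def by blast
  then have "real (l $ i) - 1 / 4 < x $ i \<and> x $ i < real (l $ i) + (if i \<in> I then 1 else 0) + 1 / 4" for i
    by (smt (verit) divide_pos_pos zero_less_numeral)
  then show "x \<in> thick l I" unfolding thick_def by blast
qed

text \<open>Each summand of \<open>squeeze\<close> is a ramp from 0 at \<open>k + 1 / 4\<close> to 1
  at \<open>k + 3 / 4\<close>, so every coordinate follows a staircase that is flat within 1/4 of
  the integers. On the thickened cube the ramps with \<open>k\<close> below \<open>l $ i\<close> are
  complete, and those from its upper end on have not begun; \<open>N\<close> makes the sum contain
  the former.\<close>

lemma squeeze_in_cube: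
  assumes "x \<in> thick l I" "\<And>i. l $ i \<le> N"
  shows "squeeze N x \<in> cube l I"
  unfolding cube_def
proof (clarify, intro conjI)
  fix i
  let ?t = "x $ i" and ?e = "if i \<in> I then 1 else 0 :: nat"
  let ?f = "\<lambda>k. max 0 (min 1 (2 * (?t - real k) - 1 / 2))"
  have t: "real (l $ i) - 1 / 4 < ?t" "?t < real (l $ i) + real ?e + 1 / 4"
    using assms(1) by (auto simp: thick_def dest: spec[of _ i])
  have "real (l $ i) = (\<Sum>k<N. if k < l $ i then 1 else 0)"
    using assms(2)[of i]
    by (simp add: sum.If_cases Int_absorb1 lessThan_subset_iff flip: lessThan_def)
  also have "\<dots> \<le> (\<Sum>k<N. ?f k)"
  proof (rule sum_mono)
    fix k
    have "real k + 1 \<le> real (l $ i)" if "k < l $ i" using that by linarith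
    then show "(if k < l $ i then 1 else 0) \<le> ?f k" using t by auto
  qed
  finally show "real (l $ i) \<le> squeeze N x $ i" by (simp add: squeeze_def)
  have "(\<Sum>k<N. ?f k) \<le> (\<Sum>k<N. if k < l $ i + ?e then 1 else 0)"
  proof (rule sum_mono)
    fix k
    have "real k \<ge> real (l $ i) + real ?e" if "\<not> k < l $ i + ?e" using that by linarith
    then show "?f k \<le> (if k < l $ i + ?e then 1 else 0)" using t by auto
  qed
  also have "\<dots> = real (card ({..<N} \<inter> {..<l $ i + ?e}))"
    by (simp add: sum.If_cases lessThan_def)
  also have "\<dots> \<le> real (card {..<l $ i + ?e})"
    by (intro of_nat_mono card_mono) auto
  finally show "squeeze N x $ i \<le> real (l $ i) + (if i \<in> I then 1 else 0)" by (auto simp: squeeze_def)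
qed

lemma convex_cube: "convex (cube l I)" and convex_thick: "convex (thick l I)"
proof -
  have c: "cube l I = {x. \<forall>i. x $ i \<in> {real (l $ i) .. real (l $ i) + (if i \<in> I then 1 else 0)}}"
    by (auto simp: cube_def)
  have t: "thick l I = {x. \<forall>i. x $ i \<in> {real (l $ i) - 1 / 4 <..< real (l $ i) + (if i \<in> I then 1 else 0) + 1 / 4}}"
    by (auto simp: thick_def)
  have *: "convex {x :: real ^ 'a. \<forall>i. x $ i \<in> S i}" if "\<And>i. convex (S i)" for S
    using that by (auto simp: convex_def)
  show "convex (cube l I)" "convex (thick l I)"
    unfolding c t by (rule *; simp)+
qed

lemma open_thick: "open (thick l (I :: 'r::finite set))"
proof -
  have "thick l I = (\<Inter>i. {x. real (l $ i) - 1 / 4 < x $ i} \<inter> {x. x $ i < real (l $ i) + (if i \<in> I then 1 else 0) + 1 / 4})"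
    unfolding thick_def by blast
  also have "open \<dots>"
    by (intro open_INT ballI open_Int open_Collect_less continuous_intros) auto
  finally show ?thesis .
qed

lemma thick_Int:
  assumes "thick l I \<inter> thick l' I' \<noteq> {}"
  shows "\<exists>I''. thick l I \<inter> thick l' I' = thick (\<chi> i. max (l $ i) (l' $ i)) I'' \<and>
     (\<forall>i. vertex (\<chi> i. max (l $ i) (l' $ i)) I'' $ i \<le> vertex l I $ i)"
proof -
  obtain x where x: "x \<in> thick l I" "x \<in> thick l' I'" using assms by auto
  define m where "m i = max (l $ i) (l' $ i)" for i
  define M where "M i = min (vertex l I $ i) (vertex l' I' $ i)" for i
  define I'' where "I'' = {i. m i < M i}"
  have b: "real (m i) - 1 / 4 < x $ i" "x $ i < real (M i) + 1 / 4" for i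
    using x by (auto simp: thick_def m_def M_def dest!: spec[of _ i])
  \<comment> \<open>The two margins of 1/4 add up to less than 1, so by integrality thickened cubes
    meet only if the cubes do, and then around the common face with lowest vertex \<open>m\<close>
    and highest vertex \<open>M\<close>.\<close>
  have "real (m i) < real (M i) + 1" for i using b[of i] by linarith
  then have le: "m i \<le> M i" for i by (metis of_nat_Suc of_nat_less_iff less_Suc_eq_le add.commute)
  have le': "M i \<le> m i + 1" for i by (auto simp: m_def M_def)
  have M: "M i = m i + (if i \<in> I'' then 1 else 0)" for i
    using le[of i] le'[of i] by (cases "m i < M i") (auto simp: I''_def)
  have "thick l I \<inter> thick l' I' = {x. \<forall>i. real (m i) - 1 / 4 < x $ i \<and> x $ i < real (M i) + 1 / 4}"
  proof -
    have "(real (l $ i) - 1 / 4 < x $ i \<and> x $ i < real (l $ i) + (if i \<in> I then 1 else 0) + 1 / 4) \<and>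
      (real (l' $ i) - 1 / 4 < x $ i \<and> x $ i < real (l' $ i) + (if i \<in> I' then 1 else 0) + 1 / 4) \<longleftrightarrow>
      real (m i) - 1 / 4 < x $ i \<and> x $ i < real (M i) + 1 / 4" for x :: "real ^ 'a" and i
    proof -
      have m: "real (m i) = max (real (l $ i)) (real (l' $ i))" by (simp add: m_def)
      have M: "real (M i) = min (real (l $ i) + (if i \<in> I then 1 else 0)) (real (l' $ i) + (if i \<in> I' then 1 else 0))"
        by (auto simp: M_def min_def)
      have "(a - 1 / 4 < t \<and> t < a + e + 1 / 4) \<and> (b - 1 / 4 < t \<and> t < b + e' + 1 / 4) \<longleftrightarrow>
        max a b - 1 / 4 < t \<and> t < min (a + e) (b + e') + 1 / 4" for a b e e' t :: real
        by (auto simp: max_def min_def)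
      then show ?thesis unfolding m M by blast
    qed
    then show ?thesis unfolding thick_def by blast
  qed
  also have "\<dots> = thick (\<chi> i. m i) I''" unfolding M by (auto simp: thick_def)
  finally show ?thesis 
  proof (intro exI[of _ I''] conjI allI)
    fix i
    have "vertex (\<chi> i. max (l $ i) (l' $ i)) I'' $ i = M i" by (simp add: M m_def)
    also have "\<dots> \<le> vertex l I $ i" by (simp add: M_def)
    finally show "vertex (\<chi> i. max (l $ i) (l' $ i)) I'' $ i \<le> vertex l I $ i" .
  qed (simp add: m_def)
qed


text \<open>Barycentres have half-integral coordinates, so a margin of 1/4 lets in no further ones:
  the strict inequalities with margin amount to the cell being a face of the cube.\<close>

lemma center_in_thick_iff: "center l I \<in> thick l' I' \<longleftrightarrow> (l, I) \<in> cells l' (vertex l' I')"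
proof -
  have "real (l' $ i) - 1 / 4 < center l I $ i \<and> center l I $ i < real (l' $ i) + (if i \<in> I' then 1 else 0) + 1 / 4
     \<longleftrightarrow> l' $ i \<le> l $ i \<and> vertex l I $ i \<le> vertex l' I' $ i" for i
  proof -
    have *: "real a - 1 / 4 < real b + e \<longleftrightarrow> a \<le> b" if "e = 0 \<or> e = 1 / 2" for a b :: nat and e :: real
    proof
      assume "real a - 1 / 4 < real b + e"
      then have "real a < real (b + 1)" using that by auto
      then show "a \<le> b" by linarith
    next
      assume "a \<le> b"
      then show "real a - 1 / 4 < real b + e" using that by auto
    qed
    have 1: "real (l' $ i) - 1 / 4 < center l I $ i \<longleftrightarrow> l' $ i \<le> l $ i"
      unfolding center_def vec_lambda_beta by (rule *) auto
    have "real (vertex l I $ i) - 1 / 4 < real (vertex l' I' $ i) + (if i \<in> I then 1 / 2 else 0)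
       \<longleftrightarrow> vertex l I $ i \<le> vertex l' I' $ i"
      by (rule *) auto
    moreover have "center l I $ i < real (l' $ i) + (if i \<in> I' then 1 else 0) + 1 / 4 \<longleftrightarrow>
      real (vertex l I $ i) - 1 / 4 < real (vertex l' I' $ i) + (if i \<in> I then 1 / 2 else 0)"
      by (cases "i \<in> I"; cases "i \<in> I'"; simp add: center_def; linarith)
    ultimately show ?thesis using 1 by blast
  qed
  then show ?thesis by (simp add: thick_def cells_def)
qed

text \<open>\<open>squeeze\<close> maps every thickened cube and every cube into itself. Both are
  convex, so the segment from a point to its image never leaves the piece containing the
  point.\<close>

lemma squeeze_homotopy_equivalent:
  fixes \<C> :: "((nat ^ 'r::finite) \<times> 'r set) set"
  assumes "\<And>l I i. (l, I) \<in> \<C> \<Longrightarrow> l $ i \<le> N"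
  shows "top_of_set (\<Union>(l, I)\<in>\<C>. thick l I) homotopy_equivalent_space top_of_set (\<Union>(l, I)\<in>\<C>. cube l I)"
proof (rule deformation_homotopy_equivalent[where f = "squeeze N"])
  show "(\<Union>(l, I)\<in>\<C>. cube l I) \<subseteq> (\<Union>(l, I)\<in>\<C>. thick l I)" using cube_subset_thick by blast
  show "continuous_on (\<Union>(l, I)\<in>\<C>. thick l I) (squeeze N)"
    unfolding squeeze_def
    by (intro continuous_on_vec_lambda continuous_on_sum continuous_intros)
  show "squeeze N ` (\<Union>(l, I)\<in>\<C>. thick l I) \<subseteq> (\<Union>(l, I)\<in>\<C>. cube l I)"
  proof clarify
    fix x l I assume "(l, I) \<in> \<C>" "x \<in> thick l I"
    then show "squeeze N x \<in> (\<Union>(l, I)\<in>\<C>. cube l I)"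
      using squeeze_in_cube[of x l I N] assms[of l I] by blast
  qed
  fix x
  show "closed_segment (squeeze N x) x \<subseteq> (\<Union>(l, I)\<in>\<C>. thick l I)" if "x \<in> (\<Union>(l, I)\<in>\<C>. thick l I)"
  proof -
    obtain l I where x: "(l, I) \<in> \<C>" "x \<in> thick l I" using \<open>x \<in> _\<close> by auto
    have "squeeze N x \<in> thick l I" using squeeze_in_cube[OF x(2) assms[OF x(1)]] cube_subset_thick by blast
    then have "closed_segment (squeeze N x) x \<subseteq> thick l I"
      using x convex_thick by (metis closed_segment_subset)
    then show ?thesis using x by blast
  qed
  show "closed_segment (squeeze N x) x \<subseteq> (\<Union>(l, I)\<in>\<C>. cube l I)" if "x \<in> (\<Union>(l, I)\<in>\<C>. cube l I)"
  proof -
    obtain l I where x: "(l, I) \<in> \<C>" "x \<in> cube l I" using \<open>x \<in> _\<close> by auto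
    have "x \<in> thick l I" using x cube_subset_thick by blast
    then have "squeeze N x \<in> cube l I" using squeeze_in_cube[OF _ assms[OF x(1)]] by blast
    then have "closed_segment (squeeze N x) x \<subseteq> cube l I"
      using x convex_cube by (metis closed_segment_subset)
    then show ?thesis using x by blast
  qed
qed

text \<open>\<open>\<nu>\<close> counts with signs the cells of the box whose barycentre lies in the
  set. On a thickened cube it counts the faces, with total 1; on the union over \<open>\<C>\<close>
  closure under faces makes it count exactly \<open>\<C>\<close>.\<close>

theorem cubical_complex_euler_char:
  fixes \<C> :: "((nat ^ 'r::finite) \<times> 'r set) set"
  assumes \<C>: "\<C> \<subseteq> cells 0 M"
    and faces: "\<And>l I. (l, I) \<in> \<C> \<Longrightarrow> cells l (vertex l I) \<subseteq> \<C>"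
  shows "finite_type (top_of_set (\<Union>(l, I)\<in>\<C>. cube l I)) {}"
    and "rel_euler_char (top_of_set (\<Union>(l, I)\<in>\<C>. cube l I)) {} = (\<Sum>(l, I)\<in>\<C>. (-1) ^ card I)"
proof -
  let ?\<V> = "insert {} ((\<lambda>(l, I). thick l I) ` cells 0 M)"
  let ?\<U> = "(\<lambda>(l, I). thick l I) ` \<C>"
  have fin: "finite \<C>" using \<C> finite_cells by (rule finite_subset)
  define \<nu> where "\<nu> Y = (\<Sum>(l, I)\<in>cells 0 M. if center l I \<in> Y then (-1) ^ card I else 0 :: int)" for Y
  have main: "finite_type (top_of_set (\<Union>?\<U>)) {} \<and> rel_euler_char (top_of_set (\<Union>?\<U>)) {} = \<nu> (\<Union>?\<U>)"
  proof (rule euler_char_Union_open_convex[of ?\<V>])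
    show "open V \<and> convex V" if "V \<in> ?\<V>" for V
      using that open_thick convex_thick by auto
    show "V \<inter> W \<in> ?\<V>" if VW: "V \<in> ?\<V>" "W \<in> ?\<V>" for V W
    proof (cases "V \<inter> W = {}")
      case False
      then obtain l I l' I' where *: "V = thick l I" "W = thick l' I'" "(l, I) \<in> cells 0 M"
        using VW by auto
      then obtain I'' where I'': "V \<inter> W = thick (\<chi> i. max (l $ i) (l' $ i)) I''"
        "\<forall>i. vertex (\<chi> i. max (l $ i) (l' $ i)) I'' $ i \<le> vertex l I $ i"
        using thick_Int[of l I l' I'] False by auto
      have "(\<chi> i. max (l $ i) (l' $ i), I'') \<in> cells 0 M"
        using I''(2) *(3) by (simp add: cells_def del: vertex_nth) (meson order_trans)
      then have "thick (\<chi> i. max (l $ i) (l' $ i)) I'' \<in> (\<lambda>(l, I). thick l I) ` cells 0 M"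
        by (rule image_eqI[rotated]) simp
      then show ?thesis unfolding I''(1) by (rule insertI2)
    qed simp
    show "\<nu> {} = 0" by (simp add: \<nu>_def case_prod_unfold)
    show "\<nu> (Y \<union> Z) + \<nu> (Y \<inter> Z) = \<nu> Y + \<nu> Z" for Y Z
      unfolding \<nu>_def by (auto simp: case_prod_unfold simp flip: sum.distrib intro!: sum.cong)
    show "\<nu> V = 1" if V: "V \<in> ?\<V>" "V \<noteq> {}" for V
    proof -
      obtain l I where l: "(l, I) \<in> cells 0 M" "V = thick l I" using V by auto
      have sub: "cells l (vertex l I) \<subseteq> cells 0 M"
        using l(1) by (auto simp: cells_def simp del: vertex_nth) (meson order_trans)
      have "\<nu> V = (\<Sum>(l', I')\<in>cells l (vertex l I). (-1) ^ card I' * 1)"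
        unfolding \<nu>_def l(2) center_in_thick_iff case_prod_unfold
        using sub by (intro sum.mono_neutral_cong_right) auto
      also have "\<dots> = 1" by (rule sum_cells_bottom) simp
      finally show ?thesis .
    qed
    show "finite ?\<U>" using fin by simp
    show "?\<U> \<subseteq> ?\<V>" using image_mono[OF \<C>, of "\<lambda>(l, I). thick l I"] by (rule subset_insertI2)
  qed
  have \<nu>: "\<nu> (\<Union>?\<U>) = (\<Sum>(l, I)\<in>\<C>. (-1) ^ card I)"
  proof -
    have "center l I \<in> \<Union>?\<U> \<longleftrightarrow> (l, I) \<in> \<C>" for l I
    proof
      assume "center l I \<in> \<Union>?\<U>"
      then obtain l' I' where "(l', I') \<in> \<C>" "(l, I) \<in> cells l' (vertex l' I')"
        by (auto simp: center_in_thick_iff)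
      then show "(l, I) \<in> \<C>" using faces by blast
    next
      assume "(l, I) \<in> \<C>"
      moreover have "center l I \<in> thick l I" by (simp add: center_in_thick_iff cells_def)
      ultimately show "center l I \<in> \<Union>?\<U>" by blast
    qed
    then show ?thesis unfolding \<nu>_def case_prod_unfold
      using \<C> by (intro sum.mono_neutral_cong_right) auto
  qed
  define N where "N = Max (range (($) M))"
  have N: "M $ i \<le> N" for i by (simp add: N_def)
  have "l $ i \<le> N" if "(l, I) \<in> \<C>" for l I i
  proof -
    have "l $ i \<le> vertex l I $ i" by simp
    also have "\<dots> \<le> M $ i" using subsetD[OF \<C> that] by (simp add: cells_def del: vertex_nth)
    finally show ?thesis using N[of i] by simp
  qed
  from squeeze_homotopy_equivalent[of \<C>, OF this]
  have *: "top_of_set (\<Union>?\<U>) homotopy_equivalent_space top_of_set (\<Union>(l, I)\<in>\<C>. cube l I)" .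
  show "finite_type (top_of_set (\<Union>(l, I)\<in>\<C>. cube l I)) {}"
    "rel_euler_char (top_of_set (\<Union>(l, I)\<in>\<C>. cube l I)) {} = (\<Sum>(l, I)\<in>\<C>. (-1) ^ card I)"
    using homotopy_equivalent_finite_type[OF *] main \<nu> by auto
qed

section \<open>Sublevel sets\<close>

text \<open>Only the coordinate that moves has to be beyond \<open>c\<close>, the others are
  arbitrary. This permits retracting the coordinates independently of one another.\<close>

definition weight_stable :: "(complex fps ^ 'r) set \<Rightarrow> nat ^ 'r \<Rightarrow> bool" where
  "weight_stable A c \<longleftrightarrow> (\<forall>l i. c $ i \<le> l $ i \<longrightarrow> weight A (vertex l {i}) = weight A l + 1)"

lemma cube_weight_le_iff:
  fixes I :: "'r::finite set"
  shows "cube_weight A l I \<le> n \<longleftrightarrow> (\<forall>J\<subseteq>I. weight A (vertex l J) \<le> n)"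
  unfolding cube_weight_def by (subst Max_le_iff) auto

lemma vertex_of_cube:
  assumes "x \<in> cube l I" "\<And>i. \<bar>x $ i - real (v $ i)\<bar> < 1"
  shows "\<exists>J\<subseteq>I. v = vertex l J"
proof (intro exI conjI)
  let ?J = "{i. l $ i < v $ i}"
  have *: "v $ i = l $ i + (if i \<in> ?J then 1 else 0)" and **: "i \<in> ?J \<Longrightarrow> i \<in> I" for i
  proof -
    have x: "real (l $ i) \<le> x $ i" "x $ i \<le> real (l $ i) + (if i \<in> I then 1 else 0)"
      using assms(1) by (auto simp: cube_def)
    have v: "x $ i - 1 < real (v $ i)" "real (v $ i) < x $ i + 1" using assms(2)[of i] by linarith+
    have 1: "l $ i \<le> v $ i" using x v by linarith
    show 2: "i \<in> I" if "i \<in> ?J" using x v that by (auto split: if_splits)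
    have "v $ i \<le> l $ i + 1"
      using x v by (auto split: if_splits)
    then show "v $ i = l $ i + (if i \<in> ?J then 1 else 0)" using 1 by auto
  qed
  show "?J \<subseteq> I" using ** by blast
  show "v = vertex l ?J" using * by (simp add: vec_eq_iff)
qed

text \<open>This is the smallest cube containing \<open>x\<close>: its lowest vertex is obtained by
  rounding down, and it has one direction for each non-integral coordinate. Minimality appears as
  the estimate that its vertices are closer than 1 to \<open>x\<close> in each coordinate.\<close>

lemma carrier_cube:
  fixes x :: "real ^ 'r::finite"
  assumes "\<And>i. 0 \<le> x $ i"
  defines "l \<equiv> \<chi> i. nat \<lfloor>x $ i\<rfloor>" and "I \<equiv> {i. x $ i \<noteq> of_int \<lfloor>x $ i\<rfloor>}"
  shows "x \<in> cube l I" "\<And>J i. J \<subseteq> I \<Longrightarrow> \<bar>x $ i - real (vertex l J $ i)\<bar> < 1"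
    "\<And>c. (\<And>i. x $ i \<le> real (c $ i)) \<Longrightarrow> (l, I) \<in> cells 0 c"
proof -
  have l: "real (l $ i) = of_int \<lfloor>x $ i\<rfloor>" for i using assms(1)[of i] by (simp add: l_def)
  show "x \<in> cube l I"
    by (auto simp: cube_def l I_def of_int_floor_le)
  show "\<bar>x $ i - real (vertex l J $ i)\<bar> < 1" if "J \<subseteq> I" for J i
  proof (cases "i \<in> J")
    case True
    then have "x $ i \<noteq> of_int \<lfloor>x $ i\<rfloor>" using that by (auto simp: I_def)
    then have "of_int \<lfloor>x $ i\<rfloor> < x $ i" using of_int_floor_le[of "x $ i"] by linarith
    moreover have "x $ i < of_int \<lfloor>x $ i\<rfloor> + 1" by linarith
    ultimately have "\<bar>x $ i - (of_int \<lfloor>x $ i\<rfloor> + 1)\<bar> < 1" by linarith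
    then show ?thesis using True by (simp add: l add.commute)
  next
    case False
    have "x $ i < of_int \<lfloor>x $ i\<rfloor> + 1" "of_int \<lfloor>x $ i\<rfloor> \<le> x $ i" by linarith+
    then have "\<bar>x $ i - of_int \<lfloor>x $ i\<rfloor>\<bar> < 1" by linarith
    then show ?thesis using False by (simp add: l)
  qed
  show "(l, I) \<in> cells 0 c" if c: "\<And>i. x $ i \<le> real (c $ i)" for c
  proof -
    have "vertex l I $ i \<le> c $ i" for i
    proof (cases "i \<in> I")
      case True
      then have "x $ i \<noteq> of_int \<lfloor>x $ i\<rfloor>" by (simp add: I_def)
      then have "of_int \<lfloor>x $ i\<rfloor> < x $ i" using of_int_floor_le[of "x $ i"] by linarith
      then have "real (l $ i) < real (c $ i)" using c[of i] l[of i] by linarith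
      then show ?thesis using True by simp
    next
      case False
      then have "real (l $ i) \<le> real (c $ i)" using c[of i] l[of i] by (simp add: I_def)
      then show ?thesis using False by simp
    qed
    then show ?thesis by (simp add: cells_def del: vertex_nth)
  qed
qed

text \<open>The lattice points closer than 1 to \<open>x\<close> in every coordinate are the
  vertices of the smallest cube containing \<open>x\<close>. Conditions on them replace the search
  for a cube and allow \<open>x\<close> to be moved across cubes.\<close>

lemma sublevel_iff:
  fixes x :: "real ^ 'r::finite"
  shows "x \<in> sublevel A n \<longleftrightarrow> (\<forall>i. 0 \<le> x $ i) \<and>
    (\<forall>v. (\<forall>i. \<bar>x $ i - real (v $ i)\<bar> < 1) \<longrightarrow> weight A v \<le> n)"
proof
  assume "x \<in> sublevel A n"
  then obtain l I where l: "x \<in> cube l I" "cube_weight A l I \<le> n" by (auto simp: sublevel_def)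
  have "0 \<le> x $ i" for i
    using l(1) by (auto simp: cube_def intro: order_trans[of 0 "real (l $ i)"])
  moreover have "weight A v \<le> n" if "\<forall>i. \<bar>x $ i - real (v $ i)\<bar> < 1" for v
    using vertex_of_cube[OF l(1), of v] that l(2) unfolding cube_weight_le_iff by blast
  ultimately show "(\<forall>i. 0 \<le> x $ i) \<and> (\<forall>v. (\<forall>i. \<bar>x $ i - real (v $ i)\<bar> < 1) \<longrightarrow> weight A v \<le> n)"
    by blast
next
  assume x: "(\<forall>i. 0 \<le> x $ i) \<and> (\<forall>v. (\<forall>i. \<bar>x $ i - real (v $ i)\<bar> < 1) \<longrightarrow> weight A v \<le> n)"
  define l where "l = (\<chi> i. nat \<lfloor>x $ i\<rfloor>)"
  define I where "I = {i. x $ i \<noteq> of_int \<lfloor>x $ i\<rfloor>}"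
  have 1: "x \<in> cube l I" "\<And>J i. J \<subseteq> I \<Longrightarrow> \<bar>x $ i - real (vertex l J $ i)\<bar> < 1"
    using carrier_cube(1,2)[of x] x unfolding l_def I_def by blast+
  have "cube_weight A l I \<le> n" unfolding cube_weight_le_iff using 1(2) x by blast
  then show "x \<in> sublevel A n" unfolding sublevel_def using 1(1) by blast
qed

lemma sublevel_eq_empty:
  fixes A :: "(complex fps ^ 'r::finite) set"
  assumes "\<And>l. n < weight A l"
  shows "sublevel A n = {}"
proof -
  have "\<not> cube_weight A l I \<le> n" for l I
    unfolding cube_weight_le_iff using assms by (meson empty_subsetI not_le)
  then show ?thesis by (simp add: sublevel_def)
qed

lemma sublevel_nonempty:
  fixes A :: "(complex fps ^ 'r::finite) set"
  assumes "weight A l \<le> n"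
  shows "(\<chi> i. real (l $ i)) \<in> sublevel A n"
proof -
  have "v = l" if "\<forall>i. \<bar>real (l $ i) - real (v $ i)\<bar> < 1" for v :: "nat ^ 'r"
  proof -
    have "v $ i = l $ i" for i using that[rule_format, of i] by linarith
    then show ?thesis by (simp add: vec_eq_iff)
  qed
  then show ?thesis using assms by (auto simp: sublevel_iff)
qed

text \<open>Coordinates are raised one unit at a time from \<open>v\<close> to \<open>u\<close>;
  every step takes place at or beyond \<open>c\<close> and adds 1 to the weight as well as to the
  coordinate sum.\<close>

lemma weight_growth:
  fixes v u :: "nat ^ 'r::finite"
  assumes st: "weight_stable A c" and vu: "\<And>i. v $ i = u $ i \<or> (c $ i \<le> v $ i \<and> v $ i \<le> u $ i)"
  shows "weight A u + int (abs_sum v) = weight A v + int (abs_sum u)"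
  using vu
proof (induction "abs_sum u - abs_sum v" arbitrary: v rule: less_induct)
  case less
  show ?case
  proof (cases "v = u")
    case False
    then obtain i where i: "v $ i \<noteq> u $ i" by (auto simp: vec_eq_iff)
    then have i': "c $ i \<le> v $ i" "v $ i < u $ i" using less.prems[of i] by auto
    let ?v = "vertex v {i}"
    have s: "abs_sum ?v = abs_sum v + 1"
      by (simp add: abs_sum_def sum.distrib)
    have p: "?v $ j = u $ j \<or> (c $ j \<le> ?v $ j \<and> ?v $ j \<le> u $ j)" for j
      using less.prems[of j] i' by auto
    have "abs_sum ?v \<le> abs_sum u" unfolding abs_sum_def
      using p by (intro sum_mono) (metis order_refl)
    then have "weight A u + int (abs_sum ?v) = weight A ?v + int (abs_sum u)"
      using s p by (intro less.hyps) auto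
    moreover have "weight A ?v = weight A v + 1" using st i' by (simp add: weight_stable_def)
    ultimately show ?thesis using s by simp
  qed simp
qed

lemma weight_mono_stable:
  fixes v u :: "nat ^ 'r::finite"
  assumes st: "weight_stable A c" and vu: "\<And>i. v $ i = u $ i \<or> (c $ i \<le> v $ i \<and> v $ i \<le> u $ i)"
  shows "weight A v \<le> weight A u"
proof -
  have "abs_sum v \<le> abs_sum u" unfolding abs_sum_def
    using vu by (intro sum_mono) (metis order_refl)
  then show ?thesis using weight_growth[OF assms] by simp
qed

text \<open>Truncation at \<open>c\<close> maps \<open>v\<close> to one of finitely many lattice
  points and lowers the weight by exactly the decrease of the coordinate sum; bounded weight thus
  bounds the coordinates.\<close>

lemma finite_weight_le:
  fixes A :: "(complex fps ^ 'r::finite) set"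
  assumes "weight_stable A c"
  shows "finite {v. weight A v \<le> n}"
proof -
  define t where "t v = (\<chi> i. min (v $ i) (c $ i))" for v :: "nat ^ 'r"
  have fin: "finite {l :: nat ^ 'r. \<forall>i. l $ i \<le> c $ i}" by (rule finite_vec_box)
  define m where "m = Min (weight A ` {l. \<forall>i. l $ i \<le> c $ i})"
  have "v $ i \<le> nat (n - m) + abs_sum c" if "weight A v \<le> n" for v i
  proof -
    have "weight A v + int (abs_sum (t v)) = weight A (t v) + int (abs_sum v)"
      using assms by (rule weight_growth) (auto simp: t_def min_def)
    moreover have "m \<le> weight A (t v)"
      unfolding m_def using fin by (intro Min_le) (auto simp: t_def)
    moreover have "abs_sum (t v) \<le> abs_sum c"
      unfolding abs_sum_def t_def by (intro sum_mono) simp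
    moreover have "v $ i \<le> abs_sum v"
      unfolding abs_sum_def by (rule member_le_sum) auto
    ultimately show ?thesis using that by linarith
  qed
  then have "{v. weight A v \<le> n} \<subseteq> {l. \<forall>i. l $ i \<le> (\<chi> i. nat (n - m) + abs_sum c) $ i}" by auto
  then show ?thesis using finite_vec_box by (rule finite_subset)
qed

lemma sublevel_level_space_empty:
  fixes A :: "(complex fps ^ 'r::finite) set"
  assumes "weight_stable A c"
  shows "\<exists>D. \<forall>d\<ge>D. sublevel A n \<inter> level_space d = {}"
proof (intro exI allI impI)
  \<comment> \<open>A crude bound: there are finitely many lattice points of weight at most
    \<open>n\<close>, and the sum of all their coordinate sums dominates each one. A point of a cube
    based at \<open>l\<close> rounds down to a lattice point above \<open>l\<close>.\<close>
  let ?D = "Suc (\<Sum>v | weight A v \<le> n. abs_sum v)"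
  fix d assume d: "d \<ge> ?D"
  show "sublevel A n \<inter> level_space d = {}"
  proof (rule ccontr)
    assume "sublevel A n \<inter> level_space d \<noteq> {}"
    then obtain x l I where x: "x \<in> sublevel A n" "x \<in> cube l I" "abs_sum l \<ge> d"
      by (auto simp: level_space_def)
    have x0: "0 \<le> x $ i" for i using x(1) by (simp add: sublevel_iff)
    define v where "v = (\<chi> i. nat \<lfloor>x $ i\<rfloor>)"
    have v: "\<bar>x $ i - real (v $ i)\<bar> < 1" "l $ i \<le> v $ i" for i
    proof -
      have e: "real (v $ i) = of_int \<lfloor>x $ i\<rfloor>" using x0[of i] by (simp add: v_def)
      then show "\<bar>x $ i - real (v $ i)\<bar> < 1" by linarith
      have "real (l $ i) \<le> x $ i" using x(2) by (auto simp: cube_def)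
      then show "l $ i \<le> v $ i" using e by linarith
    qed
    have w: "weight A v \<le> n" using x(1) v(1) by (simp add: sublevel_iff)
    have "d \<le> abs_sum v" using x(3) v(2) unfolding abs_sum_def
      by (meson order_trans sum_mono)
    also have "abs_sum v \<le> (\<Sum>v | weight A v \<le> n. abs_sum v)"
      using w finite_weight_le[OF assms] by (intro member_le_sum) auto
    finally show False using d by simp
  qed
qed

lemma sublevel_subset_level_space_0: "sublevel A n \<subseteq> level_space 0"
  by (auto simp: sublevel_def level_space_def)

lemma sublevel_rectangle:
  fixes A :: "(complex fps ^ 'r::finite) set"
  shows "sublevel A n \<inter> {x. \<forall>i. x $ i \<le> real (c $ i)} =
    (\<Union>(l, I)\<in>{(l, I). (l, I) \<in> cells 0 c \<and> cube_weight A l I \<le> n}. cube l I)" (is "?L = ?R")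
proof
  show "?L \<subseteq> ?R"
  proof
    fix x assume "x \<in> ?L"
    then have x: "\<And>i. 0 \<le> x $ i" "\<And>v. (\<forall>i. \<bar>x $ i - real (v $ i)\<bar> < 1) \<Longrightarrow> weight A v \<le> n"
      "\<And>i. x $ i \<le> real (c $ i)"
      by (auto simp: sublevel_iff)
    define l where "l = (\<chi> i. nat \<lfloor>x $ i\<rfloor>)"
    define I where "I = {i. x $ i \<noteq> of_int \<lfloor>x $ i\<rfloor>}"
    have 1: "x \<in> cube l I" "\<And>J i. J \<subseteq> I \<Longrightarrow> \<bar>x $ i - real (vertex l J $ i)\<bar> < 1" "(l, I) \<in> cells 0 c"
      using carrier_cube[of x] x unfolding l_def I_def by blast+
    have "cube_weight A l I \<le> n" unfolding cube_weight_le_iff using 1(2) x(2) by blast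
    then show "x \<in> ?R" using 1 by blast
  qed
  show "?R \<subseteq> ?L"
  proof
    fix x assume "x \<in> ?R"
    then obtain l I where l: "(l, I) \<in> cells 0 c" "cube_weight A l I \<le> n" "x \<in> cube l I" by auto
    have "x $ i \<le> real (c $ i)" for i
    proof -
      have "x $ i \<le> real (vertex l I $ i)" using l(3) by (auto simp: cube_def dest!: spec[of _ i])
      also have "\<dots> \<le> real (c $ i)" using l(1) by (simp add: cells_def del: vertex_nth)
      finally show ?thesis .
    qed
    then show "x \<in> ?L" using l by (auto simp: sublevel_def)
  qed
qed

section \<open>Retraction of \<open>S\<^sub>n\<close> onto its part in a rectangle\<close>

definition clamp :: "nat ^ 'r \<Rightarrow> real ^ 'r \<Rightarrow> real ^ 'r" where
  "clamp c x = (\<chi> i. min (x $ i) (real (c $ i)))"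

text \<open>A point \<open>y\<close> of the segment differs from \<open>x\<close> only in
  coordinates where \<open>x\<close> exceeds \<open>c'\<close>, and there \<open>y\<close> lies
  between \<open>c'\<close> and \<open>x\<close>. Every lattice point near \<open>y\<close> is
  dominated by one near \<open>x\<close> that differs from it only in coordinates beyond
  \<open>c\<close>, where raising a coordinate raises the weight.\<close>

lemma sublevel_clamp_segment:
  fixes A :: "(complex fps ^ 'r::finite) set"
  assumes "weight_stable A c" "\<And>i. c $ i \<le> c' $ i" "x \<in> sublevel A n"
  shows "closed_segment (clamp c' x) x \<subseteq> sublevel A n"
proof
  fix y assume "y \<in> closed_segment (clamp c' x) x"
  then obtain t where t: "0 \<le> t" "t \<le> 1" "y = (1 - t) *\<^sub>R clamp c' x + t *\<^sub>R x"
    by (auto simp: in_segment)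
  have x0: "0 \<le> x $ i" for i using assms(3) by (simp add: sublevel_iff)
  have y1: "y $ i = x $ i" if "x $ i \<le> real (c' $ i)" for i
    using that by (simp add: t(3) clamp_def algebra_simps)
  have y2: "real (c' $ i) \<le> y $ i \<and> y $ i \<le> x $ i" if "x $ i > real (c' $ i)" for i
  proof -
    have "y $ i = real (c' $ i) + t * (x $ i - real (c' $ i))"
      using that by (simp add: t(3) clamp_def algebra_simps)
    moreover have "0 \<le> t * (x $ i - real (c' $ i))" "t * (x $ i - real (c' $ i)) \<le> 1 * (x $ i - real (c' $ i))"
      using t that by (auto intro: mult_right_mono)
    ultimately show ?thesis by simp
  qed
  show "y \<in> sublevel A n"
    unfolding sublevel_iff
  proof (intro conjI allI impI)
    show "0 \<le> y $ i" for i using y1[of i] y2[of i] x0[of i]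
      by (metis le_less_linear of_nat_0_le_iff order_trans)
    fix v :: "nat ^ 'r" assume v: "\<forall>i. \<bar>y $ i - real (v $ i)\<bar> < 1"
    \<comment> \<open>\<open>u\<close> keeps the coordinates of \<open>v\<close> that are already
      close to \<open>x\<close> and rounds \<open>x\<close> down in the others, in which
      \<open>v\<close> lies at or above \<open>c'\<close> and below \<open>x\<close>.\<close>
    define u where "u = (\<chi> i. if x $ i \<le> real (c' $ i) \<or> \<bar>x $ i - real (v $ i)\<bar> < 1 then v $ i else nat \<lfloor>x $ i\<rfloor>)"
    have u: "\<bar>x $ i - real (u $ i)\<bar> < 1 \<and> (v $ i = u $ i \<or> (c $ i \<le> v $ i \<and> v $ i \<le> u $ i))" for i
    proof (cases "x $ i \<le> real (c' $ i) \<or> \<bar>x $ i - real (v $ i)\<bar> < 1")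
      case True
      then show ?thesis using y1[of i] v[rule_format, of i] by (auto simp: u_def)
    next
      case False
      then have "real (c' $ i) \<le> y $ i" "y $ i \<le> x $ i" using y2[of i] by auto
      moreover have "\<bar>y $ i - real (v $ i)\<bar> < 1" using v by blast
      moreover have e: "real (u $ i) = of_int \<lfloor>x $ i\<rfloor>" using False x0[of i] by (simp add: u_def)
      ultimately have "c' $ i \<le> v $ i" "real (v $ i) \<le> x $ i" using False by linarith+
      then have "c $ i \<le> v $ i" "v $ i \<le> u $ i" using assms(2)[of i] e by linarith+
      moreover have "\<bar>x $ i - real (u $ i)\<bar> < 1" using e by linarith
      ultimately show ?thesis by blast
    qed
    have "weight A v \<le> weight A u"
      using u by (intro weight_mono_stable[OF assms(1)]) blast
    also have "weight A u \<le> n" using assms(3) u by (auto simp: sublevel_iff)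
    finally show "weight A v \<le> n" .
  qed
qed

lemma sublevel_homotopy_equivalent:
  fixes A :: "(complex fps ^ 'r::finite) set"
  assumes "weight_stable A c" "\<And>i. c $ i \<le> c' $ i"
  shows "top_of_set (sublevel A n) homotopy_equivalent_space
    top_of_set (sublevel A n \<inter> {x. \<forall>i. x $ i \<le> real (c' $ i)})"
proof (rule deformation_homotopy_equivalent[where f = "clamp c'"])
  show "continuous_on (sublevel A n) (clamp c')"
    unfolding clamp_def by (intro continuous_on_vec_lambda continuous_intros)
  show "clamp c' ` sublevel A n \<subseteq> sublevel A n \<inter> {x. \<forall>i. x $ i \<le> real (c' $ i)}"
  proof (rule image_subsetI)
    fix x assume "x \<in> sublevel A n"
    then have "closed_segment (clamp c' x) x \<subseteq> sublevel A n" using sublevel_clamp_segment assms by blast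
    then show "clamp c' x \<in> sublevel A n \<inter> {x. \<forall>i. x $ i \<le> real (c' $ i)}" by (auto simp: clamp_def)
  qed
  show "closed_segment (clamp c' x) x \<subseteq> sublevel A n" if "x \<in> sublevel A n" for x
    using sublevel_clamp_segment assms that by blast
  show "closed_segment (clamp c' x) x \<subseteq> sublevel A n \<inter> {x. \<forall>i. x $ i \<le> real (c' $ i)}"
    if "x \<in> sublevel A n \<inter> {x. \<forall>i. x $ i \<le> real (c' $ i)}" for x
  proof -
    have "clamp c' x = x" using that by (auto simp: clamp_def vec_eq_iff min_def)
    then show ?thesis using that by simp
  qed
qed simp

text \<open>Clamping leaves a finite cubical complex, whose cells can be counted. Every corner
  \<open>c'\<close> beyond \<open>c\<close> is admissible, which is the source of the arbitrary
  rectangle in (c).\<close>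

theorem sublevel_euler_char:
  fixes A :: "(complex fps ^ 'r::finite) set"
  assumes "weight_stable A c" "\<And>i. c $ i \<le> c' $ i"
  shows "finite_type (top_of_set (sublevel A n)) {}"
    and "rel_euler_char (top_of_set (sublevel A n)) {} =
      (\<Sum>(l, I)\<in>cells 0 c'. if cube_weight A l I \<le> n then (-1) ^ card I else 0)"
proof -
  let ?C = "{(l, I). (l, I) \<in> cells 0 c' \<and> cube_weight A l I \<le> n}"
  have C: "?C \<subseteq> cells 0 c'" by auto
  have faces: "cells l (vertex l I) \<subseteq> ?C" if "(l, I) \<in> ?C" for l I
  proof clarify
    fix l' I' assume f: "(l', I') \<in> cells l (vertex l I)"
    have "(l', I') \<in> cells 0 c'"
      using f that by (simp add: cells_def del: vertex_nth) (meson order_trans)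
    moreover have "cube_weight A l' I' \<le> n"
      unfolding cube_weight_le_iff
    proof (intro allI impI)
      fix J assume J: "J \<subseteq> I'"
      \<comment> \<open>A vertex of a face is a vertex of the cube itself, raised above
        \<open>l\<close> exactly in the directions \<open>K\<close>.\<close>
      define K where "K = {i. vertex l' J $ i \<noteq> l $ i}"
      have b: "l $ i \<le> vertex l' J $ i \<and> vertex l' J $ i \<le> vertex l I $ i" for i
      proof -
        have "l $ i \<le> l' $ i" "vertex l' I' $ i \<le> vertex l I $ i"
          using f by (auto simp: cells_def simp del: vertex_nth)
        moreover have "l' $ i \<le> vertex l' J $ i" "vertex l' J $ i \<le> vertex l' I' $ i" using J by auto
        ultimately show ?thesis by linarith
      qed
      have "vertex l' J $ i = vertex l K $ i" for i
        using b[of i] unfolding vertex_nth[of l] K_def by (auto split: if_splits)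
      then have "vertex l' J = vertex l K" unfolding vec_eq_iff by blast
      moreover have "K \<subseteq> I"
      proof
        fix i assume "i \<in> K"
        then show "i \<in> I" using b[of i] unfolding vertex_nth[of l] K_def by (auto split: if_splits)
      qed
      ultimately show "weight A (vertex l' J) \<le> n"
        using that unfolding cube_weight_le_iff by auto
    qed
    ultimately show "(l', I') \<in> cells 0 c' \<and> cube_weight A l' I' \<le> n" by blast
  qed
  have he: "top_of_set (\<Union>(l, I)\<in>?C. cube l I) homotopy_equivalent_space top_of_set (sublevel A n)"
    using sublevel_homotopy_equivalent[OF assms, of n] unfolding sublevel_rectangle
    by (rule homotopy_equivalent_space_sym[THEN iffD1])
  have K: "finite_type (top_of_set (\<Union>(l, I)\<in>?C. cube l I)) {}"
    "rel_euler_char (top_of_set (\<Union>(l, I)\<in>?C. cube l I)) {} = (\<Sum>(l, I)\<in>?C. (-1) ^ card I)"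
    by (rule cubical_complex_euler_char[OF C]; use faces in blast)+
  show "finite_type (top_of_set (sublevel A n)) {}"
    by (rule homotopy_equivalent_finite_type(1)[OF he K(1)])
  have "rel_euler_char (top_of_set (sublevel A n)) {} = (\<Sum>(l, I)\<in>?C. (-1) ^ card I)"
    using homotopy_equivalent_finite_type(2)[OF he K(1)] K(2) by simp
  also have "\<dots> = (\<Sum>(l, I)\<in>cells 0 c'. if cube_weight A l I \<le> n then (-1) ^ card I else 0)"
    unfolding case_prod_unfold by (rule sum.mono_neutral_cong_left) auto
  finally show "rel_euler_char (top_of_set (sublevel A n)) {} =
      (\<Sum>(l, I)\<in>cells 0 c'. if cube_weight A l I \<le> n then (-1) ^ card I else 0)" .
qed

text \<open>Once \<open>n\<close> dominates all weights in the box below \<open>c\<close>, the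
  retract is the whole box, which is convex.\<close>

lemma sublevel_homology_large:
  fixes A :: "(complex fps ^ 'r::finite) set"
  assumes "weight_stable A c" "\<And>l. (\<And>i. l $ i \<le> c $ i) \<Longrightarrow> weight A l \<le> n"
  shows "finite_rank (homology_group p (top_of_set (sublevel A n))) \<and>
    group_rank (homology_group p (top_of_set (sublevel A n))) = (if p = 0 then 1 else 0)"
proof -
  let ?R = "{x :: real ^ 'r. \<forall>i. 0 \<le> x $ i \<and> x $ i \<le> real (c $ i)}"
  have R: "sublevel A n \<inter> {x. \<forall>i. x $ i \<le> real (c $ i)} = ?R"
  proof
    show "?R \<subseteq> sublevel A n \<inter> {x. \<forall>i. x $ i \<le> real (c $ i)}"
    proof clarify
      fix x :: "real ^ 'r" assume x: "\<forall>i. 0 \<le> x $ i \<and> x $ i \<le> real (c $ i)"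
      define l where "l = (\<chi> i. nat \<lfloor>x $ i\<rfloor>)"
      define I where "I = {i. x $ i \<noteq> of_int \<lfloor>x $ i\<rfloor>}"
      have 1: "x \<in> cube l I" "(l, I) \<in> cells 0 c"
        using carrier_cube[of x] x unfolding l_def I_def by blast+
      have "cube_weight A l I \<le> n"
        unfolding cube_weight_le_iff
      proof (intro allI impI assms(2))
        fix J i assume "J \<subseteq> I"
        then have "vertex l J $ i \<le> vertex l I $ i" by auto
        also have "\<dots> \<le> c $ i" using 1(2) by (simp add: cells_def del: vertex_nth)
        finally show "vertex l J $ i \<le> c $ i" .
      qed
      then show "x \<in> sublevel A n \<inter> {x. \<forall>i. x $ i \<le> real (c $ i)}" using 1(1) x by (auto simp: sublevel_def)
    qed
  qed (auto simp: sublevel_iff)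
  have "convex ?R"
    by (auto simp: convex_def intro!: convex_bound_le add_nonneg_nonneg mult_nonneg_nonneg)
  then have "contractible ?R" by (rule convex_imp_contractible)
  moreover have "0 \<in> ?R" by simp
  then have "?R \<noteq> {}" by blast
  ultimately have K: "finite_rank (homology_group p (top_of_set ?R)) \<and>
    group_rank (homology_group p (top_of_set ?R)) = (if p = 0 then 1 else 0)"
    by (rule contractible_group_rank)
  have "top_of_set ?R homotopy_equivalent_space top_of_set (sublevel A n)"
    using sublevel_homotopy_equivalent[OF assms(1) order_refl, of n] unfolding R
    by (rule homotopy_equivalent_space_sym[THEN iffD1])
  then have "homology_group p (top_of_set ?R) \<cong> homology_group p (top_of_set (sublevel A n))"
    by (rule homotopy_equivalent_space_imp_isomorphic_homology_groups)
  from iso_group_rank[OF _ _ this] K show ?thesis by simp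
qed

section \<open>Dimensions of quotient spaces\<close>

text \<open>\<open>*s\<close> multiplies by power series; complex scalars enter as constant series,
  in the same form as in \<open>quotient_basis\<close>, so that the general theory of bases
  applies.\<close>

abbreviation scl :: "complex \<Rightarrow> complex fps ^ 'r \<Rightarrow> complex fps ^ 'r::finite" where
  "scl c x \<equiv> fps_const c *s x"

interpretation cv: vector_space "scl :: complex \<Rightarrow> complex fps ^ 'r \<Rightarrow> complex fps ^ 'r::finite"
  by unfold_locales
    (simp_all add: vec_eq_iff algebra_simps mult.assoc[symmetric] flip: fps_const_add fps_const_mult)

interpretation cvp: vector_space_pair "scl :: complex \<Rightarrow> complex fps ^ 'r \<Rightarrow> complex fps ^ 'r::finite"
  "scl :: complex \<Rightarrow> complex fps ^ 'r \<Rightarrow> complex fps ^ 'r::finite"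
  by unfold_locales

text \<open>The identity minus a projection onto \<open>B\<close>, the latter defined on a basis of
  \<open>B\<close> and extended linearly. It realizes the quotient by \<open>B\<close> inside the
  same type.\<close>

lemma linear_with_kernel:
  fixes B :: "(complex fps ^ 'r::finite) set"
  assumes B: "cv.subspace B"
  shows "\<exists>\<phi> :: complex fps ^ 'r \<Rightarrow> complex fps ^ 'r. Vector_Spaces.linear scl scl \<phi> \<and> (\<forall>x. \<phi> x = 0 \<longleftrightarrow> x \<in> B)"
proof -
  obtain b where b: "b \<subseteq> B" "cv.independent b" "B \<subseteq> cv.span b"
    by (rule cv.maximal_independent_subset)
  have sb: "cv.span b = B" using b cv.span_minimal[OF b(1) B] by blast
  define \<psi> where "\<psi> = cvp.construct b id"
  have lin: "Vector_Spaces.linear scl scl \<psi>" unfolding \<psi>_def by (rule cvp.linear_construct[OF b(2)])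
  have in_B: "\<psi> x \<in> B" for x using cvp.construct_in_span[OF b(2), of id x] by (simp add: \<psi>_def sb)
  have fix_B: "\<psi> x = x" if "x \<in> B" for x
  proof -
    have "\<psi> x = id x"
      by (rule cvp.linear_eq_on[OF lin cv.linear_id, of x b])
         (use that b in \<open>auto simp: sb \<psi>_def cvp.construct_basis\<close>)
    then show ?thesis by simp
  qed
  have "Vector_Spaces.linear scl scl (\<lambda>x. x - \<psi> x)"
    using cvp.linear_compose_sub[OF cv.linear_ident lin] .
  moreover have "x - \<psi> x = 0 \<longleftrightarrow> x \<in> B" for x
    using in_B[of x] fix_B[of x] by auto
  ultimately show ?thesis by (intro exI[of _ "\<lambda>x. x - \<psi> x"]) simp
qed

lemma quotient_basis_indep:
  assumes "quotient_basis A B S" "finite T" "T \<subseteq> S" "(\<Sum>x\<in>T. scl (u x) x) \<in> B" "x \<in> T"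
  shows "u x = 0"
  using assms(1)[unfolded quotient_basis_def, THEN conjunct2, THEN conjunct1, rule_format, of T u x] assms(2-)
  by simp

lemma quotient_basis_span:
  assumes "quotient_basis A B S" "a \<in> A"
  obtains T u where "finite T" "T \<subseteq> S" "a - (\<Sum>x\<in>T. scl (u x) x) \<in> B"
  using assms(1)[unfolded quotient_basis_def, THEN conjunct2, THEN conjunct2, rule_format, OF assms(2)]
  by (elim exE conjE)

text \<open>\<open>\<phi>\<close> identifies the quotient by its kernel with its image, so
  representatives of a quotient basis are the sets mapped injectively onto a basis of the image of
  \<open>A\<close>. Existence and uniqueness of cardinalities then come from ordinary linear
  algebra.\<close>

lemma quotient_basis_image:
  fixes A B S :: "(complex fps ^ 'r::finite) set" and \<phi> :: "complex fps ^ 'r \<Rightarrow> complex fps ^ 'r"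
  assumes \<phi>: "Vector_Spaces.linear scl scl \<phi>" "\<And>x. \<phi> x = 0 \<longleftrightarrow> x \<in> B"
  shows "quotient_basis A B S \<longleftrightarrow>
    S \<subseteq> A \<and> inj_on \<phi> S \<and> cv.independent (\<phi> ` S) \<and> \<phi> ` A \<subseteq> cv.span (\<phi> ` S)"
proof -
  interpret \<phi>: Vector_Spaces.linear scl scl \<phi> by fact
  have map: "\<phi> (\<Sum>x\<in>T. scl (u x) x) = (\<Sum>x\<in>T. scl (u x) (\<phi> x))" for T u
    by (simp add: \<phi>.sum \<phi>.scale)
  show ?thesis
  proof (intro iffI conjI)
    assume qb: "quotient_basis A B S"
    then show "S \<subseteq> A" by (simp add: quotient_basis_def)
    have ind: "u x = 0" if "finite T" "T \<subseteq> S" "\<phi> (\<Sum>x\<in>T. scl (u x) x) = 0" "x \<in> T" for T u x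
      by (rule quotient_basis_indep[OF qb that(1,2) _ that(4)]) (use that(3) \<phi>(2) in simp)
    show inj: "inj_on \<phi> S"
    proof (rule inj_onI, rule ccontr)
      fix x y assume xy: "x \<in> S" "y \<in> S" "\<phi> x = \<phi> y" "x \<noteq> y"
      \<comment> \<open>Two representatives with the same image would satisfy a relation modulo
        \<open>B\<close> with the coefficients 1 and -1.\<close>
      have "(\<Sum>z\<in>{x, y}. scl (if z = x then 1 else -1) z) = x - y"
        using xy(4) by (auto simp: vec_eq_iff simp flip: fps_const_neg)
      then have "\<phi> (\<Sum>z\<in>{x, y}. scl (if z = x then 1 else -1) z) = 0"
        using xy(3) by (simp add: \<phi>.diff)
      from ind[OF _ _ this, of x] show False using xy by simp
    qed
    show "cv.independent (\<phi> ` S)"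
      unfolding cv.independent_explicit_finite_subsets
    proof (intro allI impI ballI)
      fix T' u v assume T': "T' \<subseteq> \<phi> ` S" "finite T'" "(\<Sum>v\<in>T'. scl (u v) v) = 0" "v \<in> T'"
      then obtain T where T: "finite T" "T \<subseteq> S" "T' = \<phi> ` T" by (meson finite_subset_image)
      have "inj_on \<phi> T" using inj T by (meson inj_on_subset)
      then have "(\<Sum>v\<in>T'. scl (u v) v) = \<phi> (\<Sum>x\<in>T. scl (u (\<phi> x)) x)"
        unfolding T(3) map by (subst sum.reindex) (simp_all only: o_def)
      then have 0: "\<phi> (\<Sum>x\<in>T. scl (u (\<phi> x)) x) = 0" using T'(3) by simp
      obtain x where x: "x \<in> T" "v = \<phi> x" using T'(4) T(3) by blast
      show "u v = 0" unfolding x(2) by (rule ind[OF T(1,2) 0 x(1)])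
    qed
    show "\<phi> ` A \<subseteq> cv.span (\<phi> ` S)"
    proof clarify
      fix a assume "a \<in> A"
      then obtain T u where T: "finite T" "T \<subseteq> S" "a - (\<Sum>x\<in>T. scl (u x) x) \<in> B"
        by (rule quotient_basis_span[OF qb])
      then have "\<phi> a = (\<Sum>x\<in>T. scl (u x) (\<phi> x))"
        using \<phi>(2)[of "a - (\<Sum>x\<in>T. scl (u x) x)"] map[of u T] by (simp add: \<phi>.diff)
      also have "\<dots> \<in> cv.span (\<phi> ` S)"
        using T by (intro cv.span_sum cv.span_scale cv.span_base) auto
      finally show "\<phi> a \<in> cv.span (\<phi> ` S)" .
    qed
  next
    assume r: "S \<subseteq> A \<and> inj_on \<phi> S \<and> cv.independent (\<phi> ` S) \<and> \<phi> ` A \<subseteq> cv.span (\<phi> ` S)"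
    show "quotient_basis A B S"
      unfolding quotient_basis_def
    proof (intro conjI allI impI ballI)
      show "S \<subseteq> A" using r by blast
      fix T u x assume T: "finite T \<and> T \<subseteq> S \<and> (\<Sum>x\<in>T. scl (u x) x) \<in> B" and x: "x \<in> T"
      have inj: "inj_on \<phi> T" using r T by (meson inj_on_subset)
      define u' where "u' v = u (the_inv_into T \<phi> v)" for v
      have u': "u' (\<phi> y) = u y" if "y \<in> T" for y using that inj by (simp add: u'_def the_inv_into_f_f)
      have "(\<Sum>v\<in>\<phi> ` T. scl (u' v) v) = (\<Sum>x\<in>T. scl (u' (\<phi> x)) (\<phi> x))"
        using inj by (subst sum.reindex) (simp_all only: o_def)
      also have "\<dots> = (\<Sum>x\<in>T. scl (u x) (\<phi> x))"
        by (rule sum.cong) (simp_all only: u')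
      also have "\<dots> = 0" using T \<phi>(2) by (simp flip: map)
      finally have z: "(\<Sum>v\<in>\<phi> ` T. scl (u' v) v) = 0" .
      have "cv.independent (\<phi> ` S)" using r by blast
      from this[unfolded cv.independent_explicit_finite_subsets, rule_format, OF _ _ z, of "\<phi> x"]
      have "u' (\<phi> x) = 0" using T x by blast
      then show "u x = 0" using u' x by simp
    next
      fix a assume "a \<in> A"
      then have "\<phi> a \<in> cv.span (\<phi> ` S)" using r by blast
      then obtain T' u where T': "finite T'" "T' \<subseteq> \<phi> ` S" "\<phi> a = (\<Sum>v\<in>T'. scl (u v) v)"
        unfolding cv.span_explicit by blast
      then obtain T where T: "finite T" "T \<subseteq> S" "T' = \<phi> ` T" by (meson finite_subset_image)
      have "inj_on \<phi> T" using r T by (meson inj_on_subset)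
      then have "\<phi> a = \<phi> (\<Sum>x\<in>T. scl (u (\<phi> x)) x)"
        unfolding T'(3) T(3) map by (subst sum.reindex) (simp_all only: o_def)
      then have "\<phi> (a - (\<Sum>x\<in>T. scl (u (\<phi> x)) x)) = 0" unfolding \<phi>.diff by simp
      then have "a - (\<Sum>x\<in>T. scl (u (\<phi> x)) x) \<in> B" unfolding \<phi>(2) .
      then show "\<exists>T u. finite T \<and> T \<subseteq> S \<and> a - (\<Sum>x\<in>T. scl (u x) x) \<in> B"
        using T(1,2) by (intro exI[of _ T] exI[of _ "\<lambda>x. u (\<phi> x)"] conjI)
    qed
  qed
qed

lemma quotient_basis_exists:
  fixes A B :: "(complex fps ^ 'r::finite) set"
  assumes "cv.subspace B"
  shows "\<exists>S. quotient_basis A B S"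
proof -
  obtain \<phi> :: "complex fps ^ 'r \<Rightarrow> complex fps ^ 'r" where \<phi>: "Vector_Spaces.linear scl scl \<phi>" "\<And>x. \<phi> x = 0 \<longleftrightarrow> x \<in> B"
    using linear_with_kernel[OF assms] by blast
  obtain C where C: "C \<subseteq> \<phi> ` A" "cv.independent C" "\<phi> ` A \<subseteq> cv.span C"
    by (rule cv.maximal_independent_subset)
  then obtain S where "S \<subseteq> A" "inj_on \<phi> S" "C = \<phi> ` S" by (metis subset_image_inj)
  then have "quotient_basis A B S" using quotient_basis_image[OF \<phi>] C by blast
  then show ?thesis by blast
qed

lemma quotient_basis_unique:
  fixes A B :: "(complex fps ^ 'r::finite) set"
  assumes "cv.subspace B" "quotient_basis A B S" "finite S" "quotient_basis A B S'"
  shows "finite S'" "card S' = card S"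
proof -
  obtain \<phi> :: "complex fps ^ 'r \<Rightarrow> complex fps ^ 'r" where \<phi>: "Vector_Spaces.linear scl scl \<phi>" "\<And>x. \<phi> x = 0 \<longleftrightarrow> x \<in> B"
    using linear_with_kernel[OF assms(1)] by blast
  note S = assms(2)[unfolded quotient_basis_image[OF \<phi>]]
  note S' = assms(4)[unfolded quotient_basis_image[OF \<phi>]]
  have 1: "finite (\<phi> ` S') \<and> card (\<phi> ` S') \<le> card (\<phi> ` S)"
    by (rule cv.independent_span_bound) (use S S' assms(3) in blast)+
  then have 2: "finite (\<phi> ` S) \<and> card (\<phi> ` S) \<le> card (\<phi> ` S')"
    by (intro cv.independent_span_bound) (use S S' assms(3) in blast)+
  show "finite S'" using 1 S' by (auto simp: finite_image_iff)
  show "card S' = card S" using 1 2 S S' by (auto simp: card_image)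
qed

lemma quotient_dim_eq:
  fixes A B :: "(complex fps ^ 'r::finite) set"
  assumes "cv.subspace B" "quotient_basis A B S" "finite S"
  shows "quotient_dim A B = card S"
  unfolding quotient_dim_def
  using quotient_basis_unique(2)[OF assms] assms(2) by (metis someI_ex)

text \<open>Additivity of dimension along \<open>C \<subseteq> B \<subseteq> A\<close>, stated for
  bases rather than dimensions: finiteness of the union then yields finiteness of each part.\<close>

lemma quotient_basis_Un:
  fixes A B C :: "(complex fps ^ 'r::finite) set"
  assumes sub: "cv.subspace B" "cv.subspace C" "C \<subseteq> B" "B \<subseteq> A"
    and S: "quotient_basis A B S" and S': "quotient_basis B C S'"
  shows "quotient_basis A C (S \<union> S')" "S \<inter> S' = {}"
proof -
  have SA: "S \<subseteq> A" "S' \<subseteq> B" using S S' by (auto simp: quotient_basis_def)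
  show disj: "S \<inter> S' = {}"
  proof (rule ccontr)
    assume "S \<inter> S' \<noteq> {}"
    then obtain x where x: "x \<in> S" "x \<in> S'" by auto
    then have "(\<Sum>y\<in>{x}. scl ((\<lambda>_. 1) y) y) \<in> B" using SA by auto
    then have "(1::complex) = 0"
      using quotient_basis_indep[OF S, of "{x}" "\<lambda>_. 1" x] x by simp
    then show False by simp
  qed
  have sumB: "(\<Sum>x\<in>T. scl (u x) x) \<in> B" if "T \<subseteq> S'" for T u
    using that SA sub(1) by (intro cv.subspace_sum cv.subspace_scale) auto
  show "quotient_basis A C (S \<union> S')"
    unfolding quotient_basis_def
  proof (intro conjI allI impI ballI)
    show "S \<union> S' \<subseteq> A" using SA sub by auto
    fix T u x assume T: "finite T \<and> T \<subseteq> S \<union> S' \<and> (\<Sum>x\<in>T. scl (u x) x) \<in> C" and x: "x \<in> T"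
    have "T = (T \<inter> S) \<union> (T \<inter> S')" using T by auto
    then have eq: "(\<Sum>x\<in>T. scl (u x) x) = (\<Sum>x\<in>T \<inter> S. scl (u x) x) + (\<Sum>x\<in>T \<inter> S'. scl (u x) x)"
      using T disj by (subst sum.union_disjoint[symmetric]) auto
    have "(\<Sum>x\<in>T. scl (u x) x) - (\<Sum>x\<in>T \<inter> S'. scl (u x) x) \<in> B"
      using T sub sumB[of "T \<inter> S'" u] by (intro cv.subspace_diff) auto
    then have B: "(\<Sum>x\<in>T \<inter> S. scl (u x) x) \<in> B" unfolding eq by simp
    have z: "u y = 0" if "y \<in> T \<inter> S" for y
      by (rule quotient_basis_indep[OF S _ _ B that]) (use T in auto)
    then have "(\<Sum>x\<in>T \<inter> S. scl (u x) x) = 0" by (intro sum.neutral) auto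
    then have C: "(\<Sum>x\<in>T \<inter> S'. scl (u x) x) \<in> C" using T eq by simp
    have "u y = 0" if "y \<in> T \<inter> S'" for y
      by (rule quotient_basis_indep[OF S' _ _ C that]) (use T in auto)
    with z show "u x = 0" using x T by auto
  next
    fix a assume "a \<in> A"
    then obtain T u where T: "finite T" "T \<subseteq> S" "a - (\<Sum>x\<in>T. scl (u x) x) \<in> B"
      by (rule quotient_basis_span[OF S])
    obtain T' u' where T': "finite T'" "T' \<subseteq> S'"
      "a - (\<Sum>x\<in>T. scl (u x) x) - (\<Sum>x\<in>T'. scl (u' x) x) \<in> C"
      by (rule quotient_basis_span[OF S' T(3)])
    define v where "v x = (if x \<in> S then u x else u' x)" for x
    have "T \<inter> T' = {}" using T T' disj by auto
    then have "(\<Sum>x\<in>T \<union> T'. scl (v x) x) = (\<Sum>x\<in>T. scl (v x) x) + (\<Sum>x\<in>T'. scl (v x) x)"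
      using T T' by (intro sum.union_disjoint)
    also have "(\<Sum>x\<in>T. scl (v x) x) = (\<Sum>x\<in>T. scl (u x) x)"
      using T by (intro sum.cong) (auto simp: v_def)
    also have "(\<Sum>x\<in>T'. scl (v x) x) = (\<Sum>x\<in>T'. scl (u' x) x)"
      using T' disj by (intro sum.cong) (auto simp: v_def)
    finally have "a - (\<Sum>x\<in>T \<union> T'. scl (v x) x) \<in> C" using T'(3) by (simp add: algebra_simps)
    then show "\<exists>T u. finite T \<and> T \<subseteq> S \<union> S' \<and> a - (\<Sum>x\<in>T. scl (u x) x) \<in> C"
      using T T' by (intro exI[of _ "T \<union> T'"] exI[of _ v]) auto
  qed
qed

lemma quotient_basis_self:
  fixes A :: "(complex fps ^ 'r::finite) set"
  shows "quotient_basis A A {}"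
  unfolding quotient_basis_def
proof (intro conjI ballI allI impI)
  show "\<exists>T u. finite T \<and> T \<subseteq> {} \<and> a - (\<Sum>x\<in>T. scl (u x) x) \<in> A" if "a \<in> A" for a
    using that by (intro exI[of _ "{}"]) simp
qed blast+

section \<open>The Hilbert function\<close>

lemma valuation_ge_iff: "valuation i f \<ge> enat n \<longleftrightarrow> (\<forall>k<n. fps_nth (f $ i) k = 0)"
proof (cases "f $ i = 0")
  case False
  then have "enat n \<le> valuation i f \<longleftrightarrow> n \<le> subdegree (f $ i)" by (simp add: valuation_def)
  also have "\<dots> \<longleftrightarrow> (\<forall>k<n. fps_nth (f $ i) k = 0)"
    using subdegree_geI[OF False] nth_less_subdegree_zero order_less_le_trans by metis
  finally show ?thesis .
qed (simp add: valuation_def)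

lemma val_filtration_iff:
  "f \<in> val_filtration A l \<longleftrightarrow> f \<in> A \<and> (\<forall>i. \<forall>k<l $ i. fps_nth (f $ i) k = 0)"
  by (simp add: val_filtration_def valuation_ge_iff)

lemma subspace_val_filtration:
  fixes A :: "(complex fps ^ 'r::finite) set"
  assumes "cv.subspace A"
  shows "cv.subspace (val_filtration A l)"
  using assms unfolding cv.subspace_def by (auto simp: val_filtration_iff)

definition val_jump :: "(complex fps ^ 'r) set \<Rightarrow> nat ^ 'r \<Rightarrow> 'r \<Rightarrow> bool" where
  "val_jump A l i \<longleftrightarrow> (\<exists>f\<in>val_filtration A l. fps_nth (f $ i) (l $ i) \<noteq> 0)"

text \<open>The next filtration step is the kernel of one linear functional on
  \<open>val_filtration A l\<close>, the coefficient of index \<open>l $ i\<close> in component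
  \<open>i\<close>. The codimension is 1 or 0 according to whether this functional is nonzero, which
  is the content of \<open>val_jump\<close>.\<close>

lemma quotient_basis_step:
  fixes A :: "(complex fps ^ 'r::finite) set"
  assumes A: "cv.subspace A"
  shows "\<exists>S. finite S \<and> card S = (if val_jump A l i then 1 else 0) \<and>
     quotient_basis (val_filtration A l) (val_filtration A (vertex l {i})) S"
proof -
  have mem: "f \<in> val_filtration A (vertex l {i}) \<longleftrightarrow> f \<in> val_filtration A l \<and> fps_nth (f $ i) (l $ i) = 0" for f
    unfolding val_filtration_iff by (auto simp: less_Suc_eq split: if_splits)
  show ?thesis
  proof (cases "val_jump A l i")
    case False
    then have "val_filtration A (vertex l {i}) = val_filtration A l"
      using mem by (auto simp: val_jump_def)
    then show ?thesis using False by (intro exI[of _ "{}"]) (simp add: quotient_basis_self)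
  next
    case True
    then obtain f where f: "f \<in> val_filtration A l" "fps_nth (f $ i) (l $ i) \<noteq> 0" by (auto simp: val_jump_def)
    note sub = subspace_val_filtration[OF A, of l]
    have "quotient_basis (val_filtration A l) (val_filtration A (vertex l {i})) {f}"
      unfolding quotient_basis_def
    proof (intro conjI allI impI ballI)
      show "{f} \<subseteq> val_filtration A l" using f by simp
      fix T and u :: "_ \<Rightarrow> complex" and x
      assume T: "finite T \<and> T \<subseteq> {f} \<and> (\<Sum>x\<in>T. scl (u x) x) \<in> val_filtration A (vertex l {i})" and x: "x \<in> T"
      then have "T = {f}" "x = f" by auto
      then show "u x = 0" using T f(2) by (auto simp: mem)
    next
      fix a assume a: "a \<in> val_filtration A l"
      define c where "c = fps_nth (a $ i) (l $ i) / fps_nth (f $ i) (l $ i)"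
      have "a - scl c f \<in> val_filtration A l"
        using a f sub by (intro cv.subspace_diff cv.subspace_scale)
      moreover have "fps_nth ((a - scl c f) $ i) (l $ i) = 0"
        using f(2) by (simp add: c_def)
      ultimately have "a - scl c f \<in> val_filtration A (vertex l {i})" unfolding mem by (rule conjI)
      then show "\<exists>T u. finite T \<and> T \<subseteq> {f} \<and> a - (\<Sum>x\<in>T. scl (u x) x) \<in> val_filtration A (vertex l {i})"
        by (intro exI[of _ "{f}"] exI[of _ "\<lambda>_. c"] conjI) simp_all
    qed
    then show ?thesis using True by (intro exI[of _ "{f}"]) auto
  qed
qed

lemma val_filtration_antimono:
  "(\<And>i. l $ i \<le> l' $ i) \<Longrightarrow> val_filtration A l' \<subseteq> val_filtration A l"
  unfolding val_filtration_iff[abs_def] subset_iff by (meson order_less_le_trans)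

lemma quotient_basis_val_filtration:
  fixes A :: "(complex fps ^ 'r::finite) set"
  assumes A: "cv.subspace A"
  shows "\<exists>S. finite S \<and> quotient_basis A (val_filtration A l) S"
proof (induction "abs_sum l" arbitrary: l)
  case 0
  then have "l = 0" by (auto simp: abs_sum_def vec_eq_iff)
  then have "val_filtration A l = A" by (auto simp: val_filtration_iff)
  then show ?case using quotient_basis_self by auto
next
  case (Suc n)
  then obtain i where i: "l $ i \<noteq> 0" by (metis abs_sum_def Zero_not_Suc sum.neutral)
  define l' where "l' = (\<chi> j. if j = i then l $ j - 1 else l $ j)"
  have l: "l = vertex l' {i}" using i by (auto simp: l'_def vec_eq_iff)
  have "abs_sum l = abs_sum l' + 1" unfolding l abs_sum_def by (simp add: sum.distrib)
  then obtain S where S: "finite S" "quotient_basis A (val_filtration A l') S" using Suc by force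
  obtain S' where S': "finite S'" "quotient_basis (val_filtration A l') (val_filtration A l) S'"
    using quotient_basis_step[OF A, of l' i] l by auto
  have "quotient_basis A (val_filtration A l) (S \<union> S')"
    by (rule quotient_basis_Un(1)[OF _ _ _ _ S(2) S'(2)])
       (auto simp: subspace_val_filtration A val_filtration_iff l)
  then show ?case using S S' by blast
qed

lemma hilbert_fun_eq:
  fixes A :: "(complex fps ^ 'r::finite) set"
  assumes "cv.subspace A" "quotient_basis A (val_filtration A l) S"
  shows "finite S" "hilbert_fun A l = card S"
proof -
  obtain S' where S': "finite S'" "quotient_basis A (val_filtration A l) S'"
    using quotient_basis_val_filtration[OF assms(1)] by blast
  show "finite S"
    using quotient_basis_unique(1)[OF subspace_val_filtration[OF assms(1)] S'(2,1) assms(2)] .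
  then show "hilbert_fun A l = card S"
    unfolding hilbert_fun_def
    by (rule quotient_dim_eq[OF subspace_val_filtration[OF assms(1)] assms(2)])
qed

lemma hilbert_fun_0:
  fixes A :: "(complex fps ^ 'r::finite) set"
  assumes "cv.subspace A"
  shows "hilbert_fun A 0 = 0"
proof -
  have "val_filtration A 0 = A" by (auto simp: val_filtration_iff)
  then show ?thesis using hilbert_fun_eq[OF assms, of 0 "{}"] quotient_basis_self[of A] by simp
qed

lemma hilbert_fun_step:
  fixes A :: "(complex fps ^ 'r::finite) set"
  assumes A: "cv.subspace A"
  shows "hilbert_fun A (vertex l {i}) = hilbert_fun A l + (if val_jump A l i then 1 else 0)"
proof -
  obtain S where S: "finite S" "quotient_basis A (val_filtration A l) S"
    using quotient_basis_val_filtration[OF A] by blast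
  obtain S' where S': "finite S'" "card S' = (if val_jump A l i then 1 else 0)"
    "quotient_basis (val_filtration A l) (val_filtration A (vertex l {i})) S'"
    using quotient_basis_step[OF A, of l i] by blast
  have "quotient_basis A (val_filtration A (vertex l {i})) (S \<union> S')" "S \<inter> S' = {}"
    by (rule quotient_basis_Un[OF _ _ _ _ S(2) S'(3)];
        auto simp: subspace_val_filtration A val_filtration_iff)+
  then show ?thesis
    using hilbert_fun_eq[OF A] S S' by (auto simp: card_Un_disjoint)
qed

text \<open>Submodularity of the Hilbert function: a witness of the jump at the larger
  \<open>l'\<close> also lies in the filtration step of \<open>l\<close>, and the coefficient
  concerned is the same.\<close>

lemma val_jump_antimono:
  assumes "val_jump A l' i" "l' $ i = l $ i" "\<And>j. l $ j \<le> l' $ j"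
  shows "val_jump A l i"
  using assms val_filtration_antimono[of l l' A] by (auto simp: val_jump_def)

lemma vertex_insert: "i \<notin> J \<Longrightarrow> vertex l (insert i J) = vertex (vertex l J) {i}"
  by (auto simp: vec_eq_iff)

lemma hilbert_fun_insert:
  fixes A :: "(complex fps ^ 'r::finite) set"
  assumes "cv.subspace A" "i \<notin> J"
  shows "hilbert_fun A (vertex l (insert i J)) =
    hilbert_fun A (vertex l J) + (if val_jump A (vertex l J) i then 1 else 0)"
  unfolding vertex_insert[OF assms(2)] by (rule hilbert_fun_step[OF assms(1)])

lemma hilbert_fun_vertex_le:
  fixes A :: "(complex fps ^ 'r::finite) set"
  assumes A: "cv.subspace A"
  shows "hilbert_fun A l \<le> hilbert_fun A (vertex l J) \<and> hilbert_fun A (vertex l J) \<le> hilbert_fun A l + card J"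
proof -
  have "finite J" by simp
  then show ?thesis
  proof (induction J)
    case empty
    have "vertex l {} = l" by (simp add: vec_eq_iff)
    then show ?case by simp
  next
    case (insert i J)
    then show ?case by (auto simp: hilbert_fun_insert[OF A])
  qed
qed

text \<open>The jumps of the Hilbert function along a cube form the rank function of a matroid, and the
  maximum of the weight is attained at its bases.\<close>

lemma hilbert_fun_matroid_basis:
  fixes A :: "(complex fps ^ 'r::finite) set"
  assumes A: "cv.subspace A"
  shows "\<exists>J\<subseteq>I. hilbert_fun A (vertex l J) = hilbert_fun A (vertex l I) \<and>
    hilbert_fun A (vertex l J) = hilbert_fun A l + card J"
proof -
  have "finite I" by simp
  then show ?thesis
  proof (induction I)
    case empty
    have "vertex l {} = l" by (simp add: vec_eq_iff)
    then show ?case by auto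
  next
    case (insert i I)
    then obtain J where J: "J \<subseteq> I" "hilbert_fun A (vertex l J) = hilbert_fun A (vertex l I)"
      "hilbert_fun A (vertex l J) = hilbert_fun A l + card J" by auto
    show ?case
    proof (cases "val_jump A (vertex l I) i")
      case False
      then have "hilbert_fun A (vertex l (insert i I)) = hilbert_fun A (vertex l I)"
        using insert by (simp add: hilbert_fun_insert[OF A])
      then show ?thesis using J by (intro exI[of _ J]) auto
    next
      case True
      have iJ: "i \<notin> J" using J insert by auto
      \<comment> \<open>Greedy step: submodularity passes the jump from the larger vertex down to
        \<open>J\<close>, so \<open>J\<close> stays independent when \<open>i\<close> is
        added.\<close>
      have "val_jump A (vertex l J) i"
        using True by (rule val_jump_antimono) (use J iJ insert in auto)
      then have "hilbert_fun A (vertex l (insert i J)) = hilbert_fun A (vertex l J) + 1"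
        using iJ by (simp add: hilbert_fun_insert[OF A])
      moreover have "hilbert_fun A (vertex l (insert i I)) = hilbert_fun A (vertex l I) + 1"
        using True insert by (simp add: hilbert_fun_insert[OF A])
      moreover have "card (insert i J) = card J + 1" using iJ by simp
      ultimately show ?thesis using J by (intro exI[of _ "insert i J"]) auto
    qed
  qed
qed

lemma abs_sum_vertex: "abs_sum (vertex l J) = abs_sum l + card (J :: 'r::finite set)"
  by (simp add: abs_sum_def sum.distrib sum.If_cases)

text \<open>At the vertex given by \<open>J\<close> one copy of the Hilbert function is at most its
  value at the top vertex, the other at most \<open>hilbert_fun A l + card J\<close>; the
  cardinality cancels against the coordinate sum. A matroid basis attains both bounds at
  once.\<close>

lemma cube_weight_eq:
  fixes A :: "(complex fps ^ 'r::finite) set"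
  assumes A: "cv.subspace A"
  shows "cube_weight A l I = int (hilbert_fun A (vertex l I)) + int (hilbert_fun A l) - int (abs_sum l)"
  unfolding cube_weight_def
proof (rule Max_eqI)
  fix y assume "y \<in> (\<lambda>J. weight A (vertex l J)) ` Pow I"
  then obtain J where J: "J \<subseteq> I" "y = weight A (vertex l J)" by auto
  have "vertex l I = vertex (vertex l J) (I - J)" using J by (auto simp: vec_eq_iff)
  then have "hilbert_fun A (vertex l J) \<le> hilbert_fun A (vertex l I)"
    using hilbert_fun_vertex_le[OF A, of "vertex l J" "I - J"] by simp
  moreover have "hilbert_fun A (vertex l J) \<le> hilbert_fun A l + card J"
    using hilbert_fun_vertex_le[OF A, of l J] by simp
  ultimately show "y \<le> int (hilbert_fun A (vertex l I)) + int (hilbert_fun A l) - int (abs_sum l)"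
    unfolding J(2) weight_def abs_sum_vertex by simp
next
  obtain J where J: "J \<subseteq> I" "hilbert_fun A (vertex l J) = hilbert_fun A (vertex l I)"
    "hilbert_fun A (vertex l J) = hilbert_fun A l + card J"
    using hilbert_fun_matroid_basis[OF A, of I l] by blast
  then have "weight A (vertex l J) = int (hilbert_fun A (vertex l I)) + int (hilbert_fun A l) - int (abs_sum l)"
    by (simp add: weight_def abs_sum_vertex)
  then show "int (hilbert_fun A (vertex l I)) + int (hilbert_fun A l) - int (abs_sum l)
      \<in> (\<lambda>J. weight A (vertex l J)) ` Pow I" using J(1) by (metis PowI image_eqI)
qed simp

text \<open>The weight of a cube is a function of its highest vertex plus a function of its lowest
  one. Each of the two alternating sums collapses to one corner of the box, and the Hilbert function
  vanishes at the origin.\<close>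

lemma sum_cube_weights:
  fixes A :: "(complex fps ^ 'r::finite) set"
  assumes A: "cv.subspace A"
  shows "(\<Sum>(l, I)\<in>cells 0 c. (-1) ^ card I * cube_weight A l I) = int (hilbert_fun A c) - int (abs_sum c)"
proof -
  have "(\<Sum>(l, I)\<in>cells 0 c. (-1) ^ card I * cube_weight A l I) =
    (\<Sum>(l, I)\<in>cells 0 c. (-1) ^ card I * int (hilbert_fun A (vertex l I))) +
    (\<Sum>(l, I)\<in>cells 0 c. (-1) ^ card I * (int (hilbert_fun A l) - int (abs_sum l)))"
    by (simp add: case_prod_unfold cube_weight_eq[OF A] algebra_simps flip: sum.distrib)
  also have "(\<Sum>(l, I)\<in>cells 0 c. (-1) ^ card I * int (hilbert_fun A (vertex l I))) = int (hilbert_fun A 0)"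
    by (rule sum_cells_top) simp
  also have "(\<Sum>(l, I)\<in>cells 0 c. (-1) ^ card I * (int (hilbert_fun A l) - int (abs_sum l))) =
    int (hilbert_fun A c) - int (abs_sum c)"
    by (rule sum_cells_bottom) simp
  finally show ?thesis using hilbert_fun_0[OF A] by simp
qed

section \<open>Conductor and delta invariant\<close>

definition evec :: "'r \<Rightarrow> complex fps \<Rightarrow> complex fps ^ 'r::finite" where
  "evec i g = (\<chi> j. if j = i then g else 0)"

lemma evec_nth [simp]: "evec i g $ j = (if j = i then g else 0)"
  by (simp add: evec_def)

lemma evec_sum: "(\<Sum>i\<in>UNIV. evec i (g $ i)) = (g :: complex fps ^ 'r::finite)"
  by (simp add: vec_eq_iff)

lemma conv_ring_iff: "f \<in> conv_ring \<longleftrightarrow> (\<forall>i. fps_conv_radius (f $ i) > 0)"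
  by (simp add: conv_ring_def)

lemma conv_ring_add: "f \<in> conv_ring \<Longrightarrow> g \<in> conv_ring \<Longrightarrow> f + g \<in> conv_ring"
  unfolding conv_ring_iff using fps_conv_radius_add by (metis less_le_trans min_less_iff_conj vector_add_component)

lemma conv_ring_mult: "f \<in> conv_ring \<Longrightarrow> g \<in> conv_ring \<Longrightarrow> f * g \<in> conv_ring"
  unfolding conv_ring_iff using fps_conv_radius_mult by (metis less_le_trans min_less_iff_conj vector_mult_component)

lemma conv_ring_1: "1 \<in> conv_ring"
  by (simp add: conv_ring_iff)

lemma conv_ring_evec: "fps_conv_radius g > 0 \<Longrightarrow> evec i g \<in> conv_ring"
  by (simp add: conv_ring_iff)

lemma scl_eq_mult: "scl c f = (\<chi> i. fps_const c) * f"
  by (simp add: vec_eq_iff)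

lemma subspace_conv_ring: "cv.subspace (conv_ring :: (complex fps ^ 'r::finite) set)"
proof -
  have c: "(\<chi> i. fps_const c) \<in> (conv_ring :: (complex fps ^ 'r) set)" for c by (simp add: conv_ring_iff)
  have z: "0 \<in> (conv_ring :: (complex fps ^ 'r) set)" by (simp add: conv_ring_iff)
  show ?thesis
    unfolding cv.subspace_def
    unfolding scl_eq_mult
    by (intro conjI ballI allI conv_ring_add conv_ring_mult c z)
qed

text \<open>The multiples of the monomial with exponents \<open>c\<close> all lie in
  \<open>A\<close>, expressed by vanishing coefficients. The conductor enters the later arguments
  through this inclusion.\<close>

definition conductor_bound :: "(complex fps ^ 'r::finite) set \<Rightarrow> nat ^ 'r \<Rightarrow> bool" where
  "conductor_bound A c \<longleftrightarrow> (\<forall>f\<in>conv_ring. (\<forall>i. \<forall>k<c $ i. fps_nth (f $ i) k = 0) \<longrightarrow> f \<in> A)"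

lemma val_jumpI:
  assumes "evec i (fps_X ^ (l $ i)) \<in> A"
  shows "val_jump A l i"
  unfolding val_jump_def
  by (rule bexI[of _ "evec i (fps_X ^ (l $ i))"]) (use assms in \<open>auto simp: val_filtration_iff\<close>)

lemma conductor_bound_val_jump:
  assumes "conductor_bound A c" "c $ i \<le> l $ i"
  shows "val_jump A l i"
  using assms by (intro val_jumpI) (auto simp: conductor_bound_def conv_ring_iff)

lemma conductor_bound_weight_stable:
  fixes A :: "(complex fps ^ 'r::finite) set"
  assumes "cv.subspace A" "conductor_bound A c"
  shows "weight_stable A c"
  using conductor_bound_val_jump[OF assms(2)]
  by (auto simp: weight_stable_def weight_def hilbert_fun_step[OF assms(1)] abs_sum_vertex)

text \<open>In the full product every step jumps, the witness being a monomial in one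
  component.\<close>

lemma hilbert_fun_conv_ring: "hilbert_fun (conv_ring :: (complex fps ^ 'r::finite) set) l = abs_sum l"
proof (induction "abs_sum l" arbitrary: l)
  case 0
  then have "l = 0" by (auto simp: abs_sum_def vec_eq_iff)
  then show ?case using hilbert_fun_0[OF subspace_conv_ring] by (simp add: abs_sum_def)
next
  case (Suc n)
  then obtain i where i: "l $ i \<noteq> 0" by (metis abs_sum_def Zero_not_Suc sum.neutral)
  define l' where "l' = (\<chi> j. if j = i then l $ j - 1 else l $ j)"
  have "l $ j = vertex l' {i} $ j" for j using i by (cases "j = i") (simp_all add: l'_def)
  then have l: "l = vertex l' {i}" unfolding vec_eq_iff by blast
  have a: "abs_sum l = abs_sum l' + 1" unfolding l abs_sum_vertex by simp
  have "val_jump conv_ring l' i" by (rule val_jumpI, rule conv_ring_evec) simp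
  then have "hilbert_fun conv_ring l = hilbert_fun conv_ring l' + 1"
    unfolding l hilbert_fun_step[OF subspace_conv_ring] by simp
  then show ?case using Suc a by simp
qed

text \<open>The filtration step at \<open>c\<close> is the same for \<open>A\<close> and for its
  normalization. Its codimension in the latter is the coordinate sum of \<open>c\<close> and splits
  at \<open>A\<close>; the same chain shows that the quotient defining delta is
  finite-dimensional.\<close>

theorem delta_hilbert:
  fixes A :: "(complex fps ^ 'r::finite) set"
  assumes A: "cv.subspace A" and sub: "A \<subseteq> conv_ring" and c: "conductor_bound A c"
  shows "delta_invariant A + hilbert_fun A c = abs_sum c"
proof -
  have eq: "val_filtration conv_ring c = val_filtration A c"
    using c sub by (auto simp: val_filtration_iff conductor_bound_def)
  obtain S1 where S1: "quotient_basis conv_ring A S1" using quotient_basis_exists[OF A] by blast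
  obtain S2 where S2: "finite S2" "quotient_basis A (val_filtration A c) S2"
    using quotient_basis_val_filtration[OF A] by blast
  have U: "quotient_basis conv_ring (val_filtration conv_ring c) (S1 \<union> S2)" "S1 \<inter> S2 = {}"
    unfolding eq
    by (rule quotient_basis_Un[OF A subspace_val_filtration[OF A] _ sub S1 S2(2)];
        simp add: val_filtration_def)+
  have "finite (S1 \<union> S2)" "abs_sum c = card (S1 \<union> S2)"
    using hilbert_fun_eq[OF subspace_conv_ring U(1)] hilbert_fun_conv_ring[of c] by auto
  then have "abs_sum c = card S1 + card S2" "finite S1" using U(2) S2(1) by (auto simp: card_Un_disjoint)
  then show ?thesis
    using quotient_dim_eq[OF A S1] hilbert_fun_eq(2)[OF A S2(2)] by (simp add: delta_invariant_def)
qed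

text \<open>The conductor ideal is an ideal of a product of discrete valuation rings, and
  \<open>B\<close> makes each of its components nonzero. A member of least order in component
  \<open>i\<close>, multiplied there by the inverse of its unit part and by zero elsewhere, becomes
  a pure monomial, and these monomials generate the ideal.\<close>

theorem conductor_bound_conductor:
  fixes A :: "(complex fps ^ 'r::finite) set"
  assumes A: "cv.subspace A" "A \<subseteq> conv_ring"
    and B: "B \<in> A" "\<And>i. B $ i \<noteq> 0" "\<And>g. g \<in> conv_ring \<Longrightarrow> B * g \<in> A"
  shows "conductor_bound A (conductor A)"
proof -
  let ?C = "conductor_ideal A"
  let ?T = "\<lambda>c :: nat ^ 'r. (\<lambda>g. (\<chi> i. fps_X ^ (c $ i)) * g) ` conv_ring"
  have BC: "B \<in> ?C" using B by (simp add: conductor_ideal_def)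
  have Cconv: "f \<in> conv_ring" if "f \<in> ?C" for f using that A by (auto simp: conductor_ideal_def)
  have C0: "0 \<in> ?C" using A by (auto simp: conductor_ideal_def cv.subspace_0)
  have Cadd: "f + g \<in> ?C" if "f \<in> ?C" "g \<in> ?C" for f g
    using that A by (auto simp: conductor_ideal_def distrib_right intro: cv.subspace_add)
  have Cmult: "f * g \<in> ?C" if "f \<in> ?C" "g \<in> conv_ring" for f g
    using that conv_ring_mult by (auto simp: conductor_ideal_def mult.assoc)
  have Csum: "sum f I \<in> ?C" if "finite I" "\<And>i. i \<in> I \<Longrightarrow> f i \<in> ?C" for f :: "'r \<Rightarrow> _" and I
    using that by (induction I) (auto intro: Cadd C0)
  define P where "P i n \<longleftrightarrow> (\<exists>f\<in>?C. f $ i \<noteq> 0 \<and> subdegree (f $ i) = n)" for i n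
  define c :: "nat ^ 'r" where "c = (\<chi> i. LEAST n. P i n)"
  have P: "P i (c $ i)" for i
    unfolding c_def vec_lambda_beta by (rule LeastI[of _ "subdegree (B $ i)"]) (use BC B in \<open>auto simp: P_def\<close>)
  have least: "c $ i \<le> subdegree (f $ i)" if "f \<in> ?C" "f $ i \<noteq> 0" for f i
    unfolding c_def vec_lambda_beta by (rule Least_le) (use that in \<open>auto simp: P_def\<close>)
  have e: "evec i (fps_X ^ (c $ i)) \<in> ?C" for i
  proof -
    obtain f where f: "f \<in> ?C" "f $ i \<noteq> 0" "subdegree (f $ i) = c $ i" using P[of i] by (auto simp: P_def)
    define u where "u = fps_shift (c $ i) (f $ i)"
    have fu: "f $ i = u * fps_X ^ (c $ i)" using subdegree_decompose[of "f $ i"] f by (simp add: u_def)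
    have u0: "fps_nth u 0 \<noteq> 0" using nth_subdegree_nonzero[OF f(2)] f(3) by (simp add: u_def)
    have "fps_conv_radius u > 0" using Cconv[OF f(1)] by (simp add: u_def conv_ring_iff)
    then have "evec i (inverse u) \<in> conv_ring" using u0 by (intro conv_ring_evec fps_conv_radius_inverse_pos)
    then have "f * evec i (inverse u) \<in> ?C" using f by (intro Cmult)
    moreover have "f * evec i (inverse u) = evec i (fps_X ^ (c $ i))"
      using inverse_mult_eq_1'[OF u0] by (simp add: vec_eq_iff fu mult.assoc mult.commute[of _ "inverse u"])
    ultimately show ?thesis by simp
  qed
  have eqc: "?C = ?T c"
  proof
    show "?C \<subseteq> ?T c"
    proof
      fix f assume f: "f \<in> ?C"
      define g :: "complex fps ^ 'r" where "g = (\<chi> i. fps_shift (c $ i) (f $ i))"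
      have "g \<in> conv_ring" using Cconv[OF f] by (simp add: g_def conv_ring_iff)
      moreover have "f $ i = fps_X ^ (c $ i) * g $ i" for i
      proof (cases "f $ i = 0")
        case False
        then show ?thesis using subdegree_decompose'[OF least[OF f False]] by (simp add: g_def mult.commute)
      qed (simp add: g_def)
      then have "f = (\<chi> i. fps_X ^ (c $ i)) * g" by (simp add: vec_eq_iff)
      ultimately show "f \<in> ?T c" by blast
    qed
    show "?T c \<subseteq> ?C"
    proof clarify
      fix g :: "complex fps ^ 'r" assume g: "g \<in> conv_ring"
      have "(\<Sum>i\<in>UNIV. evec i (fps_X ^ (c $ i)) * g) \<in> ?C" using g by (intro Csum Cmult e) auto
      also have "(\<Sum>i\<in>UNIV. evec i (fps_X ^ (c $ i)) * g) = (\<chi> i. fps_X ^ (c $ i)) * g"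
      proof -
        have "(\<Sum>i\<in>UNIV. evec i (fps_X ^ (c $ i)) * g) = (\<Sum>i\<in>UNIV. evec i ((\<chi> i. fps_X ^ (c $ i)) $ i)) * g"
          by (simp only: sum_distrib_right vec_lambda_beta)
        then show ?thesis unfolding evec_sum .
      qed
      finally show "(\<chi> i. fps_X ^ (c $ i)) * g \<in> ?C" .
    qed
  qed
  \<comment> \<open>Uniqueness of the exponents, as \<open>THE\<close> demands: the image of 1 under
    one vector of exponents must be divisible, component by component, by the monomials of the
    other.\<close>
  have le: "c2 $ i \<le> c1 $ i" if sub: "?T c1 \<subseteq> ?T c2" for c1 c2 :: "nat ^ 'r" and i
  proof -
    have "(\<chi> i. fps_X ^ (c1 $ i)) * 1 \<in> ?T c1" using conv_ring_1 by blast
    then obtain g :: "complex fps ^ 'r" where "(\<chi> i. fps_X ^ (c1 $ i)) * 1 = (\<chi> i. fps_X ^ (c2 $ i)) * g"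
      using sub by blast
    then have g: "fps_X ^ (c1 $ i) = fps_X ^ (c2 $ i) * g $ i" by (simp add: vec_eq_iff)
    show ?thesis
    proof (rule ccontr)
      assume "\<not> c2 $ i \<le> c1 $ i"
      then have "fps_nth (fps_X ^ (c2 $ i) * g $ i) (c1 $ i) = 0" by (simp add: fps_X_power_mult_nth)
      then show False unfolding g[symmetric] by simp
    qed
  qed
  have "conductor A = c"
    unfolding conductor_def
  proof (rule the_equality)
    show "?C = ?T c" by (rule eqc)
    fix c' assume "?C = ?T c'"
    then have "?T c' = ?T c" using eqc by simp
    then have "c' $ i = c $ i" for i using le[of c c' i] le[of c' c i] by simp
    then show "c' = c" by (simp add: vec_eq_iff)
  qed
  moreover have "conductor_bound A c"
    unfolding conductor_bound_def
  proof (intro ballI impI)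
    fix f :: "complex fps ^ 'r" assume f: "f \<in> conv_ring" "\<forall>i. \<forall>k<c $ i. fps_nth (f $ i) k = 0"
    define g :: "complex fps ^ 'r" where "g = (\<chi> i. fps_shift (c $ i) (f $ i))"
    have "g \<in> conv_ring" using f by (simp add: g_def conv_ring_iff)
    moreover have "f = (\<chi> i. fps_X ^ (c $ i)) * g"
      using f(2) by (auto simp: vec_eq_iff g_def fps_eq_iff fps_X_power_mult_nth)
    ultimately have "f \<in> ?C" unfolding eqc by blast
    then show "f \<in> A" by (simp add: conductor_ideal_def)
  qed
  ultimately show ?thesis by simp
qed

section \<open>The local ring\<close>

lemma holomorphic_germ_add:
  assumes "holomorphic_germ f p" "holomorphic_germ g p"
  shows "holomorphic_germ (\<lambda>x. f x + g x) p"
proof -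
  obtain U V where UV: "open U" "p \<in> U" "mv_holomorphic_on f U" "open V" "p \<in> V" "mv_holomorphic_on g V"
    using assms by (auto simp: holomorphic_germ_def)
  have "mv_holomorphic_on (\<lambda>x. f x + g x) (U \<inter> V)"
    unfolding mv_holomorphic_on_def
  proof
    fix x assume x: "x \<in> U \<inter> V"
    obtain D where D: "(f has_derivative D) (at x)" "\<forall>c v. D (c *s v) = c * D v"
      using UV x by (auto simp: mv_holomorphic_on_def)
    obtain E where E: "(g has_derivative E) (at x)" "\<forall>c v. E (c *s v) = c * E v"
      using UV x by (auto simp: mv_holomorphic_on_def)
    show "\<exists>D. ((\<lambda>x. f x + g x) has_derivative D) (at x) \<and> (\<forall>c v. D (c *s v) = c * D v)"
      using has_derivative_add[OF D(1) E(1)] D(2) E(2)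
      by (intro exI[of _ "\<lambda>v. D v + E v"]) (simp add: distrib_left)
  qed
  then show ?thesis using UV by (auto simp: holomorphic_germ_def intro!: exI[of _ "U \<inter> V"])
qed

lemma holomorphic_germ_mult:
  assumes "holomorphic_germ f p" "holomorphic_germ g p"
  shows "holomorphic_germ (\<lambda>x. f x * g x) p"
proof -
  obtain U V where UV: "open U" "p \<in> U" "mv_holomorphic_on f U" "open V" "p \<in> V" "mv_holomorphic_on g V"
    using assms by (auto simp: holomorphic_germ_def)
  have "mv_holomorphic_on (\<lambda>x. f x * g x) (U \<inter> V)"
    unfolding mv_holomorphic_on_def
  proof
    fix x assume x: "x \<in> U \<inter> V"
    obtain D where D: "(f has_derivative D) (at x)" "\<forall>c v. D (c *s v) = c * D v"
      using UV x by (auto simp: mv_holomorphic_on_def)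
    obtain E where E: "(g has_derivative E) (at x)" "\<forall>c v. E (c *s v) = c * E v"
      using UV x by (auto simp: mv_holomorphic_on_def)
    show "\<exists>D. ((\<lambda>x. f x * g x) has_derivative D) (at x) \<and> (\<forall>c v. D (c *s v) = c * D v)"
      using has_derivative_mult[OF D(1) E(1)] D(2) E(2)
      by (intro exI[of _ "\<lambda>v. f x * E v + D v * g x"]) (simp add: algebra_simps)
  qed
  then show ?thesis using UV by (auto simp: holomorphic_germ_def intro!: exI[of _ "U \<inter> V"])
qed

lemma holomorphic_germ_const: "holomorphic_germ (\<lambda>x. c) p"
  by (auto simp: holomorphic_germ_def mv_holomorphic_on_def intro!: exI[of _ UNIV] exI[of _ "\<lambda>_. 0"])

text \<open>The derivative of \<open>H\<close> acts as multiplication by a complex number, so the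
  chain rule preserves complex linearity.\<close>

lemma holomorphic_germ_compose:
  assumes "holomorphic_germ f p" "H holomorphic_on V" "open V" "f p \<in> V"
  shows "holomorphic_germ (\<lambda>x. H (f x)) p"
proof -
  obtain U where U: "open U" "p \<in> U" "mv_holomorphic_on f U"
    using assms by (auto simp: holomorphic_germ_def)
  have "continuous_on U f"
    using U(1,3) by (auto simp: continuous_on_eq_continuous_at mv_holomorphic_on_def intro: has_derivative_continuous)
  then have op: "open (U \<inter> f -` V)" using U(1) assms(3) by (rule continuous_open_preimage)
  have "mv_holomorphic_on (\<lambda>x. H (f x)) (U \<inter> f -` V)"
    unfolding mv_holomorphic_on_def
  proof
    fix x assume x: "x \<in> U \<inter> f -` V"
    obtain D where D: "(f has_derivative D) (at x)" "\<forall>c v. D (c *s v) = c * D v"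
      using U x by (auto simp: mv_holomorphic_on_def)
    have "(H has_field_derivative deriv H (f x)) (at (f x))"
      using assms(2,3) x by (intro holomorphic_derivI) auto
    then have "(H has_derivative (\<lambda>y. deriv H (f x) * y)) (at (f x))"
      by (simp add: has_field_derivative_def)
    then have "((\<lambda>x. H (f x)) has_derivative (\<lambda>v. deriv H (f x) * D v)) (at x)"
      using diff_chain_at[OF D(1)] by (simp add: o_def)
    then show "\<exists>D. ((\<lambda>x. H (f x)) has_derivative D) (at x) \<and> (\<forall>c v. D (c *s v) = c * D v)"
      using D(2) by (intro exI[of _ "\<lambda>v. deriv H (f x) * D v"]) simp
  qed
  then show ?thesis using U op assms(4) by (auto simp: holomorphic_germ_def intro!: exI[of _ "U \<inter> f -` V"])
qed

lemma local_ring_conv: "local_ring p \<gamma> \<subseteq> conv_ring"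
  by (auto simp: local_ring_def conv_ring_iff has_fps_expansion_def)

lemma local_ring_add:
  assumes "F \<in> local_ring p \<gamma>" "G \<in> local_ring p \<gamma>"
  shows "F + G \<in> local_ring p \<gamma>"
proof -
  obtain f g where "holomorphic_germ f p" "\<forall>i. (\<lambda>t. f (\<gamma> i t)) has_fps_expansion F $ i"
    "holomorphic_germ g p" "\<forall>i. (\<lambda>t. g (\<gamma> i t)) has_fps_expansion G $ i"
    using assms by (auto simp: local_ring_def)
  then show ?thesis
    by (auto simp: local_ring_def intro!: exI[of _ "\<lambda>x. f x + g x"] holomorphic_germ_add has_fps_expansion_add)
qed

lemma local_ring_mult:
  assumes "F \<in> local_ring p \<gamma>" "G \<in> local_ring p \<gamma>"
  shows "F * G \<in> local_ring p \<gamma>"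
proof -
  obtain f g where "holomorphic_germ f p" "\<forall>i. (\<lambda>t. f (\<gamma> i t)) has_fps_expansion F $ i"
    "holomorphic_germ g p" "\<forall>i. (\<lambda>t. g (\<gamma> i t)) has_fps_expansion G $ i"
    using assms by (auto simp: local_ring_def)
  then show ?thesis
    by (auto simp: local_ring_def intro!: exI[of _ "\<lambda>x. f x * g x"] holomorphic_germ_mult has_fps_expansion_mult)
qed

lemma local_ring_const: "(\<chi> i. fps_const c) \<in> local_ring p \<gamma>"
  by (auto simp: local_ring_def intro!: exI[of _ "\<lambda>x. c"] holomorphic_germ_const)

lemma subspace_local_ring: "cv.subspace (local_ring p (\<gamma> :: 'r::finite \<Rightarrow> complex \<Rightarrow> complex ^ 'n))"
proof -
  have "(0 :: complex fps ^ 'r) = (\<chi> i. fps_const 0)" by (simp add: vec_eq_iff)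
  then have z: "0 \<in> local_ring p \<gamma>" using local_ring_const[of 0 p \<gamma>] by simp
  show ?thesis
    unfolding cv.subspace_def
    unfolding scl_eq_mult
    by (intro conjI ballI allI local_ring_add local_ring_mult local_ring_const z)
qed

lemma local_ring_1: "1 \<in> local_ring p \<gamma>"
proof -
  have "(1 :: complex fps ^ 'a) = (\<chi> i. fps_const 1)" by (simp add: vec_eq_iff)
  then show ?thesis using local_ring_const by metis
qed

lemma local_ring_sum:
  assumes "finite J" "\<And>j. j \<in> J \<Longrightarrow> F j \<in> local_ring p \<gamma>"
  shows "sum F J \<in> local_ring p \<gamma>"
  using assms cv.subspace_sum[OF subspace_local_ring] by blast

lemma local_ring_prod:
  assumes "finite J" "\<And>j. j \<in> J \<Longrightarrow> F j \<in> local_ring p \<gamma>"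
  shows "prod F J \<in> local_ring p \<gamma>"
  using assms by (induction J) (auto intro: local_ring_mult local_ring_1)

text \<open>Composing a germ that vanishes at \<open>p\<close> with a convergent series in one
  variable gives a germ again. So \<open>A\<close> contains all convergent series in a given element
  without constant terms.\<close>

lemma local_ring_compose:
  assumes \<gamma>: "\<And>i. \<gamma> i 0 = p" and F: "F \<in> local_ring p \<gamma>" "\<And>i. fps_nth (F $ i) 0 = 0"
    and h: "fps_conv_radius h > 0"
  shows "(\<chi> i. fps_compose h (F $ i)) \<in> local_ring p (\<gamma> :: 'r::finite \<Rightarrow> complex \<Rightarrow> complex ^ 'n)"
proof -
  obtain f where f: "holomorphic_germ f p" "\<And>i. (\<lambda>t. f (\<gamma> i t)) has_fps_expansion F $ i"
    using F(1) by (auto simp: local_ring_def)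
  \<comment> \<open>All branches pass through \<open>p\<close>, so the constant term in any one
    component is the value of \<open>f\<close> at \<open>p\<close>.\<close>
  have "f (\<gamma> undefined 0) = fps_nth (F $ undefined) 0"
    by (rule has_fps_expansion_imp_0_eq_fps_nth_0[OF f(2)])
  then have "f p = 0" unfolding F(2) \<gamma> .
  have H: "eval_fps h has_fps_expansion h" using h by (rule eval_fps_has_fps_expansion)
  then obtain V where V: "open V" "0 \<in> V" "eval_fps h holomorphic_on V"
    by (rule has_fps_expansion_imp_holomorphic)
  have "holomorphic_germ (\<lambda>x. eval_fps h (f x)) p"
    by (rule holomorphic_germ_compose[OF f(1) V(3,1)]) (simp add: V(2) \<open>f p = 0\<close>)
  moreover have "(\<lambda>t. eval_fps h (f (\<gamma> i t))) has_fps_expansion (\<chi> i. fps_compose h (F $ i)) $ i" for i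
    using has_fps_expansion_compose[OF H f(2)[of i] F(2)] by (simp add: o_def)
  ultimately show ?thesis by (auto simp: local_ring_def)
qed

section \<open>Existence of a conductor\<close>

text \<open>Taking an \<open>m\<close>-th root of a series of order \<open>m\<close> yields a new local coordinate, in which
  convergent series decompose according to residue classes of exponents.\<close>

lemma local_coordinate_root:
  fixes a :: "complex fps"
  assumes a: "fps_conv_radius a > 0" "a \<noteq> 0" "fps_nth a 0 = 0"
  shows "\<exists>S t. fps_conv_radius S > 0 \<and> fps_nth S 0 = 0 \<and> S ^ subdegree a = a \<and>
    t analytic_on {0} \<and> t 0 = 0 \<and> (\<forall>\<^sub>F w in nhds 0. t (eval_fps S w) = w)"
proof -
  define \<phi> where "\<phi> = eval_fps a"
  define m where "m = subdegree a"
  have \<phi>: "\<phi> has_fps_expansion a" unfolding \<phi>_def using a(1) by (rule eval_fps_has_fps_expansion)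
  then obtain V where V: "open V" "0 \<in> V" "\<phi> holomorphic_on V"
    by (rule has_fps_expansion_imp_holomorphic)
  have m: "0 < m" using a by (metis m_def gr0I nth_subdegree_nonzero)
  have d: "(deriv ^^ k) \<phi> 0 = fact k * fps_nth a k" for k
    using fps_nth_fps_expansion[OF \<phi>, of k] by simp
  have \<phi>0: "\<phi> 0 = 0" using d[of 0] a by simp
  \<comment> \<open>The order \<open>m\<close> of the zero allows an \<open>m\<close>-th root,
    namely \<open>w * g w\<close> with \<open>g\<close> nowhere zero. This root has nonzero
    derivative at 0 and so is a local coordinate.\<close>
  obtain g r where gr: "0 < r" "g holomorphic_on ball 0 r"
    "\<And>w. w \<in> ball 0 r \<Longrightarrow> \<phi> w - \<phi> 0 = ((w - 0) * g w) ^ m" "\<And>w. w \<in> ball 0 r \<Longrightarrow> g w \<noteq> 0"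
    by (rule holomorphic_factor_order_of_zero_strong[OF V(3,1,2) m])
       (use a(2) in \<open>auto simp: d m_def\<close>)
  define s where "s w = w * g w" for w
  have hs: "s holomorphic_on ball 0 r" unfolding s_def using gr(2) by (intro holomorphic_intros)
  have "g analytic_on {0}" using gr(1,2) by (auto simp: analytic_at intro!: exI[of _ "ball 0 r"])
  then obtain G where G: "g has_fps_expansion G" using analytic_at_imp_has_fps_expansion_0 by blast
  define S where "S = fps_X * G"
  have S: "s has_fps_expansion S" unfolding s_def S_def using G by (intro fps_expansion_intros)
  have "fps_nth S 1 = fps_nth G 0" by (simp add: S_def)
  also have "\<dots> \<noteq> 0" using has_fps_expansion_imp_0_eq_fps_nth_0[OF G] gr(4)[of 0] gr(1) by simp
  finally have ds: "deriv s 0 \<noteq> 0" using fps_nth_fps_expansion[OF S, of 1] by simp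
  have b: "0 \<in> ball (0::complex) r" "open (ball (0::complex) r)" using gr(1) by auto
  obtain r' where r': "r' > 0" "ball (0::complex) r' \<subseteq> ball 0 r" "inj_on s (ball 0 r')"
    by (rule has_complex_derivative_locally_injective[OF hs b ds]) (rule that)
  have hs': "s holomorphic_on ball 0 r'" by (rule holomorphic_on_subset[OF hs r'(2)])
  obtain t where t: "t holomorphic_on s ` ball 0 r'" "\<And>z. z \<in> ball 0 r' \<Longrightarrow> t (s z) = z"
    by (rule holomorphic_has_inverse[OF hs' open_ball r'(3)]) (rule that)
  have "open (s ` ball 0 r')" using hs' open_ball r'(3) by (rule open_mapping_thm3)
  moreover have s0: "s 0 = 0" by (simp add: s_def)
  then have "0 \<in> s ` ball 0 r'" using r'(1) by force
  ultimately have "t analytic_on {0}" using t(1) by (auto simp: analytic_at)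
  moreover have "t 0 = 0" using t(2)[of 0] s0 r'(1) by simp
  moreover have "S ^ m = a"
  proof -
    have "(\<lambda>w. s w ^ m) has_fps_expansion S ^ m" using S by (rule has_fps_expansion_power)
    moreover have "\<forall>\<^sub>F w in nhds 0. w \<in> ball 0 r" using gr(1) by (intro eventually_nhds_in_open) auto
    then have "\<forall>\<^sub>F w in nhds 0. s w ^ m = \<phi> w"
      by eventually_elim (use gr(3) \<phi>0 in \<open>auto simp: s_def\<close>)
    ultimately have "\<phi> has_fps_expansion S ^ m"
      using has_fps_expansion_cong[of "\<lambda>w. s w ^ m" \<phi> "S ^ m" "S ^ m"] by simp
    then show ?thesis by (rule fps_expansion_unique_complex[OF _ \<phi>])
  qed
  moreover have "\<forall>\<^sub>F w in nhds 0. t (eval_fps S w) = w"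
  proof -
    have "\<forall>\<^sub>F w in nhds 0. eval_fps S w = s w" using S by (simp add: has_fps_expansion_def)
    moreover have "\<forall>\<^sub>F w in nhds 0. w \<in> ball 0 r'" using r'(1) by (intro eventually_nhds_in_open) auto
    ultimately show ?thesis by eventually_elim (use t(2) in auto)
  qed
  moreover have "fps_nth S 0 = 0" by (simp add: S_def)
  moreover have "fps_conv_radius S > 0" using S by (simp add: has_fps_expansion_def)
  ultimately show ?thesis unfolding m_def by blast
qed

text \<open>At \<open>r ^ m\<close> the terms of the new series are, up to the factor
  \<open>r ^ j\<close>, a subfamily of the absolutely summable terms of \<open>h\<close> at
  \<open>r\<close>.\<close>

lemma fps_conv_radius_residue_class:
  fixes h :: "complex fps"
  assumes "fps_conv_radius h > 0" "m > 0"
  shows "fps_conv_radius (Abs_fps (\<lambda>k. fps_nth h (m * k + j))) > 0"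
proof -
  obtain r where r: "0 < ereal r" "ereal r < fps_conv_radius h" using ereal_dense2[OF assms(1)] by auto
  then have r0: "r > 0" by simp
  have "summable (\<lambda>n. norm (fps_nth h n * complex_of_real r ^ n))"
    using r r0 by (intro norm_summable_fps) simp
  moreover have "inj (\<lambda>k. m * k + j)" using assms(2) by (auto simp: inj_on_def)
  ultimately have "summable ((\<lambda>n. norm (fps_nth h n * complex_of_real r ^ n)) \<circ> (\<lambda>k. m * k + j))"
    by (rule summable_reindex) simp
  then have "summable (\<lambda>k. norm (fps_nth h (m * k + j) * complex_of_real r ^ (m * k + j)) / r ^ j)"
    by (intro summable_divide) (simp add: o_def)
  moreover have "norm (fps_nth h (m * k + j) * complex_of_real r ^ (m * k + j)) / r ^ j =
      norm (fps_nth h (m * k + j) * complex_of_real (r ^ m) ^ k)" for k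
    using r0 by (simp add: norm_mult norm_power power_add power_mult)
  ultimately have "summable (\<lambda>k. norm (fps_nth h (m * k + j) * complex_of_real (r ^ m) ^ k))" by simp
  then have "summable (\<lambda>k. fps_nth h (m * k + j) * complex_of_real (r ^ m) ^ k)" by (rule summable_norm_cancel)
  then have "conv_radius (\<lambda>k. fps_nth h (m * k + j)) \<ge> norm (complex_of_real (r ^ m))"
    by (rule conv_radius_geI)
  moreover have "ereal (norm (complex_of_real (r ^ m))) > 0" using r0 by simp
  ultimately have "conv_radius (\<lambda>k. fps_nth h (m * k + j)) > 0" by (rule less_le_trans[rotated])
  moreover have "fps_nth (Abs_fps (\<lambda>k. fps_nth h (m * k + j))) = (\<lambda>k. fps_nth h (m * k + j))"
    by (simp add: fun_eq_iff)
  ultimately show ?thesis by (simp only: fps_conv_radius_def)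
qed

lemma fps_residue_class_decomposition:
  fixes h :: "complex fps"
  assumes "m > 0"
  shows "h = (\<Sum>j<m. fps_X ^ j * fps_compose (Abs_fps (\<lambda>k. fps_nth h (m * k + j))) (fps_X ^ m))"
proof (rule fps_ext)
  fix n
  have "fps_nth (\<Sum>j<m. fps_X ^ j * fps_compose (Abs_fps (\<lambda>k. fps_nth h (m * k + j))) (fps_X ^ m)) n =
    (\<Sum>j<m. if n < j then 0 else if m dvd n - j then fps_nth h (m * ((n - j) div m) + j) else 0)"
    by (simp add: fps_sum_nth fps_X_power_mult_nth fps_nth_compose_X_power cong: if_cong)
  also have "\<dots> = (\<Sum>j<m. if j = n mod m then fps_nth h n else 0)"
  proof (rule sum.cong)
    fix j assume j: "j \<in> {..<m}"
    have "\<not> n < j \<and> m dvd n - j \<longleftrightarrow> j = n mod m"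
    proof
      assume "\<not> n < j \<and> m dvd n - j"
      then have "n mod m = j mod m" by (metis mod_eq_dvd_iff_nat not_less)
      then show "j = n mod m" using j by simp
    next
      assume "j = n mod m"
      then show "\<not> n < j \<and> m dvd n - j"
        by (simp add: dvd_minus_mod not_less)
    qed
    moreover have "m * ((n - j) div m) + j = n" if "\<not> n < j" "m dvd n - j" using that by simp
    ultimately show "(if n < j then 0 else if m dvd n - j then fps_nth h (m * ((n - j) div m) + j) else 0) =
      (if j = n mod m then fps_nth h n else 0)" by auto
  qed simp
  also have "\<dots> = fps_nth h n" using assms by simp
  finally show "fps_nth h n = fps_nth (\<Sum>j<m. fps_X ^ j * fps_compose (Abs_fps (\<lambda>k. fps_nth h (m * k + j))) (fps_X ^ m)) n"
    by simp
qed

text \<open>With \<open>S\<close> an \<open>m\<close>-th root of \<open>a\<close>, where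
  \<open>m\<close> is the order of \<open>a\<close>, a convergent \<open>G\<close> becomes a
  convergent series in \<open>S\<close>. Collecting exponents modulo \<open>m\<close> makes it a
  combination of the powers of \<open>S\<close> below \<open>m\<close> with coefficients that are
  series in \<open>a\<close>.\<close>

lemma finite_module_generators:
  fixes a :: "complex fps"
  assumes a: "fps_conv_radius a > 0" "a \<noteq> 0" "fps_nth a 0 = 0"
  shows "\<exists>S. fps_conv_radius S > 0 \<and> (\<forall>G. fps_conv_radius G > 0 \<longrightarrow>
    (\<exists>h. (\<forall>j. fps_conv_radius (h j) > 0) \<and> G = (\<Sum>j<subdegree a. S ^ j * fps_compose (h j) a)))"
proof -
  obtain S t where S: "fps_conv_radius S > 0" "fps_nth S 0 = 0" "S ^ subdegree a = a"
    and t: "t analytic_on {0}" "t 0 = 0" "\<forall>\<^sub>F w in nhds 0. t (eval_fps S w) = w"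
    using local_coordinate_root[OF a] by blast
  define m where "m = subdegree a"
  have m: "0 < m" using a by (metis m_def gr0I nth_subdegree_nonzero)
  have "\<exists>h. (\<forall>j. fps_conv_radius (h j) > 0) \<and> G = (\<Sum>j<m. S ^ j * fps_compose (h j) a)"
    if G: "fps_conv_radius G > 0" for G
  proof -
    have eG: "eval_fps G has_fps_expansion G" using G by (rule eval_fps_has_fps_expansion)
    have "eval_fps G analytic_on (t ` {0})"
      using has_fps_expansion_imp_analytic_0[OF eG] t(2) by simp
    with t(1) have "(eval_fps G \<circ> t) analytic_on {0}" by (rule analytic_on_compose)
    then obtain H where H: "(eval_fps G \<circ> t) has_fps_expansion H" using analytic_at_imp_has_fps_expansion_0 by blast
    have eS: "eval_fps S has_fps_expansion S" using S(1) by (rule eval_fps_has_fps_expansion)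
    have "(eval_fps G \<circ> t \<circ> eval_fps S) has_fps_expansion fps_compose H S"
      by (rule has_fps_expansion_compose[OF H eS S(2)])
    moreover have "\<forall>\<^sub>F w in nhds 0. (eval_fps G \<circ> t \<circ> eval_fps S) w = eval_fps G w"
      using t(3) by eventually_elim simp
    ultimately have "eval_fps G has_fps_expansion fps_compose H S"
      using has_fps_expansion_cong[of "eval_fps G \<circ> t \<circ> eval_fps S" "eval_fps G" "fps_compose H S"]
      by simp
    then have GH: "G = fps_compose H S" by (rule fps_expansion_unique_complex[OF eG])
    define h where "h j = Abs_fps (\<lambda>k. fps_nth H (m * k + j))" for j
    have "fps_conv_radius H > 0" using H by (simp add: has_fps_expansion_def)
    then have hr: "fps_conv_radius (h j) > 0" for j
      unfolding h_def using m by (rule fps_conv_radius_residue_class)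
    have Xm: "fps_nth (fps_X ^ m :: complex fps) 0 = 0" using m by simp
    have "H = (\<Sum>j<m. fps_X ^ j * fps_compose (h j) (fps_X ^ m))"
      unfolding h_def by (rule fps_residue_class_decomposition[OF m])
    then have "fps_compose H S = fps_compose (\<Sum>j<m. fps_X ^ j * fps_compose (h j) (fps_X ^ m)) S"
      by (rule arg_cong[where f = "\<lambda>H. fps_compose H S"])
    also have "\<dots> = (\<Sum>j<m. fps_compose (fps_X ^ j) S * fps_compose (fps_compose (h j) (fps_X ^ m)) S)"
      by (simp add: fps_compose_sum_distrib fps_compose_mult_distrib[OF S(2)])
    also have "\<dots> = (\<Sum>j<m. S ^ j * fps_compose (h j) a)"
      using S(3) by (simp add: fps_X_power_compose[OF S(2)] m_def
        flip: fps_compose_assoc[OF S(2) Xm[unfolded m_def]])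
    finally show ?thesis using hr GH by blast
  qed
  then show ?thesis using S(1) unfolding m_def by blast
qed

text \<open>For each component \<open>i\<close> an element \<open>a\<close> of \<open>A\<close>
  concentrated there is found. Convergent series in the \<open>i\<close>-th variable are generated
  by finitely many powers over the series in \<open>a\<close>, and the latter come from
  \<open>A\<close>; a common denominator of these generators therefore works for the whole
  component.\<close>

theorem conductor_element_exists:
  fixes \<gamma> :: "'r::finite \<Rightarrow> complex \<Rightarrow> complex ^ 'n"
  assumes norm: "is_normalization C p \<gamma>"
  defines "A \<equiv> local_ring p \<gamma>"
  shows "\<exists>B\<in>A. (\<forall>i. B $ i \<noteq> 0) \<and> (\<forall>g\<in>conv_ring. B * g \<in> A)"
proof -
  have \<gamma>0: "\<gamma> i 0 = p" for i using norm by (simp add: is_normalization_def)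
  have den: "\<exists>b\<in>A. (\<forall>i. b $ i \<noteq> 0) \<and> b * x \<in> A" if "x \<in> conv_ring" for x
  proof -
    have "laurent_embed x \<in> integral_closure (laurent_embed ` A)"
      using norm that by (simp add: is_normalization_def A_def)
    then obtain a b where ab: "a \<in> A" "b \<in> A" "\<forall>i. laurent_embed b $ i \<noteq> 0"
      "laurent_embed b * laurent_embed x = laurent_embed a"
      by (auto simp: integral_closure_def total_fractions_def)
    have "b * x = a" using ab(4) by (simp add: vec_eq_iff laurent_embed_def flip: fls_times_fps_to_fls)
    moreover have "\<forall>i. b $ i \<noteq> 0" using ab(3) by (auto simp: laurent_embed_def)
    ultimately show ?thesis using ab by blast
  qed
  have common: "\<exists>b\<in>A. (\<forall>i. b $ i \<noteq> 0) \<and> (\<forall>x\<in>X. b * x \<in> A)" if "finite X" "X \<subseteq> conv_ring" for X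
    using that
  proof (induction X)
    case empty
    then show ?case using local_ring_1 unfolding A_def by (intro bexI[of _ 1]) auto
  next
    case (insert x X)
    then obtain b where b: "b \<in> A" "\<forall>i. b $ i \<noteq> 0" "\<forall>x\<in>X. b * x \<in> A" by auto
    obtain b' where b': "b' \<in> A" "\<forall>i. b' $ i \<noteq> 0" "b' * x \<in> A" using den[of x] insert by auto
    have "b * b' * y \<in> A" if y: "y \<in> insert x X" for y
    proof -
      consider "y = x" | "y \<in> X" using y by auto
      then show ?thesis
      proof cases
        case 1
        then show ?thesis using local_ring_mult[of b p \<gamma> "b' * x"] b b' by (simp add: A_def mult.assoc)
      next
        case 2
        then have "b * y \<in> A" using b by auto
        then show ?thesis using local_ring_mult[of b' p \<gamma> "b * y"] b' by (simp add: A_def ac_simps)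
      qed
    qed
    moreover have "b * b' \<in> A" using b b' local_ring_mult by (simp add: A_def)
    ultimately show ?case using b b' by (intro bexI[of _ "b * b'"]) auto
  qed
  have "\<exists>b\<in>A. (\<forall>j. b $ j \<noteq> 0) \<and> (\<forall>g. fps_conv_radius g > 0 \<longrightarrow> b * evec i g \<in> A)" for i
  proof -
    have "evec i fps_X \<in> conv_ring" by (rule conv_ring_evec) simp
    then obtain b where b: "b \<in> A" "\<forall>i. b $ i \<noteq> 0" "b * evec i fps_X \<in> A" using den by blast
    \<comment> \<open>Clearing the denominator of the \<open>i\<close>-th variable gives an element
      of \<open>A\<close> without constant term that is nonzero in component \<open>i\<close> and
      zero in all others.\<close>
    define a where "a = b * evec i fps_X"
    have a: "a \<in> A" "a $ i = b $ i * fps_X" "\<And>j. j \<noteq> i \<Longrightarrow> a $ j = 0" using b by (auto simp: a_def)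
    have a0: "fps_nth (a $ j) 0 = 0" for j using a(2) a(3)[of j] by (cases "j = i") auto
    have "fps_conv_radius (a $ i) > 0" using a(1) local_ring_conv[of p \<gamma>] by (auto simp: A_def conv_ring_iff)
    moreover have "a $ i \<noteq> 0" unfolding a(2) using b(2) by simp
    ultimately obtain S where S: "fps_conv_radius S > 0"
      and gen: "\<forall>G. fps_conv_radius G > 0 \<longrightarrow> (\<exists>h. (\<forall>j. fps_conv_radius (h j) > 0) \<and>
        G = (\<Sum>j<subdegree (a $ i). S ^ j * fps_compose (h j) (a $ i)))"
      using finite_module_generators[OF _ _ a0] by blast
    let ?X = "(\<lambda>j. evec i (S ^ j)) ` {..<subdegree (a $ i)}"
    have "?X \<subseteq> conv_ring"
      using S fps_conv_radius_power[of S] by (auto intro!: conv_ring_evec intro: less_le_trans)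
    then obtain d where d: "d \<in> A" "\<forall>i. d $ i \<noteq> 0" "\<forall>x\<in>?X. d * x \<in> A" using common[of ?X] by auto
    have "d * evec i g \<in> A" if g: "fps_conv_radius g > 0" for g
    proof -
      obtain h where h: "\<And>j. fps_conv_radius (h j) > 0"
        "g = (\<Sum>j<subdegree (a $ i). S ^ j * fps_compose (h j) (a $ i))" using gen g by blast
      \<comment> \<open>In the components other than \<open>i\<close> the substituted series reduces
        to its constant term, which the factor \<open>evec i (S ^ j)\<close> annihilates.\<close>
      have "(\<Sum>j<subdegree (a $ i). (d * evec i (S ^ j)) * (\<chi> k. fps_compose (h j) (a $ k))) \<in> A"
        unfolding A_def
      proof (rule local_ring_sum)
        fix j assume "j \<in> {..<subdegree (a $ i)}"
        then have "d * evec i (S ^ j) \<in> local_ring p \<gamma>" using d(3) by (auto simp: A_def)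
        moreover have "(\<chi> k. fps_compose (h j) (a $ k)) \<in> local_ring p \<gamma>"
          by (rule local_ring_compose[OF \<gamma>0 a(1)[unfolded A_def] a0 h(1)])
        ultimately show "(d * evec i (S ^ j)) * (\<chi> k. fps_compose (h j) (a $ k)) \<in> local_ring p \<gamma>"
          by (rule local_ring_mult)
      qed simp
      also have "(\<Sum>j<subdegree (a $ i). (d * evec i (S ^ j)) * (\<chi> k. fps_compose (h j) (a $ k))) = d * evec i g"
        unfolding vec_eq_iff
      proof
        fix k
        show "(\<Sum>j<subdegree (a $ i). (d * evec i (S ^ j)) * (\<chi> k. fps_compose (h j) (a $ k))) $ k = (d * evec i g) $ k"
          by (cases "k = i") (simp_all add: h(2) sum_distrib_left mult.assoc)
      qed
      finally show ?thesis .
    qed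
    then show ?thesis using d by blast
  qed
  then obtain b where b: "\<And>i. b i \<in> A" "\<And>i j. b i $ j \<noteq> 0"
    "\<And>i g. fps_conv_radius g > 0 \<Longrightarrow> b i * evec i g \<in> A" by metis
  \<comment> \<open>Component \<open>i\<close> of \<open>g\<close> is absorbed by its own factor
    \<open>b i\<close>; the remaining factors merely multiply by elements of
    \<open>A\<close>.\<close>
  define B where "B = prod b UNIV"
  have "B \<in> A" unfolding B_def A_def using b(1) by (intro local_ring_prod) (auto simp: A_def)
  moreover have nth: "prod b J $ j = (\<Prod>i\<in>J. b i $ j)" for J j
    by (induction J rule: infinite_finite_induct) auto
  have "B $ j \<noteq> 0" for j unfolding B_def nth using b(2) by simp
  moreover have "B * g \<in> A" if g: "g \<in> conv_ring" for g
  proof -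
    have "B * evec i (g $ i) \<in> A" for i
    proof -
      have "prod b (UNIV - {i}) \<in> A"
        unfolding A_def by (rule local_ring_prod) (use b(1) in \<open>auto simp: A_def\<close>)
      moreover have "b i * evec i (g $ i) \<in> A" using b(3) g by (simp add: conv_ring_iff)
      ultimately have "prod b (UNIV - {i}) * (b i * evec i (g $ i)) \<in> A"
        unfolding A_def by (rule local_ring_mult)
      moreover have "B = b i * prod b (UNIV - {i})" unfolding B_def by (rule prod.remove) auto
      ultimately show ?thesis by (simp add: ac_simps)
    qed
    then have "(\<Sum>i\<in>UNIV. B * evec i (g $ i)) \<in> A"
      unfolding A_def by (intro local_ring_sum) auto
    also have "(\<Sum>i\<in>UNIV. B * evec i (g $ i)) = B * g"
      by (simp only: evec_sum flip: sum_distrib_left)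
    finally show ?thesis .
  qed
  ultimately show ?thesis by blast
qed

section \<open>The limit of the spectral sequence\<close>

lemma group_rank_quotient:
  assumes G: "comm_group G" "finite_rank G" and K: "subgroup K G" and L: "subgroup L G" "L \<subseteq> K"
  shows "group_rank (subgroup_generated G K) =
    group_rank (subgroup_generated G K Mod L) + group_rank (subgroup_generated G L)"
proof -
  interpret G: comm_group G by fact
  let ?K = "subgroup_generated G K" and ?L = "subgroup_generated G L"
  have cK: "carrier ?K = K" by (rule subgroup.carrier_subgroup_generated_subgroup[OF K])
  have cL: "carrier ?L = L" by (rule subgroup.carrier_subgroup_generated_subgroup[OF L(1)])
  have ab: "comm_group ?K" "comm_group ?L" by (simp_all add: G.abelian_subgroup_generated G(1))
  interpret K: comm_group ?K by fact
  have LK: "subgroup L ?K" by (rule G.subgroup_of_subgroup_generated[OF L(2,1)])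
  have Q: "comm_group (?K Mod L)" by (rule K.abelian_FactGroup[OF LK])
  have nL: "L \<lhd> ?K" using LK by (simp add: K.normal_iff_subgroup)
  have hom: "id \<in> hom ?L ?K" "id \<in> hom ?K G" "id \<in> hom ?L G"
    using L subgroup.subset[OF K] by (auto simp: hom_def cK cL)
  have fr: "finite_rank ?K" "finite_rank ?L"
    using finite_rank_injective[OF ab(1) G(1) hom(2) _ G(2)] finite_rank_injective[OF ab(2) G(1) hom(3) _ G(2)]
    by simp_all
  have q: "(\<lambda>a. L #>\<^bsub>?K\<^esub> a) \<in> hom ?K (?K Mod L)" by (rule normal.r_coset_hom_Mod[OF nL])
  have im: "(\<lambda>a. L #>\<^bsub>?K\<^esub> a) ` carrier ?K = carrier (?K Mod L)" by (simp add: carrier_FactGroup)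
  have frQ: "finite_rank (?K Mod L)" by (rule finite_rank_surjective[OF ab(1) Q q im fr(1)])
  have "group_rank ?K = group_rank ?L + group_rank (?K Mod L)"
  proof (rule group_rank_exact(2)[OF ab(2,1) Q hom(1) _ q im _ fr(2) frQ])
    show "id ` carrier ?L = {x \<in> carrier ?K. L #>\<^bsub>?K\<^esub> x = \<one>\<^bsub>?K Mod L\<^esub>}"
    proof (intro equalityI subsetI)
      fix x assume "x \<in> id ` carrier ?L"
      then have "x \<in> L" "x \<in> carrier ?K" using L(2) by (auto simp: cL cK)
      then show "x \<in> {x \<in> carrier ?K. L #>\<^bsub>?K\<^esub> x = \<one>\<^bsub>?K Mod L\<^esub>}"
        using K.coset_join2[OF _ LK] by simp
    next
      fix x assume "x \<in> {x \<in> carrier ?K. L #>\<^bsub>?K\<^esub> x = \<one>\<^bsub>?K Mod L\<^esub>}"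
      then have "L #>\<^bsub>?K\<^esub> x = L" "x \<in> carrier ?K" by auto
      then show "x \<in> id ` carrier ?L" using K.coset_join1[OF _ _ LK] by (simp add: cL)
    qed
  qed simp
  then show ?thesis by simp
qed

text \<open>The limit terms are the graded pieces of the filtration of
  \<open>H\<^sub>b(S\<^sub>n)\<close> by images. Additivity of ranks telescopes their sum from the
  whole group at \<open>d = 0\<close> to the trivial image at \<open>D\<close>, where the subspace
  is empty.\<close>

lemma E_infinity_rank_sum:
  fixes A :: "(complex fps ^ 'r::finite) set"
  assumes fin: "finite_rank (homology_group (int b) (top_of_set (sublevel A n)))"
    and D: "\<And>d. d \<ge> D \<Longrightarrow> sublevel A n \<inter> level_space d = {}"
  shows "(\<Sum>d<D. group_rank (E_infinity A d (int b + int d) n)) =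
      group_rank (homology_group (int b) (top_of_set (sublevel A n)))"
    and "d \<ge> D \<Longrightarrow> group_rank (E_infinity A d (int b + int d) n) = 0"
proof -
  let ?S = "sublevel A n"
  let ?X = "top_of_set ?S"
  let ?G = "homology_group (int b) ?X"
  let ?Y = "\<lambda>d. top_of_set (?S \<inter> level_space d)"
  let ?f = "\<lambda>d. hom_induced (int b) (?Y d) {} ?X {} id"
  define F where "F d = ?f d ` carrier (homology_group (int b) (?Y d))" for d
  define R where "R d = group_rank (subgroup_generated ?G (F d))" for d
  have E: "E_infinity A d (int b + int d) n = subgroup_generated ?G (F d) Mod F (Suc d)" for d
    by (simp add: E_infinity_def homology_filtration_def F_def Let_def)
  have sub: "subgroup (F d) ?G" for d
    unfolding F_def
    by (intro group_hom.img_is_subgroup) (simp add: group_hom_def group_hom_axioms_def hom_induced_empty_hom)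
  \<comment> \<open>The inclusion of the smaller subspace factors through the larger one, so
    functoriality nests the images.\<close>
  have decr: "F (Suc d) \<subseteq> F d" for d
  proof -
    have lev: "level_space (Suc d) \<subseteq> (level_space d :: (real ^ 'r) set)"
      unfolding level_space_def using Suc_leD by blast
    have c1: "continuous_map (?Y (Suc d)) (?Y d) id" using lev by (auto simp: continuous_on_id)
    have c2: "continuous_map (?Y d) ?X id" by (auto simp: continuous_on_id)
    have "?f (Suc d) = ?f d \<circ> hom_induced (int b) (?Y (Suc d)) {} (?Y d) {} id"
      using hom_induced_compose_empty[OF c1 c2, of "int b"] by simp
    then show ?thesis unfolding F_def using hom_induced_carrier by fastforce
  qed
  have step: "R d = group_rank (E_infinity A d (int b + int d) n) + R (Suc d)" for d
    unfolding R_def E by (rule group_rank_quotient[OF _ fin sub sub decr]) simp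
  have R0: "R 0 = group_rank ?G"
  proof -
    have "?S \<inter> level_space 0 = ?S" using sublevel_subset_level_space_0 by blast
    then have "F 0 = (\<lambda>x. x) ` carrier ?G" unfolding F_def by (intro image_cong) (auto simp: hom_induced_id)
    then show ?thesis unfolding R_def by (simp add: group.subgroup_generated_group_carrier)
  qed
  have R_large: "R d = 0" if "d \<ge> D" for d
  proof -
    have "trivial_group (homology_group (int b) (?Y d))"
      by (intro trivial_homology_group_empty) (simp add: D[OF that])
    then have "carrier (homology_group (int b) (?Y d)) = {\<one>\<^bsub>homology_group (int b) (?Y d)\<^esub>}"
      by (simp only: trivial_group_def)
    moreover have "?f d \<one>\<^bsub>homology_group (int b) (?Y d)\<^esub> = \<one>\<^bsub>?G\<^esub>"
      by (rule hom_one[OF hom_induced_empty_hom]) simp_all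
    ultimately have "F d = {\<one>\<^bsub>?G\<^esub>}" by (simp only: F_def image_insert image_empty)
    then have "carrier (subgroup_generated ?G (F d)) = {\<one>\<^bsub>?G\<^esub>}"
      using subgroup.carrier_subgroup_generated_subgroup[OF sub[of d]] by simp
    then have "trivial_group (subgroup_generated ?G (F d))"
      by (simp only: trivial_group_def one_subgroup_generated group.group_subgroup_generated
          group_relative_homology_group simp_thms)
    then show ?thesis unfolding R_def by (rule trivial_group_rank(2))
  qed
  have "R 0 = (\<Sum>d<k. group_rank (E_infinity A d (int b + int d) n)) + R k" for k
  proof (induction k)
    case (Suc k)
    then show ?case using step[of k] by simp
  qed simp
  from this[of D] show "(\<Sum>d<D. group_rank (E_infinity A d (int b + int d) n)) = group_rank ?G"
    using R0 R_large[of D] by simp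
  show "group_rank (E_infinity A d (int b + int d) n) = 0" if "d \<ge> D"
    using step[of d] R_large[of d] that by simp
qed

section \<open>Coefficients and values of Laurent series\<close>

lemma fls_nth_map_fls:
  assumes "g 0 = 0"
  shows "fls_nth (map_fls g F) n = g (fls_nth F n)"
  unfolding map_fls_def
proof (rule nth_Abs_fls_ex_lower_bound)
  \<comment> \<open>\<open>Abs_fls\<close> has the prescribed coefficients if these vanish below
    some index; \<open>g 0 = 0\<close> keeps the bound valid for \<open>F\<close>.\<close>
  show "\<exists>N. \<forall>n<N. g (fls_nth F n) = 0"
    using assms by (intro exI[of _ "fls_subdegree F"]) simp
qed

lemma coeff_Sum_any_monom:
  fixes f :: "nat \<Rightarrow> 'a::comm_semiring_1"
  assumes "\<And>b. b \<ge> N \<Longrightarrow> f b = 0"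
  shows "Sum_any (\<lambda>b. Polynomial.monom (f b) b) = (\<Sum>b<N. Polynomial.monom (f b) b)"
    and "poly.coeff (Sum_any (\<lambda>b. Polynomial.monom (f b) b)) k = f k"
    and "poly (Sum_any (\<lambda>b. Polynomial.monom (f b) b)) x = (\<Sum>b<N. f b * x ^ b)"
proof -
  show eq: "Sum_any (\<lambda>b. Polynomial.monom (f b) b) = (\<Sum>b<N. Polynomial.monom (f b) b)"
  proof (rule Sum_any.expand_superset)
    show "{b. Polynomial.monom (f b) b \<noteq> 0} \<subseteq> {..<N}"
    proof
      fix b assume "b \<in> {b. Polynomial.monom (f b) b \<noteq> 0}"
      then have "f b \<noteq> 0" by auto
      then show "b \<in> {..<N}" using assms[of b] by (metis lessThan_iff not_less)
    qed
  qed simp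
  show "poly.coeff (Sum_any (\<lambda>b. Polynomial.monom (f b) b)) k = f k"
    unfolding eq using assms[of k] by (simp add: coeff_sum)
  show "poly (Sum_any (\<lambda>b. Polynomial.monom (f b) b)) x = (\<Sum>b<N. f b * x ^ b)"
    unfolding eq by (simp add: poly_sum poly_monom)
qed

text \<open>Factoring out a power of the variable leaves a polynomial, whose value at 1 is the sum
  of the coefficients. The limit is taken where the variable is nonzero, so that negative powers
  cause no harm.\<close>

lemma eval_laurent_polynomial:
  fixes F :: "complex fls"
  assumes "\<And>n. n < m \<Longrightarrow> fls_nth F n = 0" "\<And>n. n \<ge> N \<Longrightarrow> fls_nth F n = 0"
  shows "(eval_fls F \<longlongrightarrow> (\<Sum>n\<in>{m..<N}. fls_nth F n)) (at 1)"
proof -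
  define M where "M = nat (N - m)"
  define P where "P = (\<Sum>k<M. Polynomial.monom (fls_nth F (m + int k)) k)"
  have cP: "poly.coeff P k = fls_nth F (m + int k)" for k
  proof (cases "k < M")
    case False
    then have "N \<le> m + int k" by (simp add: M_def)
    then show ?thesis using False assms(2) by (simp add: P_def coeff_sum)
  qed (simp add: P_def coeff_sum)
  have F: "F = fls_shift (- m) (fps_to_fls (fps_of_poly P))"
  proof (rule fls_eqI)
    fix n
    show "fls_nth F n = fls_nth (fls_shift (- m) (fps_to_fls (fps_of_poly P))) n"
      using assms(1)[of n] cP[of "nat (n - m)"] by (cases "n < m") simp_all
  qed
  have ev: "eval_fls F z = poly P z * z powi m" if "z \<noteq> 0" for z
    unfolding F using that by (simp add: eval_fls_shift eval_fps_to_fls power_int_minus field_simps)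
  have "poly P 1 = (\<Sum>k<M. fls_nth F (m + int k))" by (simp add: P_def poly_sum poly_monom)
  also have "\<dots> = (\<Sum>n\<in>{m..<N}. fls_nth F n)"
    by (rule sum.reindex_bij_witness[of _ "\<lambda>n. nat (n - m)" "\<lambda>k. m + int k"]) (auto simp: M_def)
  finally have P1: "poly P 1 * 1 powi m = (\<Sum>n\<in>{m..<N}. fls_nth F n)" by simp
  have lim: "((\<lambda>z. poly P z * z powi m) \<longlongrightarrow> poly P 1 * 1 powi m) (at 1)"
    using poly_isCont[of 1 P] unfolding isCont_def
    by (intro tendsto_mult tendsto_power_int tendsto_ident_at) simp_all
  have "\<forall>\<^sub>F z in at (1::complex). z \<in> - {0}"
    by (rule eventually_at_in_open') auto
  then have "\<forall>\<^sub>F z in at 1. poly P z * z powi m = eval_fls F z"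
    by (rule eventually_mono) (simp add: ev)
  from Lim_transform_eventually[OF lim this] show ?thesis unfolding P1 .
qed

lemma cube_subset_rectangle_iff:
  fixes c :: "int ^ 'r::finite"
  assumes "\<And>i. 0 \<le> c $ i"
  shows "cube l I \<subseteq> rectangle c \<longleftrightarrow> (l, I) \<in> cells 0 (\<chi> i. nat (c $ i))"
proof
  assume sub: "cube l I \<subseteq> rectangle c"
  \<comment> \<open>The highest vertex alone tests whether the cube respects the upper corner of the
    rectangle.\<close>
  have "(\<chi> i. real (vertex l I $ i)) \<in> cube l I" by (simp add: cube_def)
  then have "(\<chi> i. real (vertex l I $ i)) \<in> rectangle c" using sub by blast
  then have le: "real (vertex l I $ i) \<le> of_int (c $ i)" for i
    unfolding rectangle_def by (simp del: vertex_nth)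
  have "vertex l I $ i \<le> nat (c $ i)" for i
    using le[of i] by linarith
  then show "(l, I) \<in> cells 0 (\<chi> i. nat (c $ i))" by (simp add: cells_def del: vertex_nth)
next
  assume cl: "(l, I) \<in> cells 0 (\<chi> i. nat (c $ i))"
  show "cube l I \<subseteq> rectangle c"
  proof
    fix x assume "x \<in> cube l I"
    then have "\<forall>i. real (l $ i) \<le> x $ i \<and> x $ i \<le> real (l $ i) + (if i \<in> I then 1 else 0)"
      unfolding cube_def mem_Collect_eq .
    moreover have "real (vertex l I $ i) = real (l $ i) + (if i \<in> I then 1 else 0)" for i by simp
    ultimately have x: "real (l $ i) \<le> x $ i" "x $ i \<le> real (vertex l I $ i)" for i
      by (simp_all only:)
    have "0 \<le> x $ i \<and> x $ i \<le> of_int (c $ i)" for i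
    proof -
      have "vertex l I $ i \<le> nat (c $ i)" using cl by (simp add: cells_def del: vertex_nth)
      then have "real (vertex l I $ i) \<le> of_int (c $ i)"
        using assms[of i] by linarith
      moreover have "0 \<le> real (l $ i)" by simp
      ultimately show ?thesis using x[of i] by linarith
    qed
    then show "x \<in> rectangle c" by (simp add: rectangle_def)
  qed
qed

theorem theorem1p2p1:
  fixes C :: "(complex ^ 'n) set" and p :: "complex ^ 'n"
    and \<gamma> :: "'r::finite \<Rightarrow> complex \<Rightarrow> complex ^ 'n"
    and A :: "(complex fps ^ 'r) set"
  assumes "isolated_curve_singularity C p"
    and "is_normalization C p \<gamma>"
    and "A = local_ring p \<gamma>"
  shows "
     \<comment> \<open>(a)\<close>
     (subst_T 1 (PE_infinity A) =
        Abs_fls (\<lambda>n. if n \<ge> min_weight A then homology_poly (sublevel A n) else 0) \<and>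
      subst_T 1 (PE_infinity A) = lattice_homology_series A) \<and>
     \<comment> \<open>(b)\<close>
     (subst_h (-1) (subst_T 1 (PE_infinity A)) =
        Abs_fls (\<lambda>n. if n \<ge> min_weight A then euler_char (sublevel A n) else 0)) \<and>
     \<comment> \<open>(c)\<close>
     (\<forall>c' :: int ^ 'r. (\<forall>i. int (conductor A $ i) \<le> c' $ i) \<longrightarrow>
        subst_h (-1) (subst_T 1 (PE_infinity A)) =
        geometric_fls *
          (\<Sum>(l, I) \<in> {(l, I). cube l I \<subseteq> rectangle c'}. (-1) ^ card I * fls_X_intpow (cube_weight A l I))) \<and>
     \<comment> \<open>(d)\<close>
     ((eval_fls (map_fls of_int (subst_h (-1) (subst_T 1 (PE_infinity A)) - geometric_fls))
         \<longlongrightarrow> of_int (lattice_eu A)) (at 1) \<and>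
      lattice_eu A = int (delta_invariant A)) \<and>
     \<comment> \<open>(e)\<close>
     (coeffs_ge (subst_T 1 (PE_infinity A)) (const_h (subst_h 0 (subst_T 1 (PE_infinity A)))) \<and>
      coeffs_ge (const_h (subst_h 0 (subst_T 1 (PE_infinity A)))) (const_h geometric_fls) \<and>
      finite {n. fls_nth (subst_h 0 (subst_T 1 (PE_infinity A)) - geometric_fls) n \<noteq> 0})"
proof -

  \<comment> \<open>The conductor and finiteness of the ranks\<close>
  let ?c = "conductor A"
  have sub: "cv.subspace A" and conv: "A \<subseteq> conv_ring"
    unfolding assms(3) by (rule subspace_local_ring, rule local_ring_conv)
  obtain B where B: "B \<in> A" "\<forall>i. B $ i \<noteq> 0" "\<forall>g\<in>conv_ring. B * g \<in> A"
    using conductor_element_exists[OF assms(2)] unfolding assms(3) by blast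
  have cb: "conductor_bound A ?c"
    by (rule conductor_bound_conductor[OF sub conv B(1)]) (use B in auto)
  have ws: "weight_stable A ?c" by (rule conductor_bound_weight_stable[OF sub cb])
  define H where "H b n = group_rank (homology_group (int b) (top_of_set (sublevel A n)))" for b :: nat and n
  define ec where "ec n = euler_char (sublevel A n)" for n
  have ft: "finite_type (top_of_set (sublevel A n)) {}" for n
    by (rule sublevel_euler_char(1)[OF ws order_refl])
  have fr: "finite_rank (homology_group p (top_of_set (sublevel A n)))" for p n
    using ft by (simp add: finite_type_def)
  have "\<forall>n. \<exists>N. \<forall>b\<ge>N. H b n = 0" using ft by (simp add: finite_type_def H_def)
  then obtain NB where NB: "\<And>n b. b \<ge> NB n \<Longrightarrow> H b n = 0" by metis
  have ec_rel: "ec n = rel_euler_char (top_of_set (sublevel A n)) {}" for n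
    by (simp add: ec_def euler_char_def rel_euler_char_def)
  have ec_sum: "ec n = (\<Sum>b<N. (-1) ^ b * int (H b n))" if "N \<ge> NB n" for n N
    unfolding ec_rel H_def by (rule rel_euler_char_eq) (use NB[of n] that in \<open>auto simp: H_def\<close>)
  have ec_cells: "ec n = (\<Sum>(l, I)\<in>cells 0 c'. if cube_weight A l I \<le> n then (-1) ^ card I else 0)"
    if "\<And>i. ?c $ i \<le> c' $ i" for n c'
    unfolding ec_rel by (rule sublevel_euler_char(2)[OF ws that])

  \<comment> \<open>The minimal weight and the empty levels below it\<close>
  have w0: "weight A 0 = 0" using hilbert_fun_0[OF sub] by (simp add: weight_def abs_sum_def)
  have fin0: "finite {v. weight A v \<le> 0}" by (rule finite_weight_le[OF ws])
  have m_min: "\<exists>v. min_weight A = weight A v" "\<And>l. min_weight A \<le> weight A l"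
  proof -
    have ne: "weight A ` {v. weight A v \<le> 0} \<noteq> {}" using w0 by (metis empty_iff image_is_empty mem_Collect_eq order_refl)
    \<comment> \<open>The infimum over infinitely many lattice points is attained on the finite set
      of weight at most 0, which contains the origin.\<close>
    define m where "m = Min (weight A ` {v. weight A v \<le> 0})"
    have m: "m \<in> weight A ` {v. weight A v \<le> 0}" unfolding m_def using fin0 ne by (intro Min_in) auto
    have le: "m \<le> weight A l" for l
    proof (cases "weight A l \<le> 0")
      case True
      then show ?thesis unfolding m_def using fin0 by (intro Min_le) auto
    next
      case False
      then show ?thesis using m by auto
    qed
    have "Inf (range (weight A)) = m"
      by (rule cInf_eq_minimum) (use m le in auto)
    then have "min_weight A = m" by (simp add: min_weight_def)
    then show "\<exists>v. min_weight A = weight A v" "\<And>l. min_weight A \<le> weight A l" using m le by auto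
  qed
  have m0: "min_weight A \<le> 0" using m_min(2)[of 0] w0 by simp
  have empty: "sublevel A n = {}" if "n < min_weight A" for n
    by (rule sublevel_eq_empty) (use that m_min(2) in \<open>auto intro: less_le_trans\<close>)
  have nonempty: "sublevel A n \<noteq> {}" if "n \<ge> min_weight A" for n
    using sublevel_nonempty[of A _ n] m_min(1) that by fastforce
  have H_empty: "H b n = 0" if "n < min_weight A" for b n
    unfolding H_def using empty[OF that]
    by (intro trivial_group_rank trivial_homology_group_empty) simp

  \<comment> \<open>A level from which on \<open>S\<^sub>n\<close> has the ranks of a point\<close>
  define N where "N = Max (insert 0 ((\<lambda>(l, I). cube_weight A l I) ` cells 0 ?c))"
  \<comment> \<open>The inserted 0 keeps \<open>N\<close> nonnegative, so the geometric series also
    has coefficient 1 from \<open>N\<close> on, and the deviations from it are confined to the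
    finite range from \<open>min_weight A\<close> to \<open>N - 1\<close>.\<close>
  have N0: "0 \<le> N" unfolding N_def by (intro Max_ge) auto
  have N_ge: "cube_weight A l I \<le> N" if "(l, I) \<in> cells 0 ?c" for l I
    unfolding N_def using that by (intro Max_ge) (auto intro!: image_eqI[of _ _ "(l, I)"])
  have N_weight: "weight A l \<le> N" if "\<And>i. l $ i \<le> ?c $ i" for l
  proof -
    have v: "vertex l {} = l" by (simp add: vec_eq_iff)
    have "(l, {}) \<in> cells 0 ?c" using that by (simp add: cells_def)
    then have "cube_weight A l {} \<le> N" by (rule N_ge)
    then show ?thesis unfolding cube_weight_le_iff using v by auto
  qed
  have H_large: "H b n = (if b = 0 then 1 else 0)" if "n \<ge> N" for b n
  proof -
    have "weight A l \<le> n" if "\<And>i. l $ i \<le> ?c $ i" for l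
      using N_weight[OF that] \<open>n \<ge> N\<close> by linarith
    from sublevel_homology_large[OF ws this, of "int b"] show ?thesis unfolding H_def by simp
  qed
  have ec_large: "ec n = 1" if "n \<ge> N" for n
  proof -
    have "ec n = (\<Sum>b<Suc (NB n). (-1) ^ b * int (H b n))" by (rule ec_sum) simp
    also have "\<dots> = (\<Sum>b<Suc (NB n). if b = 0 then 1 else 0)"
      by (intro sum.cong) (simp_all add: H_large[OF that])
    finally show ?thesis by simp
  qed
  have ec_empty: "ec n = 0" if "n < min_weight A" for n
    using ec_sum[of n "NB n"] H_empty[OF that] by simp
  have H0_pos: "H 0 n \<ge> 1" if "n \<ge> min_weight A" for n
    using reduced_homology_rank(2)[of "top_of_set (sublevel A n)"] nonempty[OF that] fr[of 0 n]
    by (simp add: H_def)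

  \<comment> \<open>The coefficients of the limit series at \<open>T = 1\<close>\<close>
  define hp where "hp n = homology_poly (sublevel A n)" for n
  have hp_def': "hp n = Sum_any (\<lambda>b::nat. Polynomial.monom (int (H b n)) b)" for n
    by (simp add: hp_def homology_poly_def H_def)
  have Hz: "int (H b n) = 0" if "b \<ge> NB n" for b n using NB[OF that] by simp
  have hp_coeff: "poly.coeff (hp n) b = int (H b n)" for n b
    unfolding hp_def' by (rule coeff_Sum_any_monom(2)[OF Hz])
  have hp_eval: "poly (hp n) (-1) = ec n" for n
  proof -
    have "poly (hp n) (-1) = (\<Sum>b<NB n. int (H b n) * (-1) ^ b)"
      unfolding hp_def' by (rule coeff_Sum_any_monom(3)) (rule Hz)
    then show ?thesis unfolding ec_sum[OF order_refl] by (simp add: mult.commute)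
  qed
  have hp_empty: "hp n = 0" if "n < min_weight A" for n
    by (intro poly_eqI) (simp add: hp_coeff H_empty[OF that])

  define e where "e n d b = int (group_rank (E_infinity A d (int b + int d) n))" for n d and b :: nat
  define PE where "PE n = Sum_any (\<lambda>d. Polynomial.monom (Sum_any (\<lambda>b. Polynomial.monom (e n d b) b)) d)" for n
  have PE_eval: "poly (PE n) 1 = hp n" and PE_zero: "(\<And>b. H b n = 0) \<Longrightarrow> PE n = 0" for n
  proof -
    obtain D where D: "\<And>d. d \<ge> D \<Longrightarrow> sublevel A n \<inter> level_space d = {}"
      using sublevel_level_space_empty[OF ws] by blast
    have e_sum: "(\<Sum>d<D. e n d b) = int (H b n)" for b
    proof -
      have "(\<Sum>d<D. group_rank (E_infinity A d (int b + int d) n)) = H b n"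
        unfolding H_def by (rule E_infinity_rank_sum(1)[OF fr]) (rule D)
      then show ?thesis unfolding e_def by (simp flip: of_nat_sum)
    qed
    have e_large: "e n d b = 0" if "d \<ge> D" for d b
      unfolding e_def using E_infinity_rank_sum(2)[OF fr D that] by simp
    \<comment> \<open>Nonnegative ranks that add up to \<open>H b n\<close> vanish together with it,
      so the one degree bound \<open>NB n\<close> serves all \<open>d\<close>.\<close>
    have e_le: "e n d b \<le> int (H b n)" for d b
    proof (cases "d < D")
      case True
      then have "e n d b \<le> (\<Sum>d<D. e n d b)" 
        by (intro member_le_sum[of d "{..<D}" "\<lambda>d. e n d b"]) (auto simp: e_def)
      then show ?thesis using e_sum by simp
    next
      case False
      then show ?thesis using e_large by simp
    qed
    have e_zero: "e n d b = 0" if "H b n = 0" for d b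
      using e_le[of d b] that by (simp add: e_def)
    have inner: "Sum_any (\<lambda>b. Polynomial.monom (e n d b) b) = (\<Sum>b<NB n. Polynomial.monom (e n d b) b)" for d
      by (rule coeff_Sum_any_monom(1)) (rule e_zero, rule NB)
    have inner0: "Sum_any (\<lambda>b. Polynomial.monom (e n d b) b) = 0" if "d \<ge> D" for d
      unfolding inner using e_large[OF that] by simp
    have "poly (PE n) 1 = (\<Sum>d<D. Sum_any (\<lambda>b. Polynomial.monom (e n d b) b) * 1 ^ d)"
      unfolding PE_def by (rule coeff_Sum_any_monom(3)) (rule inner0)
    also have "\<dots> = (\<Sum>d<D. \<Sum>b<NB n. Polynomial.monom (e n d b) b)" by (simp only: inner power_one mult_1_right)
    also have "\<dots> = (\<Sum>b<NB n. \<Sum>d<D. Polynomial.monom (e n d b) b)" by (rule sum.swap)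
    also have "\<dots> = (\<Sum>b<NB n. Polynomial.monom (int (H b n)) b)"
    proof (rule sum.cong)
      fix b
      have "(\<Sum>d\<in>J. Polynomial.monom (e n d b) b) = Polynomial.monom (\<Sum>d\<in>J. e n d b) b" for J
        by (intro poly_eqI) (simp add: coeff_sum)
      then show "(\<Sum>d<D. Polynomial.monom (e n d b) b) = Polynomial.monom (int (H b n)) b" by (simp add: e_sum)
    qed simp
    also have "\<dots> = hp n" unfolding hp_def' by (rule coeff_Sum_any_monom(1)[OF Hz, symmetric])
    finally show "poly (PE n) 1 = hp n" .
    show "PE n = 0" if "\<And>b. H b n = 0"
      unfolding PE_def by (simp add: e_zero that)
  qed
  \<comment> \<open>A common lower bound for the supports of the series below, under which
    \<open>Abs_fls\<close> returns the prescribed coefficients.\<close>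
  have Abs_nth: "fls_nth (Abs_fls f) n = f n" if "\<And>n. n < min_weight A \<Longrightarrow> f n = 0"
    for f :: "int \<Rightarrow> 'z::zero" and n
    by (rule nth_Abs_fls_ex_lower_bound) (use that in blast)
  have PE_nth: "fls_nth (PE_infinity A) n = PE n" for n
  proof -
    have "PE_infinity A = Abs_fls PE"
      unfolding PE_infinity_def by (rule arg_cong[where f = Abs_fls]) (simp add: PE_def e_def fun_eq_iff)
    then show ?thesis using Abs_nth[of PE n] PE_zero H_empty by simp
  qed
  define P where "P = subst_T 1 (PE_infinity A)"
  have P_nth: "fls_nth P n = hp n" for n
    unfolding P_def subst_T_def by (simp add: fls_nth_map_fls PE_nth PE_eval)
  have P_chi: "fls_nth (subst_h (-1) P) n = ec n" for n
    unfolding subst_h_def by (simp add: fls_nth_map_fls P_nth hp_eval)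
  have P_0: "fls_nth (subst_h 0 P) n = int (H 0 n)" for n
    unfolding subst_h_def by (simp add: fls_nth_map_fls P_nth poly_0_coeff_0 hp_coeff)
  have geom: "fls_nth geometric_fls n = (if n \<ge> 0 then 1 else 0)" for n
    by (simp add: geometric_fls_def)

  \<comment> \<open>The Poincare series, the Euler characteristics and the count of cubes\<close>
  have a1: "P = Abs_fls (\<lambda>n. if n \<ge> min_weight A then homology_poly (sublevel A n) else 0)"
    by (rule fls_eqI) (subst Abs_nth, auto simp: P_nth hp_empty simp flip: hp_def)
  have a2: "P = lattice_homology_series A"
  proof -
    have "lattice_homology_series A = Abs_fls hp"
      unfolding lattice_homology_series_def
      by (rule arg_cong[where f = Abs_fls]) (simp add: hp_def' lattice_homology_part_def H_def fun_eq_iff)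
    then show ?thesis by (intro fls_eqI) (simp add: P_nth Abs_nth hp_empty)
  qed
  have b: "subst_h (-1) P = Abs_fls (\<lambda>n. if n \<ge> min_weight A then euler_char (sublevel A n) else 0)"
    by (rule fls_eqI) (subst Abs_nth, auto simp: P_chi ec_empty simp flip: ec_def)
  have c: "subst_h (-1) P = geometric_fls *
      (\<Sum>(l, I) \<in> {(l, I). cube l I \<subseteq> rectangle c'}. (-1) ^ card I * fls_X_intpow (cube_weight A l I))"
    if c': "\<forall>i. int (?c $ i) \<le> c' $ i" for c' :: "int ^ 'r"
  proof (rule fls_eqI)
    fix n
    define c2 :: "nat ^ 'r" where "c2 = (\<chi> i. nat (c' $ i))"
    have c0: "0 \<le> c' $ i" for i using c'[rule_format, of i] by linarith
    have set: "{(l, I). cube l I \<subseteq> rectangle c'} = cells 0 c2"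
      unfolding c2_def by (auto simp: cube_subset_rectangle_iff[OF c0])
    \<comment> \<open>Multiplied by the geometric series, \<open>Q ^ w\<close> becomes the indicator
      of \<open>w \<le> n\<close>; the coefficient at \<open>n\<close> thus counts with signs the
      cubes of the rectangle of weight at most \<open>n\<close>.\<close>
    have summand: "fls_nth (geometric_fls * ((-1) ^ card I * fls_X_intpow w)) n =
      (if w \<le> n then (-1) ^ card I else 0)" for I :: "'r set" and w
    proof -
      have "geometric_fls * ((-1) ^ card I * fls_X_intpow w) = (-1) ^ card I * fls_shift (- w) geometric_fls"
        by (simp only: mult.left_commute[of geometric_fls]) (simp only: fls_X_intpow_times_conv_shift(2))
      then show ?thesis by (cases "even (card I)") (simp_all add: geom)
    qed
    have "fls_nth (geometric_fls * (\<Sum>(l, I)\<in>cells 0 c2. (-1) ^ card I * fls_X_intpow (cube_weight A l I))) n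
      = (\<Sum>(l, I)\<in>cells 0 c2. if cube_weight A l I \<le> n then (-1) ^ card I else 0)"
      by (simp only: sum_distrib_left fls_nth_sum case_prod_unfold summand)
    also have "\<dots> = ec n"
    proof (rule ec_cells[symmetric])
      show "?c $ i \<le> c2 $ i" for i using c'[rule_format, of i] by (simp add: c2_def)
    qed
    finally show "fls_nth (subst_h (-1) P) n = fls_nth (geometric_fls *
      (\<Sum>(l, I) \<in> {(l, I). cube l I \<subseteq> rectangle c'}. (-1) ^ card I * fls_X_intpow (cube_weight A l I))) n"
      unfolding set P_chi by simp
  qed

  \<comment> \<open>The limit at 1, the delta invariant and the lattice Euler characteristic\<close>
  let ?J = "{min_weight A..<N}"
  \<comment> \<open>Outside \<open>?J\<close> the Euler characteristics coincide with the
    coefficients of the geometric series, so the difference is a Laurent polynomial and the limit is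
    the sum of its coefficients.\<close>
  have dlim: "(eval_fls (map_fls of_int (subst_h (-1) P - geometric_fls))
      \<longlongrightarrow> of_int (\<Sum>n\<in>?J. ec n - (if n \<ge> 0 then 1 else 0))) (at 1)"
  proof -
    let ?F = "map_fls of_int (subst_h (-1) P - geometric_fls) :: complex fls"
    have nth: "fls_nth ?F n = of_int (ec n - (if n \<ge> 0 then 1 else 0))" for n
      by (simp add: fls_nth_map_fls P_chi geom)
    have "(eval_fls ?F \<longlongrightarrow> (\<Sum>n\<in>?J. fls_nth ?F n)) (at 1)"
      by (rule eval_laurent_polynomial) (use m0 N0 in \<open>auto simp: nth ec_empty ec_large\<close>)
    then show ?thesis by (simp only: nth of_int_sum)
  qed
  have sumJ: "(\<Sum>n\<in>?J. ec n - (if n \<ge> 0 then 1 else 0)) = (\<Sum>n\<in>?J. ec n) - N"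
  proof -
    have "(\<Sum>n\<in>?J. if n \<ge> 0 then 1 else 0 :: int) = (\<Sum>n\<in>{0..<N}. 1)"
      using m0 by (intro sum.mono_neutral_cong_right) auto
    then show ?thesis using N0 by (simp add: sum_subtractf)
  qed
  have delta: "(\<Sum>n\<in>?J. ec n) - N = int (delta_invariant A)"
  proof -
    have "(\<Sum>n\<in>?J. ec n) = (\<Sum>(l, I)\<in>cells 0 ?c. \<Sum>n\<in>?J. if cube_weight A l I \<le> n then (-1) ^ card I else 0)"
      unfolding ec_cells[OF order_refl] case_prod_unfold by (rule sum.swap)
    \<comment> \<open>After the exchange of sums, a cube of weight \<open>w\<close> is present
      exactly at the levels from \<open>w\<close> to \<open>N - 1\<close> and is counted
      \<open>N - w\<close> times.\<close>
    also have "\<dots> = (\<Sum>(l, I)\<in>cells 0 ?c. (-1) ^ card I * N - (-1) ^ card I * cube_weight A l I)"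
    proof (rule sum.cong, rule refl, clarify)
      fix l I assume lI: "(l, I) \<in> cells 0 ?c"
      have "vertex l {} = l" by (simp add: vec_eq_iff)
      moreover have "\<forall>J\<subseteq>I. weight A (vertex l J) \<le> cube_weight A l I"
        using cube_weight_le_iff[of A l I "cube_weight A l I"] by blast
      ultimately have "weight A l \<le> cube_weight A l I" by (metis empty_subsetI)
      then have lo: "min_weight A \<le> cube_weight A l I" using m_min(2)[of l] by linarith
      have "(\<Sum>n\<in>?J. if cube_weight A l I \<le> n then (-1) ^ card I else 0) = (\<Sum>n\<in>{cube_weight A l I..<N}. (-1) ^ card I)"
        using lo by (intro sum.mono_neutral_cong_right) auto
      also have "\<dots> = (N - cube_weight A l I) * (-1) ^ card I" using N_ge[OF lI] by simp
      finally show "(\<Sum>n\<in>?J. if cube_weight A l I \<le> n then (-1) ^ card I else 0)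
        = (-1) ^ card I * N - (-1) ^ card I * cube_weight A l I" by (simp add: algebra_simps)
    qed
    also have "\<dots> = (\<Sum>(l, I)\<in>cells 0 ?c. (-1) ^ card I * N) - (\<Sum>(l, I)\<in>cells 0 ?c. (-1) ^ card I * cube_weight A l I)"
      by (simp add: case_prod_unfold sum_subtractf)
    \<comment> \<open>The box has Euler characteristic 1, so this term cancels the subtracted
      \<open>N\<close>.\<close>
    also have "(\<Sum>(l, I)\<in>cells 0 ?c. (-1) ^ card I * N) = N"
      by (rule sum_cells_bottom[where g = "\<lambda>_. N"]) simp
    also have "(\<Sum>(l, I)\<in>cells 0 ?c. (-1) ^ card I * cube_weight A l I) = int (hilbert_fun A ?c) - int (abs_sum ?c)"
      by (rule sum_cube_weights[OF sub])
    finally show ?thesis using delta_hilbert[OF sub conv cb] by simp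
  qed
  \<comment> \<open>Reducing \<open>H\<^sub>0\<close> subtracts 1 at each of the
    \<open>N - min_weight A\<close> levels in \<open>?J\<close>, and the term
    \<open>- min_weight A\<close> of \<open>lattice_eu\<close> turns this into \<open>- N\<close>.
    Levels outside \<open>?J\<close> add no rank: there \<open>S\<^sub>n\<close> is empty or has the
    ranks of a point.\<close>
  have eu: "lattice_eu A = (\<Sum>n\<in>?J. ec n) - N"
  proof -
    define r where "r q = int (group_rank (reduced_lattice_homology A q))" for q
    \<comment> \<open>One degree bound for the finitely many levels in \<open>?J\<close>; the
      \<open>Suc\<close> ensures that degree 0, which carries the correction, is in the
      range.\<close>
    define K where "K = Suc (\<Sum>n\<in>?J. NB n)"
    have K: "NB n \<le> K" if "n \<in> ?J" for n
      unfolding K_def using member_le_sum[of n ?J NB] that by simp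
    have rq: "r q = (\<Sum>n\<in>?J. int (H q n))" if "q > 0" for q
    proof -
      have "group_rank (sum_group UNIV (lattice_homology_part A q)) = (\<Sum>n\<in>?J. H q n)"
        unfolding H_def lattice_homology_part_def[symmetric]
      proof (rule group_rank_sum_group[THEN conjunct2])
        show "group_rank (lattice_homology_part A q n) = 0" if "n \<in> UNIV - ?J" for n
        proof -
          have "n < min_weight A \<or> N \<le> n" using that by auto
          then have "H q n = 0" using H_empty H_large \<open>q > 0\<close> by auto
          then show ?thesis by (simp add: H_def lattice_homology_part_def)
        qed
      qed (simp_all add: lattice_homology_part_def fr)
      then show ?thesis using that by (simp add: r_def reduced_lattice_homology_def lattice_homology_def)
    qed
    have r0: "r 0 = (\<Sum>n\<in>?J. int (H 0 n) - 1)"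
    proof -
      let ?R = "\<lambda>n. reduced_homology_group 0 (top_of_set (sublevel A n))"
      have R: "comm_group (?R n)" for n
        unfolding reduced_homology_group_def by (rule group.abelian_subgroup_generated) auto
      have rr: "finite_rank (?R n)" "H 0 n = group_rank (?R n) + 1" if "n \<ge> min_weight A" for n
        using reduced_homology_rank[of "top_of_set (sublevel A n)"] nonempty[OF that] fr[of 0 n]
        by (simp_all add: H_def)
      have "group_rank (sum_group {min_weight A..} ?R) = (\<Sum>n\<in>?J. group_rank (?R n))"
      proof (rule group_rank_sum_group[THEN conjunct2])
        show "group_rank (?R n) = 0" if "n \<in> {min_weight A..} - ?J" for n
        proof -
          have "min_weight A \<le> n" "N \<le> n" using that by auto
          then show ?thesis using rr(2)[of n] H_large[of n 0] by simp
        qed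
      qed (use R rr in auto)
      then have "r 0 = (\<Sum>n\<in>?J. int (group_rank (?R n)))" by (simp add: r_def reduced_lattice_homology_def)
      also have "\<dots> = (\<Sum>n\<in>?J. int (H 0 n) - 1)" by (intro sum.cong) (simp_all add: rr(2))
      finally show ?thesis .
    qed
    have rK: "r q = 0" if "q \<ge> K" for q
    proof -
      have "q > 0" using that by (simp add: K_def)
      moreover have "H q n = 0" if "n \<in> ?J" for n using NB K[OF that] \<open>q \<ge> K\<close> by simp
      ultimately show ?thesis by (simp add: rq)
    qed
    have "Sum_any (\<lambda>q. (-1) ^ q * r q) = (\<Sum>q<K. (-1) ^ q * r q)"
    proof (rule Sum_any.expand_superset)
      show "{q. (-1) ^ q * r q \<noteq> 0} \<subseteq> {..<K}"
      proof
        fix q assume "q \<in> {q. (-1) ^ q * r q \<noteq> 0}"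
        then have "r q \<noteq> 0" by auto
        then show "q \<in> {..<K}" using rK[of q] by (metis lessThan_iff not_less)
      qed
    qed simp
    also have "\<dots> = (\<Sum>q<K. \<Sum>n\<in>?J. (-1) ^ q * int (H q n) - (if q = 0 then 1 else 0))"
    proof (rule sum.cong)
      fix q
      show "(-1) ^ q * r q = (\<Sum>n\<in>?J. (-1) ^ q * int (H q n) - (if q = 0 then 1 else 0))"
        by (cases "q = 0") (simp_all add: r0 rq sum_distrib_left)
    qed simp
    also have "\<dots> = (\<Sum>n\<in>?J. \<Sum>q<K. (-1) ^ q * int (H q n) - (if q = 0 then 1 else 0))" by (rule sum.swap)
    also have "\<dots> = (\<Sum>n\<in>?J. ec n - 1)"
    proof (rule sum.cong)
      fix n assume n: "n \<in> ?J"
      have "(\<Sum>q<K. if q = 0 then 1 else 0 :: int) = 1" by (simp add: K_def)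
      then show "(\<Sum>q<K. (-1) ^ q * int (H q n) - (if q = 0 then 1 else 0)) = ec n - 1"
        using ec_sum[OF K[OF n]] by (simp add: sum_subtractf)
    qed simp
    also have "\<dots> = (\<Sum>n\<in>?J. ec n) - (N - min_weight A)" using m0 N0 by (simp add: sum_subtractf)
    finally show ?thesis by (simp add: lattice_eu_def r_def)
  qed

  \<comment> \<open>Comparison with the constant term in \<open>h\<close> and with the geometric
    series\<close>
  have Ch_coeff: "poly.coeff (fls_nth (const_h F) n) k = (if k = 0 then fls_nth F n else 0)" for F n k
    unfolding const_h_def by (simp add: fls_nth_map_fls coeff_pCons split: nat.split)
  have e1: "coeffs_ge P (const_h (subst_h 0 P))"
    unfolding coeffs_ge_def by (simp add: Ch_coeff P_0 P_nth hp_coeff)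
  have e2: "coeffs_ge (const_h (subst_h 0 P)) (const_h geometric_fls)"
    unfolding coeffs_ge_def
  proof (intro allI)
    fix n k
    \<comment> \<open>The minimal weight is at most 0, the weight of the origin, so these levels are
      nonempty and have a component.\<close>
    have "H 0 n \<ge> 1" if "n \<ge> 0" using H0_pos m0 that by simp
    then show "0 \<le> poly.coeff (fls_nth (const_h (subst_h 0 P) - const_h geometric_fls) n) k"
      by (auto simp: Ch_coeff P_0 geom)
  qed
  have e3: "finite {n. fls_nth (subst_h 0 P - geometric_fls) n \<noteq> 0}"
  proof (rule finite_subset)
    show "{n. fls_nth (subst_h 0 P - geometric_fls) n \<noteq> 0} \<subseteq> ?J"
    proof
      fix n assume n: "n \<in> {n. fls_nth (subst_h 0 P - geometric_fls) n \<noteq> 0}"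
      show "n \<in> ?J"
      proof (rule ccontr)
        assume "n \<notin> ?J"
        then consider "n < min_weight A" | "n \<ge> N" by force
        then show False
          using n m0 N0 H_empty[of n 0] H_large[of n 0] by cases (simp_all add: P_0 geom)
      qed
    qed
  qed simp
  have eu_delta: "lattice_eu A = int (delta_invariant A)" using eu delta by (rule trans)
  have dlim': "(eval_fls (map_fls of_int (subst_h (-1) P - geometric_fls)) \<longlongrightarrow> of_int (lattice_eu A)) (at 1)"
    using dlim unfolding sumJ eu .
  show ?thesis
    unfolding P_def[symmetric]
    by (intro conjI allI impI; (rule a1 | rule a2 | rule b | erule c | rule dlim' | rule eu_delta | rule e1 | rule e2 | rule e3))
qed

end
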